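(* Let $p\ge1$ be a fixed integer, $s\ge0$ an integer, $0<\gamma\le1$, and $\alpha=s+\gamma$. Consider the location-scale regression model of the context on $[0,1]^d$, with covariate density class $\mathcal H$, scale function class $\Sigma$ and error density $f$ as specified there, and suppose the regression function $\mu$ belongs to the multiple index class $\mathcal Q$ of all functions $$x\mapsto\lambda_1(\beta_{(1)}^Tx)+\lambda_2(\beta_{(2)}^Tx)+\cdots+\lambda_p(\beta_{(p)}^Tx),\quad x\in[0,1]^d,$$ where $\lambda_1,\dots,\lambda_p$ are non-constant functions in the Hölder class $\Lambda^{s,\gamma}(L)$ and $\beta_{(1)},\dots,\beta_{(p)}\in\mathbb R^d$ are distinct vectors with $\|\beta_{(i)}\|_2=1$. Then the minimax rate of convergence under the squared $L_2$ loss for estimating the regression function is $n^{-\frac{2\alpha}{2\alpha+1}}$, that is, $$\inf_{\hat\mu}\ \sup_{\mu\in\mathcal Q,\ \sigma\in\Sigma,\ h\in\mathcal H}\mathbb E\|\mu-\hat\mu\|_{2,h}^2\asymp n^{-\frac{2\alpha}{2\alpha+1}},$$ for all $\alpha>0$, the infimum being over all estimators based on $(X_i,Y_i)_{i=1}^n$.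
   Context: Model. $(X_i,Y_i)_{i=1}^n$ are i.i.d. with $Y_i=\mu(X_i)+\sigma(X_i)\epsilon_i$, $X_i\in[0,1]^d$ with density $h\in\mathcal H$, and $\epsilon_i$ independent of $X_i$ with known density $f$ on $\mathbb R$. $\mathcal H$ is the class of all densities $h$ on $[0,1]^d$ with $1/\overline C\le h(x)\le\overline C$, for a fixed constant $\overline C>1$. $\Sigma=\{x\mapsto\exp(\sum_{i=1}^dc_ix_i):\max_{1\le i\le d}|c_i|\le C'\}$ for a known constant $C'>0$. The error density $f$ is any one of the following, where $\rho_\tau(y)=y(\tau-I(y<0))$ and $\Gamma(t,k)=\int_k^\infty x^{t-1}e^{-x}dx$: (a) $f(y)=\tau(1-\tau)\exp[-\rho_\tau(y)]$, $0<\tau<1$; (b) $f(y)=\frac{\tau(1-\tau)}{\Gamma(a+1,a)}[a+\rho_\tau(y)]^a\exp\{-[a+\rho_\tau(y)]\}$, $0<\tau<1$, $a\ge0$; (c) $f(y)=\frac{2\tau}{\sqrt{2\pi}}e^{-y^2/2}I(y\le0)+\frac{1-\tau}{\beta}e^{-y/\beta}I(y>0)$, $0<\tau<1$, $\beta>0$, $\frac{1-\tau}{\beta}=\frac{2\tau}{\sqrt{2\pi}}$; (d) $f(y)=\frac1{\pi(1+y^2)}$; (e) $f(y)=\frac{2}{\sqrt\pi}\frac{\sqrt{\phi(1-\phi)}}{\sqrt\phi+\sqrt{1-\phi}}\exp[-\phi y^2I(y\ge0)-(1-\phi)y^2I(y<0)]$, $0<\phi<1$. Hölder class. $\Lambda^{s,\gamma}(L)$,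 with $L>0$ a constant, is the class of functions $\lambda:\mathbb R\to\mathbb R$ whose $s$-th derivative satisfies $|\lambda^{(s)}(z_1)-\lambda^{(s)}(z_2)|\le L|z_1-z_2|^\gamma$ for all $z_1,z_2\in\mathbb R$ and such that for each $0\le k\le s$ the $k$-th derivative is bounded in absolute value by a fixed constant, uniformly over the class. (The dimension $d$ and $p$ are such that $p$ distinct unit vectors exist in $\mathbb R^d$, i.e. $d\ge2$, or $d=1$ and $p\le2$.) No identifiability conditions are imposed on the index model. Notation. $\|\mu-\upsilon\|_{2,h}^2=\int(\mu(x)-\upsilon(x))^2h(x)\,dx$; $k_n\asymp s_n$ means $k_n=O(s_n)$ and $s_n=O(k_n)$ as $n\to\infty$, with $d,p,s,\gamma$, the constants and $f$ fixed. *)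

theory Defs
  imports "HOL-Probability.Probability" "HOL-Library.Landau_Symbols"
begin

subsection \<open>Error densities\<close>

definition pinball :: "real \<Rightarrow> real \<Rightarrow> real" where
  "pinball \<tau> y = y * (\<tau> - indicator {..<0} y)"

definition upper_incomplete_Gamma :: "real \<Rightarrow> real \<Rightarrow> real" where
  "upper_incomplete_Gamma t k = (LBINT x:{k..}. x powr (t - 1) * exp (- x))"

definition asym_laplace :: "real \<Rightarrow> real \<Rightarrow> real" where
  "asym_laplace \<tau> y = \<tau> * (1 - \<tau>) * exp (- pinball \<tau> y)"

text \<open>The case distinction restores the convention that a zeroth power is one:
  in HOL, \<open>0 powr 0 = 0\<close>, which would matter for \<open>a = 0\<close> at \<open>y = 0\<close>.\<close>

definition asym_gamma :: "real \<Rightarrow> real \<Rightarrow> real \<Rightarrow> real" where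
  "asym_gamma \<tau> a y =
     \<tau> * (1 - \<tau>) / upper_incomplete_Gamma (a + 1) a
     * (if a = 0 then 1 else (a + pinball \<tau> y) powr a)
     * exp (- (a + pinball \<tau> y))"

definition normal_exponential :: "real \<Rightarrow> real \<Rightarrow> real \<Rightarrow> real" where
  "normal_exponential \<tau> \<beta> y =
     2 * \<tau> / sqrt (2 * pi) * exp (- (y\<^sup>2) / 2) * indicator {..0} y
     + (1 - \<tau>) / \<beta> * exp (- y / \<beta>) * indicator {0<..} y"

definition standard_cauchy :: "real \<Rightarrow> real" where
  "standard_cauchy y = 1 / (pi * (1 + y\<^sup>2))"

definition asym_normal :: "real \<Rightarrow> real \<Rightarrow> real" where
  "asym_normal \<phi> y =
     2 / sqrt pi * (sqrt (\<phi> * (1 - \<phi>)) / (sqrt \<phi> + sqrt (1 - \<phi>)))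
     * exp (- \<phi> * y\<^sup>2 * indicator {0..} y - (1 - \<phi>) * y\<^sup>2 * indicator {..<0} y)"

definition error_densities :: "(real \<Rightarrow> real) set" where
  "error_densities =
     {asym_laplace \<tau> | \<tau>. 0 < \<tau> \<and> \<tau> < 1}
   \<union> {asym_gamma \<tau> a | \<tau> a. 0 < \<tau> \<and> \<tau> < 1 \<and> 0 \<le> a}
   \<union> {normal_exponential \<tau> \<beta> | \<tau> \<beta>.
        0 < \<tau> \<and> \<tau> < 1 \<and> 0 < \<beta> \<and> (1 - \<tau>) / \<beta> = 2 * \<tau> / sqrt (2 * pi)}
   \<union> {standard_cauchy}
   \<union> {asym_normal \<phi> | \<phi>. 0 < \<phi> \<and> \<phi> < 1}"

subsection \<open>Covariate densities, scale functions and regression functions\<close>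

text \<open>A density on the unit cube is represented as a density on the whole space that
  vanishes off the cube. Scale and regression functions are represented by their defining
  formula on the whole space; only their values on the cube enter the model and the loss.\<close>

definition covariate_densities :: "real \<Rightarrow> (real ^ 'd::finite \<Rightarrow> real) set" where
  "covariate_densities C =
     {h. h \<in> borel_measurable borel
       \<and> (\<forall>x\<in>cbox 0 1. 1 / C \<le> h x \<and> h x \<le> C)
       \<and> (\<forall>x. x \<notin> cbox 0 1 \<longrightarrow> h x = 0)
       \<and> (\<integral>\<^sup>+x. ennreal (h x) \<partial>lborel) = 1}"

definition scale_functions :: "real \<Rightarrow> (real ^ 'd::finite \<Rightarrow> real) set" where
  "scale_functions C' =
     {(\<lambda>x. exp (\<Sum>i\<in>UNIV. c $ i * x $ i)) | c. \<forall>i. \<bar>c $ i\<bar> \<le> C'}"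

text \<open>\<open>B k\<close> is the common bound on the \<open>k\<close>-th derivatives.\<close>

definition hoelder_class :: "nat \<Rightarrow> real \<Rightarrow> real \<Rightarrow> (nat \<Rightarrow> real) \<Rightarrow> (real \<Rightarrow> real) set" where
  "hoelder_class s \<gamma> L B =
     {g. (\<forall>k<s. \<forall>z. (deriv ^^ k) g differentiable at z)
       \<and> (\<forall>z\<^sub>1 z\<^sub>2. \<bar>(deriv ^^ s) g z\<^sub>1 - (deriv ^^ s) g z\<^sub>2\<bar> \<le> L * \<bar>z\<^sub>1 - z\<^sub>2\<bar> powr \<gamma>)
       \<and> (\<forall>k\<le>s. \<forall>z. \<bar>(deriv ^^ k) g z\<bar> \<le> B k)}"

definition multi_index_class ::
    "nat \<Rightarrow> nat \<Rightarrow> real \<Rightarrow> real \<Rightarrow> (nat \<Rightarrow> real) \<Rightarrow> (real ^ 'd::finite \<Rightarrow> real) set" where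
  "multi_index_class p s \<gamma> L B =
     {(\<lambda>x. \<Sum>i<p. g i (b i \<bullet> x)) | g b.
        (\<forall>i<p. g i \<in> hoelder_class s \<gamma> L B \<and> \<not> g i constant_on UNIV)
      \<and> (\<forall>i<p. norm (b i) = 1) \<and> inj_on b {..<p}}"

subsection \<open>Model, estimators and minimax risk\<close>

text \<open>Joint law of \<open>(X, \<mu> X + \<sigma> X * \<epsilon>)\<close> for independent \<open>X\<close> and \<open>\<epsilon>\<close> with densities \<open>h\<close> and \<open>f\<close>.\<close>

definition observation_law ::
    "(real \<Rightarrow> real) \<Rightarrow> (real ^ 'd::finite \<Rightarrow> real) \<Rightarrow> (real ^ 'd \<Rightarrow> real) \<Rightarrow> (real ^ 'd \<Rightarrow> real)
      \<Rightarrow> ((real ^ 'd) \<times> real) measure" where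
  "observation_law f \<mu> \<sigma> h =
     distr (density lborel (\<lambda>x. ennreal (h x)) \<Otimes>\<^sub>M density lborel (\<lambda>e. ennreal (f e))) borel
       (\<lambda>(x, e). (x, \<mu> x + \<sigma> x * e))"

definition sample_law ::
    "nat \<Rightarrow> (real \<Rightarrow> real) \<Rightarrow> (real ^ 'd::finite \<Rightarrow> real) \<Rightarrow> (real ^ 'd \<Rightarrow> real)
      \<Rightarrow> (real ^ 'd \<Rightarrow> real) \<Rightarrow> (nat \<Rightarrow> (real ^ 'd) \<times> real) measure" where
  "sample_law n f \<mu> \<sigma> h = PiM {..<n} (\<lambda>_. observation_law f \<mu> \<sigma> h)"

definition sq_loss ::
    "(real ^ 'd::finite \<Rightarrow> real) \<Rightarrow> (real ^ 'd \<Rightarrow> real) \<Rightarrow> (real ^ 'd \<Rightarrow> real) \<Rightarrow> ennreal" where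
  "sq_loss h \<mu> \<upsilon> = (\<integral>\<^sup>+x. ennreal ((\<mu> x - \<upsilon> x)\<^sup>2 * h x) \<partial>lborel)"

text \<open>Estimators are jointly measurable in the sample and the evaluation point, so that
  the loss is a measurable function of the sample.\<close>

definition estimators ::
    "nat \<Rightarrow> ((nat \<Rightarrow> (real ^ 'd::finite) \<times> real) \<Rightarrow> real ^ 'd \<Rightarrow> real) set" where
  "estimators n =
     {m. (\<lambda>(z, x). m z x) \<in> borel_measurable (PiM {..<n} (\<lambda>_. borel) \<Otimes>\<^sub>M borel)}"

definition risk ::
    "nat \<Rightarrow> (real \<Rightarrow> real) \<Rightarrow> ((nat \<Rightarrow> (real ^ 'd::finite) \<times> real) \<Rightarrow> real ^ 'd \<Rightarrow> real)
      \<Rightarrow> (real ^ 'd \<Rightarrow> real) \<Rightarrow> (real ^ 'd \<Rightarrow> real) \<Rightarrow> (real ^ 'd \<Rightarrow> real) \<Rightarrow> ennreal" where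
  "risk n f m \<mu> \<sigma> h = (\<integral>\<^sup>+z. sq_loss h \<mu> (m z) \<partial>sample_law n f \<mu> \<sigma> h)"

definition minimax_risk ::
    "nat \<Rightarrow> (real \<Rightarrow> real) \<Rightarrow> (real ^ 'd::finite \<Rightarrow> real) set \<Rightarrow> (real ^ 'd \<Rightarrow> real) set
      \<Rightarrow> (real ^ 'd \<Rightarrow> real) set \<Rightarrow> ennreal" where
  "minimax_risk n f Q S H =
     (INF m\<in>estimators n. SUP \<mu>\<in>Q. SUP \<sigma>\<in>S. SUP h\<in>H. risk n f m \<mu> \<sigma> h)"

end

theory Submission
  imports Defs
begin

text \<open>
  Lower bound: with uniform covariates and unit scale, perturb one ridge component by signed bumps
  \<open>\<plusminus> M powr - \<alpha> * sin (\<pi> M z) ^ (s + 2)\<close> on the \<open>M\<close> cells of a grid, where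
  \<open>M \<approx> n powr (1 / (2 \<alpha> + 1))\<close>, and apply Assouad's argument. All error densities have finite
  Fisher information for shifts, so flipping one sign changes the Hellinger affinity of the
  samples by a bounded amount only.

  Upper bound: the errors need not have a mean, so the responses are replaced by the indicators of
  \<open>Y \<le> 0\<close> and \<open>Y \<le> 1\<close>, whose regression functions are \<open>F ((t - \<mu> x) / \<sigma> x)\<close> for
  \<open>t = 0, 1\<close>, with \<open>F\<close> the known distribution function of the errors. The square loss is
  exp-concave on \<open>[0, 1]\<close>, so exponential weights over a net of pairs \<open>(\<mu>, \<sigma>)\<close>, averaged over
  the sample, have risk at most \<open>2 ln N / n\<close> plus the squared mesh, without knowledge of the
  covariate density. The metric entropy at mesh \<open>\<delta> powr \<alpha>\<close> is of order \<open>1 / \<delta>\<close>. Inverting \<open>F\<close>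
  recovers \<open>\<mu>\<close> from the two estimated regression functions.
\<close>

section \<open>Error densities\<close>

text \<open>Both bounds see the error law only through \<open>regular_error\<close>: the square
  integrable local Lipschitz constant of \<open>ln f\<close> controls Hellinger distances of shifts,
  while continuity and positivity of \<open>f\<close> make its distribution function bi-Lipschitz on
  compact intervals. Two thresholds are used because the scale is a second unknown at every
  covariate value. Balance in the lower bound: one sign moves the squared distance by order M powr
  -(2 \<alpha> + 1), and n times this must stay bounded; M cells together then lose order M powr -2
  \<alpha>. In the upper bound the entropy term is 1 / (\<delta> n) and the squared mesh is \<delta>
  powr 2 \<alpha>; they agree at \<delta> = n powr -1 / (2 \<alpha> + 1). The p directions and the
  scale vector require only meshes polynomial in \<delta>, so their entropy is of order ln (1 /
  \<delta>) and is absorbed by 1 / \<delta>: several indices cost no more than one, up to constants.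
  The estimator approximates the sum \<mu> uniformly and never its components, since different
  components can produce the same \<mu>.\<close>

abbreviation lborel_density :: "('a::euclidean_space \<Rightarrow> real) \<Rightarrow> 'a measure" where
  "lborel_density g \<equiv> density lborel (\<lambda>x. ennreal (g x))"

text \<open>Integrability of \<open>(W y)\<^sup>2 * f y\<close> plays the role of finite Fisher
  information for shifts, and the local bound on \<open>ln f\<close> also yields continuity of
  \<open>f\<close>. Increments are restricted to length at most one because Gaussian branches have
  log densities of unbounded slope.\<close>

definition regular_error :: "(real \<Rightarrow> real) \<Rightarrow> bool" where
  "regular_error f \<longleftrightarrow>
     f \<in> borel_measurable borel \<and> (\<forall>y. 0 < f y) \<and> (\<integral>\<^sup>+y. ennreal (f y) \<partial>lborel) = 1 \<and>
     (\<exists>W. W \<in> borel_measurable borel \<and> integrable lborel (\<lambda>y. (W y)\<^sup>2 * f y) \<and>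
        (\<forall>y y'. \<bar>y - y'\<bar> \<le> 1 \<longrightarrow> \<bar>ln (f y) - ln (f y')\<bar> \<le> W y * \<bar>y - y'\<bar>))"

section \<open>Half-line integrals for the normalising constants\<close>

lemma nn_integral_split_reflect:
  fixes g :: "real \<Rightarrow> ennreal"
  assumes [measurable]: "g \<in> borel_measurable borel"
  shows "(\<integral>\<^sup>+y. g y \<partial>lborel)
    = (\<integral>\<^sup>+y. g y * indicator {0..} y \<partial>lborel) + (\<integral>\<^sup>+y. g (- y) * indicator {0..} y \<partial>lborel)"
proof -
  have "(\<integral>\<^sup>+y. g y \<partial>lborel) = (\<integral>\<^sup>+y. g y * indicator {0..} y + g y * indicator {..<0} y \<partial>lborel)"
    by (intro nn_integral_cong) (auto split: split_indicator)
  also have "\<dots> = (\<integral>\<^sup>+y. g y * indicator {0..} y \<partial>lborel) + (\<integral>\<^sup>+y. g y * indicator {..<0} y \<partial>lborel)"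
    by (rule nn_integral_add) auto
  also have "(\<integral>\<^sup>+y. g y * indicator {..<0} y \<partial>lborel)
     = (\<integral>\<^sup>+y. g (- y) * indicator {..<0} (- y) \<partial>lborel)"
    by (subst nn_integral_real_affine[where c = "-1" and t = 0]) auto
  \<comment> \<open>Reflection produces the open half line; including 0 changes only a null
    set.\<close>
  also have "\<dots> = (\<integral>\<^sup>+y. g (- y) * indicator {0..} y \<partial>lborel)"
    using AE_lborel_singleton[of "0::real"]
    by (intro nn_integral_cong_AE) (auto elim!: eventually_mono split: split_indicator)
  finally show ?thesis .
qed

lemma nn_integral_half_exp:
  assumes "c > 0"
  shows "(\<integral>\<^sup>+y. ennreal (exp (- (c * y))) * indicator {0..} y \<partial>lborel) = ennreal (1 / c)"
proof -
  have "((\<lambda>y. - exp (- (c * y)) / c) \<longlongrightarrow> 0) at_top"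
  proof -
    have "((\<lambda>y. exp (- (c * y))) \<longlongrightarrow> 0) at_top"
      using assms by (intro filterlim_compose[OF exp_at_bot])
        (auto simp: filterlim_uminus_at_bot intro!: filterlim_tendsto_pos_mult_at_top[OF tendsto_const _ filterlim_ident])
    then have "((\<lambda>y. - exp (- (c * y)) / c) \<longlongrightarrow> - 0 / c) at_top"
      using assms by (intro tendsto_intros) auto
    then show ?thesis by simp
  qed
  then have "(\<integral>\<^sup>+y. ennreal (exp (- (c * y))) * indicator {0..} y \<partial>lborel)
      = ennreal (0 - (- exp (- (c * 0)) / c))"
    using assms
    by (intro nn_integral_FTC_atLeast) (auto intro!: derivative_eq_intros)
  then show ?thesis by simp
qed

lemma nn_integral_half_gauss:
  assumes "c > 0"
  shows "(\<integral>\<^sup>+y. ennreal (exp (- (c * y\<^sup>2))) * indicator {0..} y \<partial>lborel) = ennreal (sqrt pi / (2 * sqrt c))"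
proof -
  have "(\<integral>\<^sup>+y. ennreal (indicator {0..} y *\<^sub>R exp (- y\<^sup>2)) \<partial>lborel) = ennreal (sqrt pi / 2)"
    using gaussian_moment_0
    by (subst nn_integral_eq_integral)
       (auto simp: has_bochner_integral_iff intro!: AE_I2 split: split_indicator)
  moreover have "(\<integral>\<^sup>+y. ennreal (indicator {0..} y *\<^sub>R exp (- y\<^sup>2)) \<partial>lborel) =
     ennreal (sqrt c) * (\<integral>\<^sup>+y. ennreal (indicator {0..} (sqrt c * y) *\<^sub>R exp (- (sqrt c * y)\<^sup>2)) \<partial>lborel)"
    using assms by (subst nn_integral_real_affine[where c = "sqrt c" and t = 0]) auto
  moreover have "(\<integral>\<^sup>+y. ennreal (indicator {0..} (sqrt c * y) *\<^sub>R exp (- (sqrt c * y)\<^sup>2)) \<partial>lborel)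
     = (\<integral>\<^sup>+y. ennreal (exp (- (c * y\<^sup>2))) * indicator {0..} y \<partial>lborel)" (is "_ = ?I")
    using assms
    by (intro nn_integral_cong) (auto simp: power_mult_distrib zero_le_mult_iff split: split_indicator)
  ultimately have "ennreal (sqrt c) * ?I = ennreal (sqrt pi / 2)" by simp
  then have "ennreal (1 / sqrt c) * (ennreal (sqrt c) * ?I) = ennreal (1 / sqrt c) * ennreal (sqrt pi / 2)" by simp
  then show ?thesis
    using assms by (simp add: mult.assoc[symmetric] ennreal_mult'[symmetric])
qed

lemma nn_integral_half_cauchy:
  "(\<integral>\<^sup>+y. ennreal (1 / (pi * (1 + y\<^sup>2))) * indicator {0..} y \<partial>lborel) = ennreal (1 / 2)"
proof -
  have *: "((\<lambda>y. arctan y / pi) \<longlongrightarrow> (pi / 2) / pi) at_top"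
    by (intro tendsto_intros tendsto_arctan_at_top) auto
  have d: "DERIV (\<lambda>y. arctan y / pi) y :> 1 / (pi * (1 + y\<^sup>2))" for y
    by (rule DERIV_cong[OF DERIV_cdivide[OF DERIV_arctan]]) (auto simp: field_simps)
  have "(\<integral>\<^sup>+y. ennreal (1 / (pi * (1 + y\<^sup>2))) * indicator {0..} y \<partial>lborel)
     = ennreal ((pi / 2) / pi - arctan 0 / pi)"
    by (intro nn_integral_FTC_atLeast[OF _ d _ *]) auto
  then show ?thesis by simp
qed

lemma integrable_exp_neg_abs:
  assumes "k > 0"
  shows "integrable lborel (\<lambda>y::real. exp (- (k * \<bar>y\<bar>)))"
proof (rule integrableI_bounded)
  have "(\<integral>\<^sup>+y. ennreal (norm (exp (- (k * \<bar>y\<bar>)))) \<partial>lborel)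
     = (\<integral>\<^sup>+y. ennreal (exp (- (k * y))) * indicator {0..} y \<partial>lborel)
     + (\<integral>\<^sup>+y. ennreal (exp (- (k * y))) * indicator {0..} y \<partial>lborel)"
    by (subst nn_integral_split_reflect)
       (auto intro!: arg_cong2[where f = "(+)"] nn_integral_cong split: split_indicator)
  also have "\<dots> < \<infinity>"
    by (simp add: nn_integral_half_exp assms)
  finally show "(\<integral>\<^sup>+y. ennreal (norm (exp (- (k * \<bar>y\<bar>)))) \<partial>lborel) < \<infinity>" .
qed auto

text \<open>Half of the exponential decay absorbs the quadratic factor:
  \<open>t\<^sup>2 / 2 \<le> exp t\<close> at \<open>t = k * (A + 2 * \<bar>y\<bar>) / 4\<close>
  leaves a multiple of \<open>exp (- (k / 2 * \<bar>y\<bar>))\<close>.\<close>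

lemma integrable_quadratic_exp_neg_abs:
  assumes k: "k > 0" and A: "A \<ge> 0"
  shows "integrable lborel (\<lambda>y::real. (A + 2 * \<bar>y\<bar>)\<^sup>2 * exp (- (k * \<bar>y\<bar>)))"
proof (rule Bochner_Integration.integrable_bound)
  let ?C = "32 / k\<^sup>2 * exp (k * A / 4)"
  show "integrable lborel (\<lambda>y::real. ?C * exp (- (k / 2 * \<bar>y\<bar>)))"
    using integrable_exp_neg_abs[of "k/2"] k by auto
  show "AE y in lborel. norm ((A + 2 * \<bar>y\<bar>)\<^sup>2 * exp (- (k * \<bar>y\<bar>))) \<le> norm (?C * exp (- (k / 2 * \<bar>y\<bar>)))"
  proof (rule AE_I2)
    fix y :: real
    let ?t = "k * (A + 2 * \<bar>y\<bar>) / 4"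
    have t: "?t \<ge> 0" using k A by auto
    have "?t\<^sup>2 / 2 \<le> exp ?t"
      using exp_lower_Taylor_quadratic[OF t] t by simp
    then have "(A + 2 * \<bar>y\<bar>)\<^sup>2 \<le> 32 / k\<^sup>2 * exp ?t"
      using k by (simp add: field_simps power2_eq_square)
    also have "exp ?t = exp (k * A / 4) * exp (k / 2 * \<bar>y\<bar>)"
      by (simp add: exp_add[symmetric] field_simps)
    finally have "(A + 2 * \<bar>y\<bar>)\<^sup>2 * exp (- (k * \<bar>y\<bar>))
        \<le> (32 / k\<^sup>2 * (exp (k * A / 4) * exp (k / 2 * \<bar>y\<bar>))) * exp (- (k * \<bar>y\<bar>))"
      by (intro mult_right_mono) auto
    also have "\<dots> = ?C * (exp (k / 2 * \<bar>y\<bar>) * exp (- (k * \<bar>y\<bar>)))" by simp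
    also have "exp (k / 2 * \<bar>y\<bar>) * exp (- (k * \<bar>y\<bar>)) = exp (- (k / 2 * \<bar>y\<bar>))"
      by (simp add: exp_add[symmetric])
    finally show "norm ((A + 2 * \<bar>y\<bar>)\<^sup>2 * exp (- (k * \<bar>y\<bar>))) \<le> norm (?C * exp (- (k / 2 * \<bar>y\<bar>)))"
      using k by (simp add: abs_mult)
  qed
qed auto

text \<open>A constant \<open>W\<close> suffices for a globally Lipschitz log density; this covers
  the Laplace, gamma and Cauchy families.\<close>

lemma regular_errorI_Lipschitz:
  assumes [measurable]: "f \<in> borel_measurable borel" and pos: "\<And>y. 0 < f y"
    and int: "(\<integral>\<^sup>+y. ennreal (f y) \<partial>lborel) = 1"
    and lip: "\<And>y y'. \<bar>ln (f y) - ln (f y')\<bar> \<le> K * \<bar>y - y'\<bar>"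
  shows "regular_error f"
proof -
  have "integrable lborel f"
    using int pos by (intro integrableI_nonneg) (auto simp: less_imp_le)
  then show ?thesis
    unfolding regular_error_def using assms
    by (intro conjI allI exI[of _ "\<lambda>_. K"]) auto
qed

text \<open>Serves the densities with a Gaussian branch: the slope of \<open>ln f\<close> grows
  linearly, and the exponential tail makes its square integrable against \<open>f\<close>.\<close>

lemma regular_errorI_exp_tail:
  assumes [measurable]: "f \<in> borel_measurable borel" and pos: "\<And>y. 0 < f y"
    and int: "(\<integral>\<^sup>+y. ennreal (f y) \<partial>lborel) = 1"
    and k: "k > 0" and tail: "\<And>y. f y \<le> C * exp (- (k * \<bar>y\<bar>))"
    and A: "A \<ge> 0"
    and lip: "\<And>y y'. \<bar>y - y'\<bar> \<le> 1 \<Longrightarrow> \<bar>ln (f y) - ln (f y')\<bar> \<le> (A + 2 * \<bar>y\<bar>) * \<bar>y - y'\<bar>"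
  shows "regular_error f"
proof -
  have "integrable lborel (\<lambda>y. (A + 2 * \<bar>y\<bar>)\<^sup>2 * f y)"
  proof (rule Bochner_Integration.integrable_bound)
    show "integrable lborel (\<lambda>y. C * ((A + 2 * \<bar>y\<bar>)\<^sup>2 * exp (- (k * \<bar>y\<bar>))))"
      by (intro integrable_mult_right integrable_quadratic_exp_neg_abs k A)
    show "AE y in lborel. norm ((A + 2 * \<bar>y\<bar>)\<^sup>2 * f y)
        \<le> norm (C * ((A + 2 * \<bar>y\<bar>)\<^sup>2 * exp (- (k * \<bar>y\<bar>))))"
    proof (rule AE_I2)
      fix y
      have "(A + 2 * \<bar>y\<bar>)\<^sup>2 * f y \<le> (A + 2 * \<bar>y\<bar>)\<^sup>2 * (C * exp (- (k * \<bar>y\<bar>)))"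
        by (intro mult_left_mono tail) auto
      also have "\<dots> = C * ((A + 2 * \<bar>y\<bar>)\<^sup>2 * exp (- (k * \<bar>y\<bar>)))" by simp
      finally show "norm ((A + 2 * \<bar>y\<bar>)\<^sup>2 * f y) \<le> norm (C * ((A + 2 * \<bar>y\<bar>)\<^sup>2 * exp (- (k * \<bar>y\<bar>))))"
        using pos[of y] by simp
    qed
  qed auto
  then show ?thesis
    unfolding regular_error_def using assms
    by (intro conjI allI exI[of _ "\<lambda>y. A + 2 * \<bar>y\<bar>"]) auto
qed

section \<open>The five error families\<close>

lemma pinball_eq_max:
  "pinball \<tau> y = max (\<tau> * y) ((\<tau> - 1) * y)"
  by (auto simp: pinball_def max_def algebra_simps split: split_indicator)

lemma pinball_nonneg: "0 \<le> \<tau> \<Longrightarrow> \<tau> \<le> 1 \<Longrightarrow> 0 \<le> pinball \<tau> y"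
  by (auto simp: pinball_def zero_le_mult_iff split: split_indicator)

lemma pinball_Lipschitz:
  assumes "0 \<le> \<tau>" "\<tau> \<le> 1"
  shows "\<bar>pinball \<tau> y - pinball \<tau> y'\<bar> \<le> \<bar>y - y'\<bar>"
proof -
  have "\<bar>\<tau> * y - \<tau> * y'\<bar> \<le> \<bar>y - y'\<bar>" "\<bar>(\<tau> - 1) * y - (\<tau> - 1) * y'\<bar> \<le> \<bar>y - y'\<bar>"
    using assms by (auto simp: right_diff_distrib[symmetric] abs_mult intro!: mult_left_le_one_le)
  then show ?thesis unfolding pinball_eq_max by linarith
qed

lemma borel_measurable_pinball [measurable]: "pinball \<tau> \<in> borel_measurable borel"
  unfolding pinball_def[abs_def] by measurable

lemma regular_error_asym_laplace:
  assumes "0 < \<tau>" "\<tau> < 1"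
  shows "regular_error (asym_laplace \<tau>)"
proof (rule regular_errorI_Lipschitz[where K = 1])
  show "asym_laplace \<tau> \<in> borel_measurable borel"
    unfolding asym_laplace_def[abs_def] by measurable
  show "0 < asym_laplace \<tau> y" for y
    using assms by (auto simp: asym_laplace_def)
  have "(\<integral>\<^sup>+y. ennreal (exp (- pinball \<tau> y)) \<partial>lborel)
     = (\<integral>\<^sup>+y. ennreal (exp (- (\<tau> * y))) * indicator {0..} y \<partial>lborel)
     + (\<integral>\<^sup>+y. ennreal (exp (- ((1 - \<tau>) * y))) * indicator {0..} y \<partial>lborel)"
    by (subst nn_integral_split_reflect)
       (auto intro!: arg_cong2[where f = "(+)"] nn_integral_cong simp: pinball_def algebra_simps split: split_indicator)
  also have "\<dots> = ennreal (1 / \<tau> + 1 / (1 - \<tau>))"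
    using assms by (simp add: nn_integral_half_exp)
  finally show "(\<integral>\<^sup>+y. ennreal (asym_laplace \<tau> y) \<partial>lborel) = 1"
    using assms by (simp add: asym_laplace_def ennreal_mult' nn_integral_cmult)
      (simp add: ennreal_mult'[symmetric] ennreal_plus[symmetric] field_simps ennreal_1[symmetric] del: ennreal_plus ennreal_1)
  show "\<bar>ln (asym_laplace \<tau> y) - ln (asym_laplace \<tau> y')\<bar> \<le> 1 * \<bar>y - y'\<bar>" for y y'
    using assms pinball_Lipschitz[of \<tau> y y'] by (simp add: asym_laplace_def ln_mult abs_minus_commute)
qed

lemma regular_error_standard_cauchy: "regular_error standard_cauchy"
proof (rule regular_errorI_Lipschitz[where K = 1])
  show "standard_cauchy \<in> borel_measurable borel"
    unfolding standard_cauchy_def[abs_def] by measurable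
  have p: "1 + y\<^sup>2 > 0" for y :: real by (smt (verit) zero_le_power2)
  show "0 < standard_cauchy y" for y
    using p by (auto simp: standard_cauchy_def)
  have "(\<integral>\<^sup>+y. ennreal (standard_cauchy y) \<partial>lborel) = ennreal (1/2) + ennreal (1/2)"
    unfolding standard_cauchy_def
    by (subst nn_integral_split_reflect) (auto simp: nn_integral_half_cauchy)
  then show "(\<integral>\<^sup>+y. ennreal (standard_cauchy y) \<partial>lborel) = 1"
    by (subst (asm) ennreal_plus[symmetric]) auto
  show "\<bar>ln (standard_cauchy y) - ln (standard_cauchy y')\<bar> \<le> 1 * \<bar>y - y'\<bar>" for y y' :: real
  proof -
    have "norm (ln (1 + y\<^sup>2) - ln (1 + y'\<^sup>2)) \<le> 1 * norm (y - y')"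
    proof (rule field_differentiable_bound[where S = UNIV and f' = "\<lambda>y. 2 * y / (1 + y\<^sup>2)"])
      show "((\<lambda>y. ln (1 + y\<^sup>2)) has_field_derivative 2 * z / (1 + z\<^sup>2)) (at z within UNIV)" for z :: real
        using p[of z] by (auto intro!: derivative_eq_intros simp: field_simps)
      show "norm (2 * z / (1 + z\<^sup>2)) \<le> 1" for z :: real
      proof -
        have "0 \<le> (\<bar>z\<bar> - 1)\<^sup>2" by simp
        then have "2 * \<bar>z\<bar> \<le> 1 + z\<^sup>2" by (simp add: power2_eq_square algebra_simps abs_mult_self_eq)
        then show ?thesis using p[of z] by (simp add: abs_mult)
      qed
    qed auto
    then show ?thesis
      using p[of y] p[of y'] by (simp add: standard_cauchy_def ln_div ln_mult abs_minus_commute)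
  qed
qed

lemma regular_error_asym_normal:
  assumes "0 < \<phi>" "\<phi> < 1"
  shows "regular_error (asym_normal \<phi>)"
proof -
  define c where "c = 2 / sqrt pi * (sqrt (\<phi> * (1 - \<phi>)) / (sqrt \<phi> + sqrt (1 - \<phi>)))"
  define w where "w y = (if y < 0 then 1 - \<phi> else \<phi>)" for y :: real
  define k where "k = min \<phi> (1 - \<phi>)"
  have k: "0 < k" "k \<le> w y" "w y \<le> 1" for y using assms by (auto simp: k_def w_def)
  have c: "c > 0" using assms unfolding c_def
    by (intro mult_pos_pos divide_pos_pos add_pos_pos) auto
  have f: "asym_normal \<phi> y = c * exp (- (w y * y\<^sup>2))" for y
    by (auto simp: asym_normal_def c_def w_def split: split_indicator)
  have [measurable]: "w \<in> borel_measurable borel" unfolding w_def[abs_def] by measurable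
  show ?thesis
  proof (rule regular_errorI_exp_tail[where k = k and A = 1 and C = "c * exp 1"])
    show "asym_normal \<phi> \<in> borel_measurable borel" unfolding f by measurable
    show "0 < asym_normal \<phi> y" for y using c by (simp add: f)
    have "(\<integral>\<^sup>+y. ennreal (exp (- (w y * y\<^sup>2))) \<partial>lborel)
     = (\<integral>\<^sup>+y. ennreal (exp (- (\<phi> * y\<^sup>2))) * indicator {0..} y \<partial>lborel)
     + (\<integral>\<^sup>+y. ennreal (exp (- ((1 - \<phi>) * y\<^sup>2))) * indicator {0..} y \<partial>lborel)"
      by (subst nn_integral_split_reflect)
        (auto intro!: arg_cong2[where f = "(+)"] nn_integral_cong simp: w_def split: split_indicator)
    also have "\<dots> = ennreal (sqrt pi / (2 * sqrt \<phi>) + sqrt pi / (2 * sqrt (1 - \<phi>)))"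
      using assms by (simp add: nn_integral_half_gauss)
    finally have "(\<integral>\<^sup>+y. ennreal (asym_normal \<phi> y) \<partial>lborel)
       = ennreal (c * (sqrt pi / (2 * sqrt \<phi>) + sqrt pi / (2 * sqrt (1 - \<phi>))))"
      using c by (simp add: f ennreal_mult' nn_integral_cmult)
    also have "c * (sqrt pi / (2 * sqrt \<phi>) + sqrt pi / (2 * sqrt (1 - \<phi>))) = 1"
    proof -
      have p: "sqrt \<phi> > 0" "sqrt (1 - \<phi>) > 0" "sqrt pi > 0" using assms by auto
      then have "sqrt \<phi> + sqrt (1 - \<phi>) \<noteq> 0" by linarith
      with p show ?thesis
        by (simp add: c_def real_sqrt_mult divide_simps) (simp add: algebra_simps)
    qed
    finally show "(\<integral>\<^sup>+y. ennreal (asym_normal \<phi> y) \<partial>lborel) = 1" by simp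
    show "asym_normal \<phi> y \<le> c * exp 1 * exp (- (k * \<bar>y\<bar>))" for y
    proof -
      have "0 \<le> (\<bar>y\<bar> - 1)\<^sup>2" by simp
      then have "\<bar>y\<bar> \<le> y\<^sup>2 + 1"
        by (simp add: power2_eq_square algebra_simps abs_mult_self_eq)
      then have "k * \<bar>y\<bar> \<le> k * y\<^sup>2 + k"
        using k by (metis distrib_left less_imp_le mult.right_neutral mult_left_mono)
      also have "\<dots> \<le> w y * y\<^sup>2 + 1"
        using k(2)[of y] k(3)[of y] by (intro add_mono mult_right_mono) auto
      finally have "- (w y * y\<^sup>2) \<le> 1 + - (k * \<bar>y\<bar>)" by simp
      then have "exp (- (w y * y\<^sup>2)) \<le> exp 1 * exp (- (k * \<bar>y\<bar>))"
        by (subst exp_add[symmetric]) simp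
      then show ?thesis using c by (simp add: f)
    qed
    show "\<bar>ln (asym_normal \<phi> y) - ln (asym_normal \<phi> y')\<bar> \<le> (1 + 2 * \<bar>y\<bar>) * \<bar>y - y'\<bar>"
      if d: "\<bar>y - y'\<bar> \<le> 1" for y y'
    proof -
      have "\<bar>w y * y\<^sup>2 - w y' * y'\<^sup>2\<bar> \<le> (1 + 2 * \<bar>y\<bar>) * \<bar>y - y'\<bar>"
      proof (cases "w y = w y'")
        case True
        have "\<bar>w y * y\<^sup>2 - w y' * y'\<^sup>2\<bar> = w y * (\<bar>y + y'\<bar> * \<bar>y - y'\<bar>)"
          using k(1) k(2)[of y] True
          by (simp add: right_diff_distrib[symmetric] abs_mult power2_eq_square square_diff_square_factored)
        also have "\<dots> \<le> 1 * (\<bar>y + y'\<bar> * \<bar>y - y'\<bar>)"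
          using k by (intro mult_right_mono) auto
        also have "\<dots> \<le> (1 + 2 * \<bar>y\<bar>) * \<bar>y - y'\<bar>"
          using d by (simp, intro mult_right_mono) auto
        finally show ?thesis .
      next
        \<comment> \<open>Different weights put the two points on opposite sides of 0, so each is
          within \<open>\<bar>y - y'\<bar> \<le> 1\<close> of 0 and its square is at most that
          distance.\<close>
        case False
        have b: "0 \<le> w z * z\<^sup>2" "w z * z\<^sup>2 \<le> 1 * z\<^sup>2" for z
          using k(1) k(2)[of z] mult_right_mono[OF k(3)[of z], of "z\<^sup>2"]
          by (auto simp: zero_le_mult_iff)
        have "\<bar>y\<bar> \<le> \<bar>y - y'\<bar>" "\<bar>y'\<bar> \<le> \<bar>y - y'\<bar>"
          using False by (auto simp: w_def split: if_splits)
        then have "y\<^sup>2 \<le> \<bar>y - y'\<bar>\<^sup>2" "y'\<^sup>2 \<le> \<bar>y - y'\<bar>\<^sup>2"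
          using abs_le_square_iff[of _ "y - y'"] by auto
        moreover have "\<bar>y - y'\<bar>\<^sup>2 \<le> 1 * \<bar>y - y'\<bar>"
          unfolding power2_eq_square using d by (intro mult_right_mono) auto
        moreover have "1 * \<bar>y - y'\<bar> \<le> (1 + 2 * \<bar>y\<bar>) * \<bar>y - y'\<bar>"
          by (intro mult_right_mono) auto
        ultimately show ?thesis using b[of y] b[of y'] by linarith
      qed
      then show ?thesis using c by (simp add: f ln_mult abs_minus_commute)
    qed
  qed (use k in auto)
qed

text \<open>The matching condition \<open>eq\<close> gives both branches the same height
  \<open>c\<close> at 0. The density is therefore \<open>c * exp (- q y)\<close> with a continuous
  exponent, as the local Lipschitz bound on its logarithm demands.\<close>

lemma regular_error_normal_exponential:
  assumes "0 < \<tau>" "\<tau> < 1" "0 < \<beta>" and eq: "(1 - \<tau>) / \<beta> = 2 * \<tau> / sqrt (2 * pi)"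
  shows "regular_error (normal_exponential \<tau> \<beta>)"
proof -
  define c where "c = 2 * \<tau> / sqrt (2 * pi)"
  define q where "q y = (if y \<le> 0 then y\<^sup>2 / 2 else y / \<beta>)" for y :: real
  define k where "k = min 1 (1 / \<beta>)"
  have c: "c > 0" using assms by (auto simp: c_def)
  have k: "0 < k" "k \<le> 1" "k \<le> 1 / \<beta>" using assms by (auto simp: k_def)
  have f: "normal_exponential \<tau> \<beta> y = c * exp (- q y)" for y
    using eq by (auto simp: normal_exponential_def c_def[symmetric] q_def split: split_indicator)
  have [measurable]: "q \<in> borel_measurable borel" unfolding q_def[abs_def] by measurable
  show ?thesis
  proof (rule regular_errorI_exp_tail[where k = k and A = "1 + 1 / \<beta>" and C = "c * exp 1"])
    show "normal_exponential \<tau> \<beta> \<in> borel_measurable borel" unfolding f by measurable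
    show "0 < normal_exponential \<tau> \<beta> y" for y using c by (simp add: f)
    have "(\<integral>\<^sup>+y. ennreal (exp (- q y)) \<partial>lborel)
     = (\<integral>\<^sup>+y. ennreal (exp (- (1 / \<beta> * y))) * indicator {0..} y \<partial>lborel)
     + (\<integral>\<^sup>+y. ennreal (exp (- (1 / 2 * y\<^sup>2))) * indicator {0..} y \<partial>lborel)"
      by (subst nn_integral_split_reflect)
        (auto intro!: arg_cong2[where f = "(+)"] nn_integral_cong simp: q_def split: split_indicator)
    also have "\<dots> = ennreal (1 / (1 / \<beta>) + sqrt pi / (2 * sqrt (1 / 2)))"
      using assms nn_integral_half_exp[of "1 / \<beta>"] nn_integral_half_gauss[of "1 / 2"] by simp
    finally have "(\<integral>\<^sup>+y. ennreal (normal_exponential \<tau> \<beta> y) \<partial>lborel)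
       = ennreal (c * (1 / (1 / \<beta>) + sqrt pi / (2 * sqrt (1 / 2))))"
      using c by (simp add: f ennreal_mult' nn_integral_cmult)
    also have "c * (1 / (1 / \<beta>) + sqrt pi / (2 * sqrt (1 / 2))) = c * \<beta> + c * (sqrt (2 * pi) / 2)"
      by (simp add: real_sqrt_mult real_sqrt_divide field_simps)
    also have "c * \<beta> = 1 - \<tau>" using eq assms unfolding c_def[symmetric] by (simp add: field_simps)
    also have "c * (sqrt (2 * pi) / 2) = \<tau>" by (simp add: c_def)
    finally show "(\<integral>\<^sup>+y. ennreal (normal_exponential \<tau> \<beta> y) \<partial>lborel) = 1" by simp
    show "normal_exponential \<tau> \<beta> y \<le> c * exp 1 * exp (- (k * \<bar>y\<bar>))" for y
    proof -
      have "k * \<bar>y\<bar> \<le> q y + 1"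
      proof (cases "y \<le> 0")
        case True
        have "k * \<bar>y\<bar> \<le> 1 * \<bar>y\<bar>" using k by (intro mult_right_mono) auto
        moreover have "0 \<le> (\<bar>y\<bar> - 1)\<^sup>2" by simp
        then have "\<bar>y\<bar> \<le> y\<^sup>2 / 2 + 1"
          by (simp add: power2_eq_square algebra_simps abs_mult_self_eq)
        ultimately show ?thesis using True by (simp add: q_def)
      next
        case False
        have "k * \<bar>y\<bar> \<le> 1 / \<beta> * \<bar>y\<bar>" using k by (intro mult_right_mono) auto
        then show ?thesis using False by (simp add: q_def)
      qed
      then have "- q y \<le> 1 + - (k * \<bar>y\<bar>)" by simp
      then have "exp (- q y) \<le> exp 1 * exp (- (k * \<bar>y\<bar>))"
        by (subst exp_add[symmetric]) simp
      then show ?thesis using c by (simp add: f)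
    qed
    show "\<bar>ln (normal_exponential \<tau> \<beta> y) - ln (normal_exponential \<tau> \<beta> y')\<bar>
        \<le> (1 + 1 / \<beta> + 2 * \<bar>y\<bar>) * \<bar>y - y'\<bar>"
      if d: "\<bar>y - y'\<bar> \<le> 1" for y y'
    proof -
      \<comment> \<open>Across 0 the two values of \<open>q\<close> are bounded separately, each
        point being within \<open>\<bar>u - v\<bar>\<close> of 0.\<close>
      have mixed: "\<bar>q u - q v\<bar> \<le> \<bar>u - v\<bar> + 1 / \<beta> * \<bar>u - v\<bar>"
        if "u \<le> 0" "0 < v" "\<bar>u - v\<bar> \<le> 1" for u v
      proof -
        have "u\<^sup>2 / 2 \<le> \<bar>u\<bar> * \<bar>u\<bar>" by (simp add: power2_eq_square)
        also have "\<dots> \<le> 1 * \<bar>u - v\<bar>" using that by (intro mult_mono) auto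
        finally have "u\<^sup>2 / 2 \<le> \<bar>u - v\<bar>" by simp
        moreover have "1 / \<beta> * v \<le> 1 / \<beta> * \<bar>u - v\<bar>"
          using that assms by (intro mult_left_mono) auto
        moreover have "0 \<le> u\<^sup>2 / 2" "0 \<le> 1 / \<beta> * v" using that assms by auto
        moreover have "\<bar>s - t\<bar> \<le> S + T" if "0 \<le> s" "s \<le> S" "0 \<le> t" "t \<le> T" for s t S T :: real
          using that by linarith
        moreover have "q u = u\<^sup>2 / 2" "q v = 1 / \<beta> * v" using that by (auto simp: q_def)
        ultimately show ?thesis by presburger
      qed
      have "\<bar>q y - q y'\<bar> \<le> (1 + 1 / \<beta> + 2 * \<bar>y\<bar>) * \<bar>y - y'\<bar>"
      proof -
        have e: "(1 + 1 / \<beta> + 2 * \<bar>y\<bar>) * \<bar>y - y'\<bar>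
            = \<bar>y - y'\<bar> + 1 / \<beta> * \<bar>y - y'\<bar> + 2 * \<bar>y\<bar> * \<bar>y - y'\<bar>"
          by (simp add: algebra_simps)
        have n: "0 \<le> 1 / \<beta> * \<bar>y - y'\<bar>" "0 \<le> 2 * \<bar>y\<bar> * \<bar>y - y'\<bar>" using assms by auto
        consider "y \<le> 0" "y' \<le> 0" | "y > 0" "y' > 0" | "y \<le> 0" "y' > 0" | "y > 0" "y' \<le> 0"
          by linarith
        then show ?thesis
        proof cases
          case 1
          have "q y - q y' = (y + y') * (y - y') / 2"
            using 1 by (simp add: q_def power2_eq_square algebra_simps diff_divide_distrib)
          then have "\<bar>q y - q y'\<bar> = \<bar>y + y'\<bar> * \<bar>y - y'\<bar> / 2"
            by (simp only: abs_mult abs_divide abs_numeral)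
          also have "\<dots> \<le> (1 + 2 * \<bar>y\<bar>) * \<bar>y - y'\<bar> / 2"
            using d by (intro divide_right_mono mult_right_mono) auto
          also have "\<dots> \<le> (1 + 2 * \<bar>y\<bar>) * \<bar>y - y'\<bar>" by simp
          also have "\<dots> = \<bar>y - y'\<bar> + 2 * \<bar>y\<bar> * \<bar>y - y'\<bar>" by (simp add: algebra_simps)
          finally show ?thesis using n unfolding e by linarith
        next
          case 2
          then have "\<bar>q y - q y'\<bar> = 1 / \<beta> * \<bar>y - y'\<bar>"
            using assms by (simp add: q_def diff_divide_distrib[symmetric])
          then show ?thesis using n unfolding e by linarith
        next
          case 3 then show ?thesis using mixed[of y y'] d n unfolding e by linarith
        next
          case 4
          then have "\<bar>q y - q y'\<bar> \<le> \<bar>y - y'\<bar> + 1 / \<beta> * \<bar>y - y'\<bar>"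
            using mixed[of y' y] d by (simp add: abs_minus_commute)
          then show ?thesis using n unfolding e by linarith
        qed
      qed
      then show ?thesis using c by (simp add: f ln_mult abs_minus_commute)
    qed
  qed (use assms k in auto)
qed

text \<open>\<open>upper_incomplete_Gamma\<close> is a Bochner integral, which would be 0 for a
  non-integrable function. Comparison with the full Gamma integral excludes this, and a unit
  interval of the tail gives positivity.\<close>

lemma nn_integral_upper_incomplete_Gamma:
  assumes "0 \<le> a"
  shows "(\<integral>\<^sup>+u. ennreal (u powr a * exp (- u)) * indicator {a..} u \<partial>lborel)
      = ennreal (upper_incomplete_Gamma (a + 1) a)"
    and "0 < upper_incomplete_Gamma (a + 1) a"
proof -
  let ?g = "\<lambda>u. u powr a * exp (- u) :: real"
  have "(\<integral>\<^sup>+u. ennreal (?g u) * indicator {a..} u \<partial>lborel)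
     \<le> (\<integral>\<^sup>+t. ennreal (indicator {0..} t * t powr (a + 1 - 1) / exp t) \<partial>lborel)"
    using assms by (intro nn_integral_mono) (auto simp: exp_minus field_simps split: split_indicator)
  also have "\<dots> = Gamma (a + 1)"
    using assms by (subst Gamma_conv_nn_integral_real) auto
  also have "\<dots> < \<infinity>" by simp
  finally have fin: "(\<integral>\<^sup>+u. ennreal (?g u) * indicator {a..} u \<partial>lborel) < \<infinity>" .
  have eq: "(\<integral>\<^sup>+u. ennreal (?g u) * indicator {a..} u \<partial>lborel)
      = (\<integral>\<^sup>+u. ennreal (indicator {a..} u *\<^sub>R (u powr (a + 1 - 1) * exp (- u))) \<partial>lborel)"
    by (intro nn_integral_cong) (auto split: split_indicator)
  have int: "integrable lborel (\<lambda>u. indicator {a..} u *\<^sub>R (u powr (a + 1 - 1) * exp (- u)))"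
    using fin unfolding eq by (intro integrableI_nonneg) auto
  show *: "(\<integral>\<^sup>+u. ennreal (?g u) * indicator {a..} u \<partial>lborel)
      = ennreal (upper_incomplete_Gamma (a + 1) a)"
    unfolding eq upper_incomplete_Gamma_def set_lebesgue_integral_def
    by (rule nn_integral_eq_integral[OF int]) auto
  \<comment> \<open>The interval starts at \<open>a + 1\<close> so that \<open>u \<ge> 1\<close>,
    whence \<open>u powr a \<ge> 1\<close>.\<close>
  have "(\<integral>\<^sup>+u. ennreal (exp (- (a + 2))) * indicator {a + 1..a + 2} u \<partial>lborel)
      \<le> (\<integral>\<^sup>+u. ennreal (?g u) * indicator {a..} u \<partial>lborel)"
  proof (intro nn_integral_mono)
    fix u :: real
    show "ennreal (exp (- (a + 2))) * indicator {a + 1..a + 2} u \<le> ennreal (?g u) * indicator {a..} u"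
    proof (cases "u \<in> {a + 1..a + 2}")
      case True
      then have "1 * exp (- (a + 2)) \<le> u powr a * exp (- u)"
        using assms by (intro mult_mono ge_one_powr_ge_zero) auto
      then show ?thesis using True by (auto intro!: ennreal_leI)
    qed auto
  qed
  also have "(\<integral>\<^sup>+u. ennreal (exp (- (a + 2))) * indicator {a + 1..a + 2} u \<partial>lborel)
      = ennreal (exp (- (a + 2)))"
    by (simp add: nn_integral_cmult)
  finally have "exp (- (a + 2)) \<le> upper_incomplete_Gamma (a + 1) a"
    unfolding * by (simp add: ennreal_le_iff2)
  then show "0 < upper_incomplete_Gamma (a + 1) a"
    using exp_gt_zero[of "- (a + 2)"] by linarith
qed

text \<open>On each half line the density is an affine substitution \<open>u = a + r * y\<close> in
  the incomplete Gamma integrand, with \<open>r = \<tau>\<close> or \<open>r = 1 - \<tau>\<close>.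
  The Lipschitz constant 2 is 1 from the power and 1 from the exponential.\<close>

lemma regular_error_asym_gamma:
  assumes "0 < \<tau>" "\<tau> < 1" "0 \<le> a"
  shows "regular_error (asym_gamma \<tau> a)"
proof -
  define \<Gamma> where "\<Gamma> = upper_incomplete_Gamma (a + 1) a"
  define G where "G u = (if a = 0 then 1 else u powr a) * exp (- u)" for u :: real
  define c where "c = \<tau> * (1 - \<tau>) / \<Gamma>"
  have \<Gamma>: "\<Gamma> > 0" using nn_integral_upper_incomplete_Gamma(2) assms by (simp add: \<Gamma>_def)
  have c: "c > 0" using assms \<Gamma> by (simp add: c_def)
  have [measurable]: "G \<in> borel_measurable borel" unfolding G_def[abs_def] by measurable
  have f: "asym_gamma \<tau> a y = c * G (a + pinball \<tau> y)" for y
    by (simp add: asym_gamma_def c_def \<Gamma>_def G_def)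
  have pn: "0 \<le> pinball \<tau> y" for y using assms by (intro pinball_nonneg) auto
  have G0: "0 \<le> G u" for u by (simp add: G_def)
  \<comment> \<open>For \<open>a = 0\<close> the integrands differ at \<open>u = 0\<close>, where
    \<open>0 powr 0 = 0\<close>; elsewhere they agree.\<close>
  have int_G: "(\<integral>\<^sup>+u. ennreal (G u) * indicator {a..} u \<partial>lborel) = ennreal \<Gamma>"
    unfolding \<Gamma>_def nn_integral_upper_incomplete_Gamma(1)[OF assms(3), symmetric]
    using AE_lborel_singleton[of "0::real"]
    by (intro nn_integral_cong_AE)
       (auto elim!: eventually_mono simp: G_def split: split_indicator)
  have half: "(\<integral>\<^sup>+y. ennreal (G (a + r * y)) * indicator {0..} y \<partial>lborel) = ennreal (\<Gamma> / r)"
    (is "?I = _") if "r > 0" for r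
  proof -
    have "ennreal \<Gamma> = ennreal r * (\<integral>\<^sup>+y. ennreal (G (a + r * y)) * indicator {a..} (a + r * y) \<partial>lborel)"
      unfolding int_G[symmetric] using that
      by (subst nn_integral_real_affine[where c = r and t = a]) auto
    also have "(\<integral>\<^sup>+y. ennreal (G (a + r * y)) * indicator {a..} (a + r * y) \<partial>lborel) = ?I"
      using that by (intro nn_integral_cong) (auto simp: zero_le_mult_iff split: split_indicator)
    finally have "ennreal (1 / r) * ennreal \<Gamma> = ennreal (1 / r) * (ennreal r * ?I)" by simp
    then show ?thesis
      using that \<Gamma> by (simp add: mult.assoc[symmetric] ennreal_mult'[symmetric])
  qed
  show ?thesis
  proof (rule regular_errorI_Lipschitz[where K = 2])
    show "asym_gamma \<tau> a \<in> borel_measurable borel" unfolding f by measurable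
    have pos: "0 < G (a + pinball \<tau> y)" for y
      using pn[of y] assms(3) by (auto simp: G_def)
    then show "0 < asym_gamma \<tau> a y" for y using c by (simp add: f)
    have "(\<integral>\<^sup>+y. ennreal (G (a + pinball \<tau> y)) \<partial>lborel)
     = (\<integral>\<^sup>+y. ennreal (G (a + \<tau> * y)) * indicator {0..} y \<partial>lborel)
     + (\<integral>\<^sup>+y. ennreal (G (a + (1 - \<tau>) * y)) * indicator {0..} y \<partial>lborel)"
      by (subst nn_integral_split_reflect)
        (auto intro!: arg_cong2[where f = "(+)"] nn_integral_cong simp: pinball_def algebra_simps split: split_indicator)
    also have "\<dots> = ennreal (\<Gamma> / \<tau> + \<Gamma> / (1 - \<tau>))"
      using assms \<Gamma> by (simp add: half)
    finally have "(\<integral>\<^sup>+y. ennreal (asym_gamma \<tau> a y) \<partial>lborel) = ennreal (c * (\<Gamma> / \<tau> + \<Gamma> / (1 - \<tau>)))"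
      using c by (simp add: f ennreal_mult' nn_integral_cmult)
    also have "c * (\<Gamma> / \<tau> + \<Gamma> / (1 - \<tau>)) = 1"
      using assms \<Gamma> by (simp add: c_def field_simps)
    finally show "(\<integral>\<^sup>+y. ennreal (asym_gamma \<tau> a y) \<partial>lborel) = 1" by simp
    \<comment> \<open>On \<open>[a, \<infinity>)\<close> the logarithm has slope at most
      \<open>1 / a\<close>, which cancels the exponent \<open>a\<close> of the power.\<close>
    have ln_lip: "ln u - ln v \<le> (u - v) / a" if "a > 0" "a \<le> v" "v \<le> u" for u v
    proof -
      have "ln u - ln v = ln (u / v)" using that by (simp add: ln_div)
      also have "\<dots> \<le> u / v - 1" using that by (intro ln_le_minus_one) auto
      also have "\<dots> = (u - v) / v" using that by (simp add: field_simps)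
      also have "\<dots> \<le> (u - v) / a" using that by (intro divide_left_mono) auto
      finally show ?thesis .
    qed
    have abs_ln: "\<bar>ln u - ln v\<bar> \<le> \<bar>u - v\<bar> / a" if "a > 0" "a \<le> v" "a \<le> u" for u v
    proof (cases "v \<le> u")
      case True then show ?thesis using ln_lip[of v u] that by (simp add: ln_le_cancel_iff)
    next
      case False then show ?thesis using ln_lip[of u v] that
        by (simp add: ln_le_cancel_iff abs_minus_commute[of "ln u"] abs_minus_commute[of u])
    qed
    show "\<bar>ln (asym_gamma \<tau> a y) - ln (asym_gamma \<tau> a y')\<bar> \<le> 2 * \<bar>y - y'\<bar>" for y y'
    proof -
      let ?u = "a + pinball \<tau> y" and ?v = "a + pinball \<tau> y'"
      have uv: "\<bar>?u - ?v\<bar> \<le> \<bar>y - y'\<bar>" using pinball_Lipschitz[of \<tau> y y'] assms by simp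
      have "\<bar>ln (G ?u) - ln (G ?v)\<bar> \<le> 2 * \<bar>?u - ?v\<bar>"
      proof (cases "a = 0")
        case True then show ?thesis by (simp add: G_def abs_minus_commute)
      next
        case False
        then have a: "a > 0" using assms by simp
        have p: "?u > 0" "?v > 0" using a pn by (auto intro: add_pos_nonneg)
        have "a * \<bar>ln ?u - ln ?v\<bar> \<le> \<bar>?u - ?v\<bar>"
          using abs_ln[of ?v ?u] a pn by (simp add: field_simps)
        then have "\<bar>a * (ln ?u - ln ?v)\<bar> \<le> \<bar>?u - ?v\<bar>"
          using a by (simp only: abs_mult abs_of_pos)
        moreover have "ln (G ?u) - ln (G ?v) = a * (ln ?u - ln ?v) - (?u - ?v)"
          using p a by (simp add: G_def ln_mult ln_powr algebra_simps)
        ultimately show ?thesis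
          using abs_triangle_ineq4[of "a * (ln ?u - ln ?v)" "?u - ?v"] by simp
      qed
      then show ?thesis
        using c pos[of y] pos[of y'] uv by (simp add: f ln_mult)
    qed
  qed
qed

lemma regular_error_if_error_density:
  "f \<in> error_densities \<Longrightarrow> regular_error f"
  unfolding error_densities_def
  using regular_error_asym_laplace regular_error_asym_gamma regular_error_normal_exponential
    regular_error_standard_cauchy regular_error_asym_normal
  by auto

section \<open>Affinity of product measures\<close>

text \<open>The largest such \<open>r\<close> is the squared Hellinger affinity of \<open>P\<close> and \<open>Q\<close>, by the
  Cauchy-Schwarz inequality. This form needs no densities and passes to product measures by
  integrating out one coordinate at a time.\<close>

definition affinity_bound :: "'a measure \<Rightarrow> 'a measure \<Rightarrow> real \<Rightarrow> bool" where
  "affinity_bound P Q r \<longleftrightarrow>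
     (\<forall>u lo hi. u \<in> borel_measurable P \<longrightarrow> 0 < lo \<longrightarrow> (\<forall>z. lo \<le> u z \<and> u z \<le> hi) \<longrightarrow>
        r \<le> (\<integral>z. u z \<partial>P) * (\<integral>z. 1 / u z \<partial>Q))"

lemma affinity_bound_mono: "affinity_bound P Q r \<Longrightarrow> r' \<le> r \<Longrightarrow> affinity_bound P Q r'"
  unfolding affinity_bound_def by (meson order_trans)

lemma (in prob_space) integral_between:
  fixes u :: "'a \<Rightarrow> real"
  assumes [measurable]: "u \<in> borel_measurable M" and "\<And>z. lo \<le> u z" "\<And>z. u z \<le> hi"
  shows "integrable M u" "lo \<le> (\<integral>z. u z \<partial>M)" "(\<integral>z. u z \<partial>M) \<le> hi"
proof -
  have "norm (u z) \<le> \<bar>lo\<bar> + \<bar>hi\<bar>" for z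
    unfolding real_norm_def using assms(2)[of z] assms(3)[of z] by linarith
  then show int: "integrable M u"
    by (intro integrable_const_bound[where B = "\<bar>lo\<bar> + \<bar>hi\<bar>"] AE_I2) auto
  show "lo \<le> (\<integral>z. u z \<partial>M)" "(\<integral>z. u z \<partial>M) \<le> hi"
    using integral_mono[of M "\<lambda>_. lo" u] integral_mono[of M u "\<lambda>_. hi"] int assms(2,3)
    by (auto simp: prob_space)
qed

text \<open>Let \<open>v\<close> be the \<open>P\<close>-average of \<open>u\<close> over the new
  coordinate. The one-coordinate bound makes the \<open>Q\<close>-average of \<open>1 / u\<close> at
  least \<open>r / v\<close>, and the induction hypothesis applied to \<open>v\<close> supplies the
  remaining factor.\<close>

lemma affinity_bound_PiM:
  assumes P: "prob_space P" and Q: "prob_space Q" and sets: "sets P = sets Q"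
    and aff: "affinity_bound P Q r" and r: "0 \<le> r" and I: "finite I"
  shows "affinity_bound (PiM I (\<lambda>_. P)) (PiM I (\<lambda>_. Q)) (r ^ card I)"
  using I
proof (induction I rule: finite_induct)
  case empty
  show ?case
    unfolding affinity_bound_def
  proof (intro allI impI)
    fix u :: "('b \<Rightarrow> 'a) \<Rightarrow> real" and lo hi :: real
    assume "0 < lo" "\<forall>z. lo \<le> u z \<and> u z \<le> hi"
    \<comment> \<open>The empty product is the point mass at the undefined function, so the two
      integrals multiply to 1.\<close>
    then have "u (\<lambda>_. undefined) > 0" by (meson less_le_trans)
    then show "r ^ card {} \<le> (\<integral>z. u z \<partial>PiM {} (\<lambda>_. P)) * (\<integral>z. 1 / u z \<partial>PiM {} (\<lambda>_. Q))"
      by (simp add: PiM_empty lebesgue_integral_count_space_finite)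
  qed
next
  case (insert i I)
  interpret P: prob_space P by fact
  interpret Q: prob_space Q by fact
  interpret PP: product_prob_space "\<lambda>_. P" by standard
  interpret QQ: product_prob_space "\<lambda>_. Q" by standard
  interpret PI: prob_space "PiM I (\<lambda>_. P)" by (rule prob_space_PiM) (rule P)
  interpret QI: prob_space "PiM I (\<lambda>_. Q)" by (rule prob_space_PiM) (rule Q)
  interpret PiI: prob_space "PiM (insert i I) (\<lambda>_. P)" by (rule prob_space_PiM) (rule P)
  interpret QiI: prob_space "PiM (insert i I) (\<lambda>_. Q)" by (rule prob_space_PiM) (rule Q)
  have setsI: "sets (PiM I (\<lambda>_. P)) = sets (PiM I (\<lambda>_. Q))" for I :: "'b set"
    by (intro sets_PiM_cong refl sets)
  show ?case
    unfolding affinity_bound_def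
  proof (intro allI impI)
    fix u :: "('b \<Rightarrow> 'a) \<Rightarrow> real" and lo hi :: real
    assume u[measurable]: "u \<in> borel_measurable (PiM (insert i I) (\<lambda>_. P))" and lo: "0 < lo"
      and b: "\<forall>z. lo \<le> u z \<and> u z \<le> hi"
    have uQ[measurable]: "u \<in> borel_measurable (PiM (insert i I) (\<lambda>_. Q))"
      using u measurable_cong_sets[OF setsI refl] by blast
    have pos: "0 < u z" for z using b lo by (meson less_le_trans)
    have inv_b: "1 / hi \<le> 1 / u z \<and> 1 / u z \<le> 1 / lo" for z
      using b lo pos[of z] by (auto intro!: divide_left_mono mult_pos_pos)
    have [measurable]: "(\<lambda>(x, y). u (x(i := y))) \<in> borel_measurable (PiM I (\<lambda>_. P) \<Otimes>\<^sub>M P)"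
      using measurable_compose[OF measurable_add_dim[of i I "\<lambda>_. P"] u] by (simp add: split_beta')
    have [measurable]: "(\<lambda>(x, y). u (x(i := y))) \<in> borel_measurable (PiM I (\<lambda>_. Q) \<Otimes>\<^sub>M Q)"
      using measurable_compose[OF measurable_add_dim[of i I "\<lambda>_. Q"] uQ] by (simp add: split_beta')
    define v where "v x = (\<integral>y. u (x(i := y)) \<partial>P)" for x
    have sec: "(\<lambda>y. u (x(i := y))) \<in> borel_measurable P" if "x \<in> space (PiM I (\<lambda>_. P))" for x
      using that by measurable
    have secQ: "(\<lambda>y. u (x(i := y))) \<in> borel_measurable Q" if "x \<in> space (PiM I (\<lambda>_. Q))" for x
      using that by measurable
    have spc: "space (PiM I (\<lambda>_. P)) = space (PiM I (\<lambda>_. Q))"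
      using sets_eq_imp_space_eq[OF setsI] .
    \<comment> \<open>\<open>affinity_bound\<close> asks for bounds at every point, but the partial
      integral is controlled only on the product space; outside it the value is set to
      \<open>lo\<close>. The function \<open>g\<close> below serves the inner integral of
      \<open>1 / u\<close> in the same way.\<close>
    define v' where "v' x = (if x \<in> space (PiM I (\<lambda>_. P)) then v x else lo)" for x
    have v'b: "lo \<le> v' x \<and> v' x \<le> hi" for x
    proof (cases "x \<in> space (PiM I (\<lambda>_. P))")
      case True
      then show ?thesis
        using P.integral_between(2,3)[OF sec, of x lo hi] b by (simp add: v'_def v_def)
    next
      case False
      then show ?thesis using b order_trans by (auto simp: v'_def)
    qed
    have vm: "v \<in> borel_measurable (PiM I (\<lambda>_. P))" unfolding v_def by measurable
    then have v'm: "v' \<in> borel_measurable (PiM I (\<lambda>_. P))"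
      by (subst measurable_cong[where g = v]) (auto simp: v'_def)
    then have v'mQ: "v' \<in> borel_measurable (PiM I (\<lambda>_. Q))"
      using measurable_cong_sets[OF setsI refl] by blast
    have v'pos: "v' x > 0" for x using v'b lo by (meson less_le_trans)
    have E1: "(\<integral>z. u z \<partial>PiM (insert i I) (\<lambda>_. P)) = (\<integral>x. v' x \<partial>PiM I (\<lambda>_. P))"
    proof -
      have "(\<integral>z. u z \<partial>PiM (insert i I) (\<lambda>_. P)) = (\<integral>x. v x \<partial>PiM I (\<lambda>_. P))"
        unfolding v_def using insert b
        by (intro PP.product_integral_insert PiI.integral_between[OF u, of lo hi]) auto
      also have "\<dots> = (\<integral>x. v' x \<partial>PiM I (\<lambda>_. P))"
        by (intro Bochner_Integration.integral_cong) (auto simp: v'_def)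
      finally show ?thesis .
    qed
    have E2: "(\<integral>z. 1 / u z \<partial>PiM (insert i I) (\<lambda>_. Q))
        = (\<integral>x. (\<integral>y. 1 / u (x(i := y)) \<partial>Q) \<partial>PiM I (\<lambda>_. Q))"
      using insert inv_b
      by (intro QQ.product_integral_insert QiI.integral_between[where lo = "1/hi" and hi = "1/lo"]) auto
    have inner: "r * (1 / v' x) \<le> (\<integral>y. 1 / u (x(i := y)) \<partial>Q)" if "x \<in> space (PiM I (\<lambda>_. Q))" for x
    proof -
      have "r \<le> v x * (\<integral>y. 1 / u (x(i := y)) \<partial>Q)"
        unfolding v_def using aff[unfolded affinity_bound_def, rule_format, OF sec lo, of x hi] that b spc
        by auto
      moreover have "v x = v' x" using that spc by (simp add: v'_def)
      ultimately show ?thesis using v'pos[of x] by (simp add: field_simps)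
    qed
    have "(\<integral>x. r * (1 / v' x) \<partial>PiM I (\<lambda>_. Q)) \<le> (\<integral>z. 1 / u z \<partial>PiM (insert i I) (\<lambda>_. Q))"
      unfolding E2
    proof (intro integral_mono inner)
      have vb: "1 / hi \<le> 1 / v' z \<and> 1 / v' z \<le> 1 / lo" for z
        using v'b[of z] lo v'pos[of z] by (auto intro!: divide_left_mono mult_pos_pos)
      show "integrable (PiM I (\<lambda>_. Q)) (\<lambda>x. r * (1 / v' x))"
        using v'mQ vb by (intro integrable_mult_right QI.integral_between[where lo = "1/hi" and hi = "1/lo"]) auto
      define g where "g x = (if x \<in> space (PiM I (\<lambda>_. Q)) then (\<integral>y. 1 / u (x(i := y)) \<partial>Q) else 1 / lo)" for x
      have hl: "1 / hi \<le> 1 / lo" using inv_b order_trans by blast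
      have gb: "1 / hi \<le> g x \<and> g x \<le> 1 / lo" for x
      proof (cases "x \<in> space (PiM I (\<lambda>_. Q))")
        case True
        have "(\<lambda>y. 1 / u (x(i := y))) \<in> borel_measurable Q"
          using secQ[OF True] by (rule borel_measurable_divide[OF borel_measurable_const])
        from Q.integral_between(2,3)[OF this, of "1 / hi" "1 / lo"] inv_b True
        show ?thesis unfolding g_def by presburger
      next
        case False
        then show ?thesis using hl by (simp add: g_def)
      qed
      have gm: "g \<in> borel_measurable (PiM I (\<lambda>_. Q))"
        by (subst measurable_cong[where g = "\<lambda>x. (\<integral>y. 1 / u (x(i := y)) \<partial>Q)"]) (auto simp: g_def)
      show "integrable (PiM I (\<lambda>_. Q)) (\<lambda>x. \<integral>y. 1 / u (x(i := y)) \<partial>Q)"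
      proof (rule iffD1[OF Bochner_Integration.integrable_cong])
        show "integrable (PiM I (\<lambda>_. Q)) g" using gb gm by (intro QI.integral_between(1)) auto
      qed (auto simp: g_def)
    qed
    then have I2: "r * (\<integral>x. 1 / v' x \<partial>PiM I (\<lambda>_. Q)) \<le> (\<integral>z. 1 / u z \<partial>PiM (insert i I) (\<lambda>_. Q))"
      by (simp only: integral_mult_right_zero)
    have pos_int: "0 \<le> (\<integral>x. v' x \<partial>PiM I (\<lambda>_. P))"
      using v'pos by (intro Bochner_Integration.integral_nonneg) (auto simp: less_imp_le)
    have "r ^ card (insert i I) = r * r ^ card I" using insert by simp
    also have "\<dots> \<le> r * ((\<integral>x. v' x \<partial>PiM I (\<lambda>_. P)) * (\<integral>x. 1 / v' x \<partial>PiM I (\<lambda>_. Q)))"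
      using insert.IH[unfolded affinity_bound_def, rule_format, OF v'm lo, of hi] v'b r
      by (intro mult_left_mono) auto
    also have "\<dots> = (\<integral>x. v' x \<partial>PiM I (\<lambda>_. P)) * (r * (\<integral>x. 1 / v' x \<partial>PiM I (\<lambda>_. Q)))" by simp
    also have "\<dots> \<le> (\<integral>x. v' x \<partial>PiM I (\<lambda>_. P)) * (\<integral>z. 1 / u z \<partial>PiM (insert i I) (\<lambda>_. Q))"
      by (intro mult_left_mono I2 pos_int)
    finally show "r ^ card (insert i I)
        \<le> (\<integral>z. u z \<partial>PiM (insert i I) (\<lambda>_. P)) * (\<integral>z. 1 / u z \<partial>PiM (insert i I) (\<lambda>_. Q))"
      unfolding E1 .
  qed
qed

text \<open>With \<open>A\<close> the error indicator of a test, apply the bound to \<open>u = A + r / 4\<close>.\<close>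

lemma affinity_bound_test:
  assumes P: "prob_space P" and Q: "prob_space Q" and sets: "sets P = sets Q"
    and aff: "affinity_bound P Q r" and r: "0 < r"
    and A[measurable]: "A \<in> borel_measurable P" and A01: "\<And>z. 0 \<le> A z" "\<And>z. A z \<le> 1"
  shows "r / 4 \<le> (\<integral>z. A z \<partial>P) + (\<integral>z. 1 - A z \<partial>Q)"
proof -
  interpret P: prob_space P by fact
  interpret Q: prob_space Q by fact
  have AQ[measurable]: "A \<in> borel_measurable Q" using A measurable_cong_sets[OF sets refl] by blast
  \<comment> \<open>With \<open>t = r / 4\<close> one has \<open>r * t = (r / 2)\<^sup>2\<close>, so
    the final square root leaves \<open>r / 2 - t = r / 4\<close>.\<close>
  define t where "t = r / 4"
  have t: "t > 0" using r by (simp add: t_def)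
  define \<alpha> \<beta> where "\<alpha> = (\<integral>z. A z \<partial>P)" and "\<beta> = (\<integral>z. 1 - A z \<partial>Q)"
  have i1: "integrable P A" using P.integral_between[of A 0 1] A01 by auto
  have i2: "integrable Q (\<lambda>z. 1 - A z)" using Q.integral_between[of "\<lambda>z. 1 - A z" 0 1] A01 by auto
  have nn: "0 \<le> \<alpha>" "0 \<le> \<beta>" unfolding \<alpha>_def \<beta>_def using A01 by (auto intro!: Bochner_Integration.integral_nonneg)
  have "r \<le> (\<integral>z. A z + t \<partial>P) * (\<integral>z. 1 / (A z + t) \<partial>Q)"
    by (rule aff[unfolded affinity_bound_def, rule_format, of "\<lambda>z. A z + t" t "1 + t"])
       (use A01 t in auto)
  also have "(\<integral>z. A z + t \<partial>P) = \<alpha> + t" using i1 by (simp add: \<alpha>_def P.prob_space)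
  also have "(\<alpha> + t) * (\<integral>z. 1 / (A z + t) \<partial>Q) \<le> (\<alpha> + t) * (\<integral>z. ((1 - A z) + t) / t \<partial>Q)"
  proof (intro mult_left_mono integral_mono)
    \<comment> \<open>The majorant of \<open>1 / (A z + t)\<close> is affine in \<open>A z\<close>,
      so its integral involves only \<open>\<beta>\<close>.\<close>
    fix z
    have p: "A z + t > 0" using A01(1)[of z] t by linarith
    have "0 \<le> A z * (1 - A z) + t\<^sup>2" using A01(1,2)[of z] by (intro add_nonneg_nonneg mult_nonneg_nonneg) auto
    then have "t \<le> ((1 - A z) + t) * (A z + t)"
      by (simp add: algebra_simps power2_eq_square)
    then show "1 / (A z + t) \<le> ((1 - A z) + t) / t"
      unfolding pos_divide_le_eq[OF p] times_divide_eq_left pos_le_divide_eq[OF t] by simp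
  next
    have "0 \<le> 1 / (A z + t)" "1 / (A z + t) \<le> 1 / t" for z using t A01(1)[of z]
      by (simp_all add: frac_le)
    then show "integrable Q (\<lambda>z. 1 / (A z + t))"
      by (intro Q.integral_between[where lo = 0 and hi = "1 / t"]) auto
    show "integrable Q (\<lambda>z. ((1 - A z) + t) / t)" using i2 by simp
  qed (use nn t in auto)
  also have "(\<integral>z. ((1 - A z) + t) / t \<partial>Q) = (\<beta> + t) / t"
    using i2 Q.prob_space unfolding \<beta>_def
    by (subst integral_divide_zero, subst Bochner_Integration.integral_add) auto
  finally have "r * t \<le> (\<alpha> + t) * (\<beta> + t)" using t by (simp add: field_simps)
  also have "\<dots> \<le> (\<alpha> + \<beta> + t)\<^sup>2"
  proof -
    have "(\<alpha> + \<beta> + t)\<^sup>2 = (\<alpha> + t) * (\<beta> + t) + (\<alpha>\<^sup>2 + \<beta>\<^sup>2 + \<alpha> * \<beta> + \<alpha> * t + \<beta> * t)"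
      by (simp add: power2_eq_square algebra_simps)
    moreover have "0 \<le> \<alpha>\<^sup>2 + \<beta>\<^sup>2 + \<alpha> * \<beta> + \<alpha> * t + \<beta> * t" using nn t by simp
    ultimately show ?thesis by linarith
  qed
  finally have "r * t \<le> (\<alpha> + \<beta> + t)\<^sup>2" .
  moreover have "(r / 2)\<^sup>2 = r * t" by (simp add: t_def power2_eq_square)
  ultimately have "(r / 2)\<^sup>2 \<le> (\<alpha> + \<beta> + t)\<^sup>2" by simp
  then have "r / 2 \<le> \<alpha> + \<beta> + t" by (rule power2_le_imp_le) (use nn t in auto)
  then show ?thesis by (simp add: \<alpha>_def \<beta>_def t_def)
qed

text \<open>The loss capped at \<open>\<Delta>\<close> and divided by \<open>\<Delta>\<close> serves
  as a randomised test: it is at most \<open>S / \<Delta>\<close>, and the separation makes its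
  complement at most \<open>S' / \<Delta>\<close>.\<close>

lemma affinity_bound_two_point:
  fixes S S' :: "'a \<Rightarrow> ennreal"
  assumes P: "prob_space P" and Q: "prob_space Q" and sets: "sets P = sets Q"
    and aff: "affinity_bound P Q r" and r: "0 < r" and \<Delta>: "0 < \<Delta>"
    and S[measurable]: "S \<in> borel_measurable P" and S'[measurable]: "S' \<in> borel_measurable Q"
    and le: "\<And>z. z \<in> space P \<Longrightarrow> ennreal \<Delta> \<le> S z + S' z"
  shows "ennreal (\<Delta> * r / 4) \<le> (\<integral>\<^sup>+z. S z \<partial>P) + (\<integral>\<^sup>+z. S' z \<partial>Q)"
proof -
  interpret P: prob_space P by fact
  interpret Q: prob_space Q by fact
  define A where "A z = enn2real (min (S z) (ennreal \<Delta>)) / \<Delta>" for z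
  have A[measurable]: "A \<in> borel_measurable P" unfolding A_def[abs_def] by measurable
  have AQ[measurable]: "A \<in> borel_measurable Q" using A measurable_cong_sets[OF sets refl] by blast
  have fin: "min (S z) (ennreal \<Delta>) < top" for z by (simp add: min_less_iff_disj)
  have eA: "ennreal (\<Delta> * A z) = min (S z) (ennreal \<Delta>)" for z
    using \<Delta> fin by (simp add: A_def)
  have A01: "0 \<le> A z" "A z \<le> 1" for z
  proof -
    show "0 \<le> A z" using \<Delta> by (simp add: A_def)
    have "ennreal (\<Delta> * A z) \<le> ennreal \<Delta>" unfolding eA by simp
    then show "A z \<le> 1" using \<Delta> by (simp add: ennreal_le_iff)
  qed
  have 1: "ennreal (\<Delta> * (\<integral>z. A z \<partial>P)) \<le> (\<integral>\<^sup>+z. S z \<partial>P)"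
  proof -
    have "ennreal (\<Delta> * (\<integral>z. A z \<partial>P)) = (\<integral>\<^sup>+z. ennreal (\<Delta> * A z) \<partial>P)"
      using P.integral_between[of A 0 1] A01 \<Delta> by (subst nn_integral_eq_integral) auto
    also have "\<dots> \<le> (\<integral>\<^sup>+z. S z \<partial>P)" by (intro nn_integral_mono) (simp add: eA)
    finally show ?thesis .
  qed
  have 2: "ennreal (\<Delta> * (\<integral>z. 1 - A z \<partial>Q)) \<le> (\<integral>\<^sup>+z. S' z \<partial>Q)"
  proof -
    have "ennreal (\<Delta> * (\<integral>z. 1 - A z \<partial>Q)) = (\<integral>\<^sup>+z. ennreal (\<Delta> * (1 - A z)) \<partial>Q)"
      using Q.integral_between[of "\<lambda>z. 1 - A z" 0 1] A01 \<Delta>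
      by (subst nn_integral_eq_integral) auto
    also have "\<dots> \<le> (\<integral>\<^sup>+z. S' z \<partial>Q)"
    proof (intro nn_integral_mono)
      fix z assume "z \<in> space Q"
      then have z: "z \<in> space P" using sets_eq_imp_space_eq[OF sets] by simp
      have d: "ennreal (\<Delta> * (1 - A z)) = ennreal \<Delta> - ennreal (\<Delta> * A z)"
        using A01 \<Delta> by (simp add: right_diff_distrib ennreal_minus)
      show "ennreal (\<Delta> * (1 - A z)) \<le> S' z"
        using le[OF z] unfolding d eA
        by (cases "S z \<le> ennreal \<Delta>")
           (auto simp: min_def ennreal_minus_le_iff not_le)
    qed
    finally show ?thesis .
  qed
  have "ennreal (\<Delta> * r / 4) \<le> ennreal (\<Delta> * (\<integral>z. A z \<partial>P) + \<Delta> * (\<integral>z. 1 - A z \<partial>Q))"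
    using affinity_bound_test[OF P Q sets aff r A A01] \<Delta>
    by (intro ennreal_leI) (simp add: distrib_left[symmetric])
  also have "\<dots> = ennreal (\<Delta> * (\<integral>z. A z \<partial>P)) + ennreal (\<Delta> * (\<integral>z. 1 - A z \<partial>Q))"
    using A01 \<Delta> by (intro ennreal_plus mult_nonneg_nonneg Bochner_Integration.integral_nonneg) auto
  also have "\<dots> \<le> (\<integral>\<^sup>+z. S z \<partial>P) + (\<integral>\<^sup>+z. S' z \<partial>Q)" by (intro add_mono 1 2)
  finally show ?thesis .
qed

section \<open>Regression observations\<close>

lemma borel_measurable_fst_snd [measurable]:
  "fst \<in> borel_measurable (borel :: ((real ^ 'd::finite) \<times> real) measure)"
  "snd \<in> borel_measurable (borel :: ((real ^ 'd) \<times> real) measure)"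
  by (auto intro!: borel_measurable_continuous_onI continuous_on_fst continuous_on_snd continuous_on_id)

lemma regular_errorD:
  assumes "regular_error f"
  shows "f \<in> borel_measurable borel" "\<And>y. 0 < f y" "\<And>y. 0 \<le> f y"
    "(\<integral>\<^sup>+y. ennreal (f y) \<partial>lborel) = 1" "integrable lborel f" "(\<integral>y. f y \<partial>lborel) = 1"
proof -
  show m[measurable]: "f \<in> borel_measurable borel" and pos: "\<And>y. 0 < f y"
    and int: "(\<integral>\<^sup>+y. ennreal (f y) \<partial>lborel) = 1"
    using assms by (auto simp: regular_error_def)
  show nn: "0 \<le> f y" for y using pos[of y] by simp
  show "integrable lborel f" using int nn by (intro integrableI_nonneg) auto
  show "(\<integral>y. f y \<partial>lborel) = 1"
    using int nn by (subst integral_eq_nn_integral) auto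
qed

lemma prob_space_regular_error:
  "regular_error f \<Longrightarrow> prob_space (lborel_density f)"
  using regular_errorD(1,4)[of f] by (intro prob_spaceI) (simp add: emeasure_density)

lemma prob_space_covariate_density:
  "h \<in> covariate_densities C \<Longrightarrow> prob_space (lborel_density h)"
  by (auto intro!: prob_spaceI simp: emeasure_density covariate_densities_def)

lemma measurable_observation:
  fixes \<mu> \<sigma> :: "real ^ 'd::finite \<Rightarrow> real"
  assumes [measurable]: "\<mu> \<in> borel_measurable borel" "\<sigma> \<in> borel_measurable borel"
  shows "(\<lambda>(x, e). (x, \<mu> x + \<sigma> x * e)) \<in> measurable
    (lborel_density h \<Otimes>\<^sub>M lborel_density f) borel"
  unfolding borel_prod[symmetric] by measurable

lemma sets_observation_law [simp, measurable_cong]: "sets (observation_law f \<mu> \<sigma> h) = sets borel"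
  by (simp add: observation_law_def)

lemma space_observation_law [simp]: "space (observation_law f \<mu> \<sigma> h) = UNIV"
  by (simp add: observation_law_def)

lemma prob_space_observation_law:
  assumes "regular_error f" "h \<in> covariate_densities C"
    and "\<mu> \<in> borel_measurable borel" "\<sigma> \<in> borel_measurable borel"
  shows "prob_space (observation_law f \<mu> \<sigma> h)"
proof -
  interpret F: prob_space "lborel_density f"
    using assms by (intro prob_space_regular_error)
  interpret H: prob_space "lborel_density h"
    using assms by (intro prob_space_covariate_density)
  interpret pair_prob_space "lborel_density h" "lborel_density f" ..
  show ?thesis
    unfolding observation_law_def using assms by (intro prob_space_distr measurable_observation)
qed

lemma integral_observation_law:
  fixes u :: "(real ^ 'd::finite) \<times> real \<Rightarrow> real"
  assumes f: "regular_error f" and h: "h \<in> covariate_densities C"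
    and \<mu>[measurable]: "\<mu> \<in> borel_measurable borel" and \<sigma>[measurable]: "\<sigma> \<in> borel_measurable borel"
    and u: "u \<in> borel_measurable borel" and b: "\<And>z. lo \<le> u z" "\<And>z. u z \<le> hi"
  shows "(\<integral>z. u z \<partial>observation_law f \<mu> \<sigma> h)
      = (\<integral>x. (\<integral>e. u (x, \<mu> x + \<sigma> x * e) \<partial>lborel_density f) \<partial>lborel_density h)"
    and "(\<lambda>x. \<integral>e. u (x, \<mu> x + \<sigma> x * e) \<partial>lborel_density f) \<in> borel_measurable borel"
    and "lo \<le> (\<integral>e. u (x, \<mu> x + \<sigma> x * e) \<partial>lborel_density f)"
    and "(\<integral>e. u (x, \<mu> x + \<sigma> x * e) \<partial>lborel_density f) \<le> hi"
proof -
  interpret F: prob_space "lborel_density f"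
    using f by (intro prob_space_regular_error)
  interpret H: prob_space "lborel_density h"
    using h by (intro prob_space_covariate_density)
  interpret pair_prob_space "lborel_density h" "lborel_density f" ..
  note m = measurable_compose[OF measurable_observation[OF \<mu> \<sigma>] u]
  have m'[measurable]: "(\<lambda>(x, e). u (x, \<mu> x + \<sigma> x * e))
      \<in> borel_measurable (lborel_density h \<Otimes>\<^sub>M lborel_density f)"
    using m[of h f] by (simp add: split_beta')
  have sec: "(\<lambda>e. u (x, \<mu> x + \<sigma> x * e)) \<in> borel_measurable (lborel_density f)" for x
    using measurable_Pair2[OF m', of x] by simp
  show "lo \<le> (\<integral>e. u (x, \<mu> x + \<sigma> x * e) \<partial>lborel_density f)"
    and "(\<integral>e. u (x, \<mu> x + \<sigma> x * e) \<partial>lborel_density f) \<le> hi"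
    using F.integral_between(2,3)[OF sec[of x], of lo hi] b by auto
  have "(\<lambda>x. \<integral>e. u (x, \<mu> x + \<sigma> x * e) \<partial>lborel_density f)
     \<in> borel_measurable (lborel_density h)"
    by measurable
  then show "(\<lambda>x. \<integral>e. u (x, \<mu> x + \<sigma> x * e) \<partial>lborel_density f) \<in> borel_measurable borel"
    by simp
  have "(\<integral>z. u z \<partial>observation_law f \<mu> \<sigma> h)
     = (\<integral>z. (case z of (x, e) \<Rightarrow> u (x, \<mu> x + \<sigma> x * e))
          \<partial>(lborel_density h \<Otimes>\<^sub>M lborel_density f))"
    unfolding observation_law_def
    by (subst integral_distr[OF measurable_observation[OF \<mu> \<sigma>] u]) (simp add: split_beta')
  also have "\<dots> = (\<integral>x. (\<integral>e. u (x, \<mu> x + \<sigma> x * e) \<partial>lborel_density f) \<partial>lborel_density h)"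
    using b by (subst integral_fst'[symmetric])
      (auto intro!: P.integral_between(1)[where lo = lo and hi = hi] m')
  finally show "(\<integral>z. u z \<partial>observation_law f \<mu> \<sigma> h)
      = (\<integral>x. (\<integral>e. u (x, \<mu> x + \<sigma> x * e) \<partial>lborel_density f) \<partial>lborel_density h)" .
qed

text \<open>The inequality \<open>1 + ln x \<le> x\<close> at the root of the ratio, scaled by the
  larger root. It converts Lipschitz bounds on log densities into Hellinger distances.\<close>

lemma sqrt_diff_square_le:
  fixes a b :: real
  assumes "0 < a" "0 < b"
  shows "(sqrt a - sqrt b)\<^sup>2 \<le> (ln a - ln b)\<^sup>2 / 4 * max a b"
proof -
  have *: "(sqrt a - sqrt b)\<^sup>2 \<le> (ln a - ln b)\<^sup>2 / 4 * a" if "0 < b" "b \<le> a" for a b :: real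
  proof -
    have a: "a > 0" using that by simp
    have "1 + ln (sqrt (b / a)) \<le> sqrt (b / a)" using a that ln_le_minus_one[of "sqrt (b / a)"] by simp
    then have "1 - sqrt (b / a) \<le> (ln a - ln b) / 2"
      using a that by (simp add: ln_sqrt ln_div field_simps)
    then have "sqrt a * (1 - sqrt (b / a)) \<le> sqrt a * ((ln a - ln b) / 2)"
      using a by (intro mult_left_mono) auto
    moreover have "sqrt a * (1 - sqrt (b / a)) = sqrt a - sqrt b"
      using a by (simp add: right_diff_distrib real_sqrt_mult[symmetric])
    ultimately have "sqrt a - sqrt b \<le> sqrt a * ((ln a - ln b) / 2)" by simp
    then have "(sqrt a - sqrt b)\<^sup>2 \<le> (sqrt a * ((ln a - ln b) / 2))\<^sup>2"
      using that by (intro power_mono) auto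
    also have "\<dots> = (ln a - ln b)\<^sup>2 / 4 * a"
      using a by (simp add: power_mult_distrib power_divide)
    finally show ?thesis .
  qed
  show ?thesis
  proof (cases "b \<le> a")
    case True then show ?thesis using *[of b a] assms by (simp add: max_def)
  next
    case False then show ?thesis using *[of a b] assms by (simp add: max_def power2_commute)
  qed
qed

text \<open>The shift family of a regular error density has finite Fisher information.\<close>

lemma regular_error_shift:
  assumes f: "regular_error f"
  obtains J where "0 \<le> J"
    "\<And>v lo hi \<delta> t. \<lbrakk>v \<in> borel_measurable borel; 0 < lo; \<And>e. lo \<le> v e; \<And>e. v e \<le> hi; \<bar>\<delta>\<bar> \<le> 1; 0 < t\<rbrakk>
      \<Longrightarrow> t * (2 - J * \<delta>\<^sup>2) \<le> t\<^sup>2 * (\<integral>e. v e \<partial>lborel_density f)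
            + (\<integral>e. 1 / v (e - \<delta>) \<partial>lborel_density f)"
proof -
  from f obtain W where [measurable]: "W \<in> borel_measurable borel"
    and W: "integrable lborel (\<lambda>y. (W y)\<^sup>2 * f y)"
    and lip: "\<And>y y'. \<bar>y - y'\<bar> \<le> 1 \<Longrightarrow> \<bar>ln (f y) - ln (f y')\<bar> \<le> W y * \<bar>y - y'\<bar>"
    unfolding regular_error_def by blast
  note [measurable] = regular_errorD(1)[OF f]
  note pos = regular_errorD(2)[OF f] and nn = regular_errorD(3)[OF f]
  define J0 where "J0 = (\<integral>y. (W y)\<^sup>2 * f y \<partial>lborel)"
  show ?thesis
  proof (rule that[of "J0 / 2"])
    show "0 \<le> J0 / 2" using nn by (auto simp: J0_def intro!: Bochner_Integration.integral_nonneg)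
    fix v :: "real \<Rightarrow> real" and lo hi \<delta> t :: real
    assume v[measurable]: "v \<in> borel_measurable borel" and lo: "0 < lo" and vb: "\<And>e. lo \<le> v e" "\<And>e. v e \<le> hi"
      and \<delta>: "\<bar>\<delta>\<bar> \<le> 1" and t: "(0::real) < t"
    have v': "(\<lambda>e. 1 / v (e - \<delta>)) \<in> borel_measurable borel" by measurable
    have vpos: "v e > 0" for e using vb(1)[of e] lo by simp
    interpret F: prob_space "lborel_density f" using f by (intro prob_space_regular_error)
    have dens: "(\<integral>e. g e \<partial>lborel_density f) = (\<integral>e. f e * g e \<partial>lborel)"
      "integrable (lborel_density f) g \<longleftrightarrow> integrable lborel (\<lambda>e. f e * g e)"
      if [measurable]: "g \<in> borel_measurable borel" for g :: "real \<Rightarrow> real"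
      using nn by (simp_all add: integral_density integrable_density)
    have "1 / v e \<le> 1 / lo" "0 \<le> 1 / v e" for e
      using vb(1)[of e] lo vpos[of e] by (simp_all add: frac_le)
    then have "integrable (lborel_density f) (\<lambda>e. 1 / v (e - \<delta>))"
      by (intro F.integral_between(1)[where lo = 0 and hi = "1 / lo"]) auto
    then have i2: "integrable lborel (\<lambda>e. f e * (1 / v (e - \<delta>)))" by (subst (asm) dens(2)) auto
    have shift: "(\<integral>e. f e * (1 / v (e - \<delta>)) \<partial>lborel) = (\<integral>e. f (\<delta> + e) * (1 / v e) \<partial>lborel)"
      by (subst lborel_integral_real_affine[where c = 1 and t = \<delta>]) auto
    have i2': "integrable lborel (\<lambda>e. f (\<delta> + e) * (1 / v e))"
      using lborel_integrable_real_affine[OF i2, of 1 \<delta>] by simp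
    have "integrable (lborel_density f) v"
      using vb by (intro F.integral_between(1)[where lo = lo and hi = hi]) auto
    then have i1: "integrable lborel (\<lambda>e. f e * v e)" by (subst (asm) dens(2)) auto
    have i3: "integrable lborel (\<lambda>e. f (\<delta> + e))"
      using lborel_integrable_real_affine[OF regular_errorD(5)[OF f], of 1 \<delta>] by simp
    have e3: "(\<integral>e. f (\<delta> + e) \<partial>lborel) = 1"
      using lborel_integral_real_affine[of 1 f \<delta>] regular_errorD(6)[OF f] by simp
    have i4: "integrable lborel (\<lambda>e. (W (\<delta> + e))\<^sup>2 * f (\<delta> + e))"
      using lborel_integrable_real_affine[OF W, of 1 \<delta>] by simp
    have e4: "(\<integral>e. (W (\<delta> + e))\<^sup>2 * f (\<delta> + e) \<partial>lborel) = J0"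
      unfolding J0_def using lborel_integral_real_affine[of 1 "\<lambda>y. (W y)\<^sup>2 * f y" \<delta>] by simp
    \<comment> \<open>Arithmetic-geometric mean: \<open>t\<^sup>2 * (a * v) + b / v\<close> is at
      least \<open>2 * t * sqrt (a * b)\<close>, and \<open>2 * sqrt (a * b)\<close> is
      \<open>a + b\<close> minus the squared difference of the roots. The latter is bounded with
      \<open>W\<close> taken at the point of larger density; adding the term of the other point
      makes the bound symmetric.\<close>
    have pw: "t * (f e + f (\<delta> + e) - \<delta>\<^sup>2 / 4 * ((W e)\<^sup>2 * f e + (W (\<delta> + e))\<^sup>2 * f (\<delta> + e)))
       \<le> t\<^sup>2 * (f e * v e) + f (\<delta> + e) * (1 / v e)" for e
    proof -
      let ?a = "f e" and ?b = "f (\<delta> + e)"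
      have ab: "?a > 0" "?b > 0" using pos by auto
      have l1: "(ln ?a - ln ?b)\<^sup>2 \<le> (W e)\<^sup>2 * \<delta>\<^sup>2"
        using power_mono[OF lip[of e "\<delta> + e"], of 2] \<delta> by (simp add: power_mult_distrib)
      have l2: "(ln ?a - ln ?b)\<^sup>2 \<le> (W (\<delta> + e))\<^sup>2 * \<delta>\<^sup>2"
        using power_mono[OF lip[of "\<delta> + e" e], of 2] \<delta> by (simp add: power_mult_distrib power2_commute)
      have "(ln ?a - ln ?b)\<^sup>2 * max ?a ?b \<le> (W e)\<^sup>2 * \<delta>\<^sup>2 * ?a + (W (\<delta> + e))\<^sup>2 * \<delta>\<^sup>2 * ?b"
      proof (cases "?b \<le> ?a")
        case True
        have "(ln ?a - ln ?b)\<^sup>2 * ?a \<le> (W e)\<^sup>2 * \<delta>\<^sup>2 * ?a" using l1 ab by (intro mult_right_mono) auto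
        moreover have "0 \<le> (W (\<delta> + e))\<^sup>2 * \<delta>\<^sup>2 * ?b" using ab by simp
        ultimately show ?thesis using True by (simp add: max_def)
      next
        case False
        have "(ln ?a - ln ?b)\<^sup>2 * ?b \<le> (W (\<delta> + e))\<^sup>2 * \<delta>\<^sup>2 * ?b" using l2 ab by (intro mult_right_mono) auto
        moreover have "0 \<le> (W e)\<^sup>2 * \<delta>\<^sup>2 * ?a" using ab by simp
        ultimately show ?thesis using False by (simp add: max_def)
      qed
      then have "(sqrt ?a - sqrt ?b)\<^sup>2 \<le> \<delta>\<^sup>2 / 4 * ((W e)\<^sup>2 * ?a + (W (\<delta> + e))\<^sup>2 * ?b)"
        using sqrt_diff_square_le[OF ab] by (simp add: algebra_simps)
      then have "?a + ?b - \<delta>\<^sup>2 / 4 * ((W e)\<^sup>2 * ?a + (W (\<delta> + e))\<^sup>2 * ?b) \<le> 2 * (sqrt ?a * sqrt ?b)"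
        using ab by (simp add: power2_diff)
      then have "t * (?a + ?b - \<delta>\<^sup>2 / 4 * ((W e)\<^sup>2 * ?a + (W (\<delta> + e))\<^sup>2 * ?b)) \<le> t * (2 * (sqrt ?a * sqrt ?b))"
        using t by (intro mult_left_mono) auto
      also have "\<dots> = 2 * (t * (sqrt ?a * sqrt (v e))) * (sqrt ?b / sqrt (v e))"
        using vpos[of e] by simp
      also have "\<dots> \<le> (t * (sqrt ?a * sqrt (v e)))\<^sup>2 + (sqrt ?b / sqrt (v e))\<^sup>2"
        by (rule sum_squares_bound)
      also have "\<dots> = t\<^sup>2 * (?a * v e) + ?b * (1 / v e)"
        using vpos[of e] ab by (simp add: power_mult_distrib power_divide)
      finally show ?thesis .
    qed
    have "(\<integral>e. t * (f e + f (\<delta> + e) - \<delta>\<^sup>2 / 4 * ((W e)\<^sup>2 * f e + (W (\<delta> + e))\<^sup>2 * f (\<delta> + e))) \<partial>lborel)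
        = t * (1 + 1 - \<delta>\<^sup>2 / 4 * (J0 + J0))"
      using regular_errorD(5,6)[OF f] W i3 i4 e3 e4 by (simp add: J0_def[symmetric])
    also have "\<dots> = t * (2 - J0 / 2 * \<delta>\<^sup>2)" by (simp add: algebra_simps)
    finally have "t * (2 - J0 / 2 * \<delta>\<^sup>2) = (\<integral>e. t * (f e + f (\<delta> + e) - \<delta>\<^sup>2 / 4 * ((W e)\<^sup>2 * f e + (W (\<delta> + e))\<^sup>2 * f (\<delta> + e))) \<partial>lborel)"
      by (rule sym)
    also have "\<dots> \<le> (\<integral>e. t\<^sup>2 * (f e * v e) + f (\<delta> + e) * (1 / v e) \<partial>lborel)"
      using regular_errorD(5)[OF f] W i1 i2' i3 i4
      by (intro integral_mono pw Bochner_Integration.integrable_add Bochner_Integration.integrable_diff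
          integrable_mult_right) auto
    also have "\<dots> = t\<^sup>2 * (\<integral>e. f e * v e \<partial>lborel) + (\<integral>e. f (\<delta> + e) * (1 / v e) \<partial>lborel)"
      using i1 i2' by (subst Bochner_Integration.integral_add) auto
    finally show "t * (2 - J0 / 2 * \<delta>\<^sup>2) \<le> t\<^sup>2 * (\<integral>e. v e \<partial>lborel_density f)
            + (\<integral>e. 1 / v (e - \<delta>) \<partial>lborel_density f)"
      by (simp only: dens(1)[OF v] trans[OF dens(1)[OF v'] shift])
  qed
qed

text \<open>The shift bounds at the individual covariate values are kept in linear form with a
  common parameter \<open>t\<close>, so that they can be integrated over \<open>x\<close>.
  Afterwards \<open>t = \<rho> / \<alpha>\<close> turns
  \<open>2 * t * \<rho> \<le> t\<^sup>2 * \<alpha> + \<beta>\<close> into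
  \<open>\<rho>\<^sup>2 \<le> \<alpha> * \<beta>\<close>.\<close>

lemma affinity_bound_observation_law:
  fixes \<mu> \<mu>' :: "real ^ 'd::finite \<Rightarrow> real"
  assumes f: "regular_error f" and h: "h \<in> covariate_densities C" and J: "0 \<le> J"
    and shift: "\<And>v lo hi \<delta> t. \<lbrakk>v \<in> borel_measurable borel; 0 < lo; \<And>e. lo \<le> v e; \<And>e. v e \<le> hi; \<bar>\<delta>\<bar> \<le> 1; 0 < t\<rbrakk>
      \<Longrightarrow> t * (2 - J * \<delta>\<^sup>2) \<le> t\<^sup>2 * (\<integral>e. v e \<partial>lborel_density f)
            + (\<integral>e. 1 / v (e - \<delta>) \<partial>lborel_density f)"
    and [measurable]: "\<mu> \<in> borel_measurable borel" "\<mu>' \<in> borel_measurable borel"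
    and close: "\<And>x. \<bar>\<mu> x - \<mu>' x\<bar> \<le> 1"
    and D: "(\<integral>x. (\<mu> x - \<mu>' x)\<^sup>2 \<partial>lborel_density h) \<le> D" "J * D \<le> 2"
  shows "affinity_bound (observation_law f \<mu> (\<lambda>_. 1) h) (observation_law f \<mu>' (\<lambda>_. 1) h) ((1 - J * D / 2)\<^sup>2)"
  unfolding affinity_bound_def
proof (intro allI impI)
  fix u :: "(real ^ 'd) \<times> real \<Rightarrow> real" and lo hi :: real
  assume "u \<in> borel_measurable (observation_law f \<mu> (\<lambda>_. 1) h)" and lo: "0 < lo" and b: "\<forall>z. lo \<le> u z \<and> u z \<le> hi"
  then have u: "u \<in> borel_measurable borel" by simp
  then have iu: "(\<lambda>z. 1 / u z) \<in> borel_measurable borel" by simp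
  have ib: "1 / u z \<le> 1 / lo" "0 \<le> 1 / u z" for z
    using b[rule_format, of z] lo by (simp_all add: frac_le)
  interpret H: prob_space "lborel_density h" using h by (intro prob_space_covariate_density)
  interpret P: prob_space "observation_law f \<mu> (\<lambda>_. 1) h"
    using f h by (intro prob_space_observation_law) auto
  define a b' where "a x = (\<integral>e. u (x, \<mu> x + e) \<partial>lborel_density f)"
    and "b' x = (\<integral>e. 1 / u (x, \<mu>' x + e) \<partial>lborel_density f)" for x
  define \<alpha> \<beta> where "\<alpha> = (\<integral>z. u z \<partial>observation_law f \<mu> (\<lambda>_. 1) h)"
    and "\<beta> = (\<integral>z. 1 / u z \<partial>observation_law f \<mu>' (\<lambda>_. 1) h)"
  note A = integral_observation_law[OF f h _ _ u, of \<mu> "\<lambda>_. 1" lo hi]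
  note B = integral_observation_law[OF f h _ _ iu, of \<mu>' "\<lambda>_. 1" 0 "1 / lo"]
  have \<alpha>: "\<alpha> = (\<integral>x. a x \<partial>lborel_density h)"
    unfolding \<alpha>_def a_def using A(1) b by simp
  have \<beta>: "\<beta> = (\<integral>x. b' x \<partial>lborel_density h)"
    unfolding \<beta>_def b'_def using B(1) ib by simp
  have ia: "integrable (lborel_density h) a"
    using A(2-4) b by (intro H.integral_between(1)[where lo = lo and hi = hi]) (simp_all add: a_def[abs_def])
  have ib': "integrable (lborel_density h) b'"
    using B(2-4) ib by (intro H.integral_between(1)[where lo = 0 and hi = "1 / lo"]) (simp_all add: b'_def[abs_def])
  have D2: "(\<mu> x - \<mu>' x)\<^sup>2 \<le> 1" for x using close[of x] by (simp add: abs_square_le_1)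
  have iD: "integrable (lborel_density h) (\<lambda>x. (\<mu> x - \<mu>' x)\<^sup>2)"
    using D2 by (intro H.integral_between(1)[where lo = 0 and hi = 1]) auto
  \<comment> \<open>Given \<open>x\<close>, the two laws of the response differ by the shift
    \<open>\<delta> = \<mu> x - \<mu>' x\<close>; with \<open>v e = u (x, \<mu> x + e)\<close>, the
    value \<open>v (e - \<delta>)\<close> is \<open>u (x, \<mu>' x + e)\<close>.\<close>
  have pw: "t * (2 - J * (\<mu> x - \<mu>' x)\<^sup>2) \<le> t\<^sup>2 * a x + b' x" if t: "0 < t" for t x
  proof -
    have "(\<lambda>e. u (x, \<mu> x + e)) \<in> borel_measurable borel"
      using u by (rule measurable_compose[rotated]) (simp add: borel_prod[symmetric])
    from shift[OF this lo, of hi "\<mu> x - \<mu>' x" t] b close[of x] t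
    show ?thesis by (simp add: a_def b'_def add.commute)
  qed
  have main: "t * (2 - J * D) \<le> t\<^sup>2 * \<alpha> + \<beta>" if t: "0 < t" for t
  proof -
    have "t * (2 - J * D) \<le> t * (2 - J * (\<integral>x. (\<mu> x - \<mu>' x)\<^sup>2 \<partial>lborel_density h))"
      using t J D(1) by (intro mult_left_mono diff_left_mono) auto
    also have "\<dots> = (\<integral>x. t * (2 - J * (\<mu> x - \<mu>' x)\<^sup>2) \<partial>lborel_density h)"
      using iD by (simp add: H.prob_space[simplified])
    also have "\<dots> \<le> (\<integral>x. t\<^sup>2 * a x + b' x \<partial>lborel_density h)"
      using iD ia ib' pw[OF t]
      by (intro integral_mono Bochner_Integration.integrable_add Bochner_Integration.integrable_diff
          integrable_mult_right) auto
    also have "\<dots> = t\<^sup>2 * \<alpha> + \<beta>" using ia ib' by (simp add: \<alpha> \<beta>)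
    finally show ?thesis .
  qed
  have \<alpha>_pos: "\<alpha> > 0"
    using P.integral_between(2)[of u lo hi] u b lo by (auto simp: \<alpha>_def)
  have \<beta>_nn: "0 \<le> \<beta>" unfolding \<beta>_def using ib by (intro Bochner_Integration.integral_nonneg) auto
  define \<rho> where "\<rho> = 1 - J * D / 2"
  show "(1 - J * D / 2)\<^sup>2 \<le> (\<integral>z. u z \<partial>observation_law f \<mu> (\<lambda>_. 1) h) * (\<integral>z. 1 / u z \<partial>observation_law f \<mu>' (\<lambda>_. 1) h)"
  proof (cases "\<rho> > 0")
    case True
    have "\<rho> / \<alpha> * (2 * \<rho>) \<le> (\<rho> / \<alpha>)\<^sup>2 * \<alpha> + \<beta>"
      using main[of "\<rho> / \<alpha>"] True \<alpha>_pos by (simp add: \<rho>_def)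
    moreover have "(\<rho> / \<alpha>)\<^sup>2 * \<alpha> = \<rho>\<^sup>2 / \<alpha>" "\<rho> / \<alpha> * (2 * \<rho>) = \<rho>\<^sup>2 / \<alpha> + \<rho>\<^sup>2 / \<alpha>"
      using \<alpha>_pos by (simp_all add: power2_eq_square field_simps)
    ultimately have "\<rho>\<^sup>2 / \<alpha> \<le> \<beta>" by linarith
    then have "\<rho>\<^sup>2 \<le> \<alpha> * \<beta>" using \<alpha>_pos by (simp add: field_simps)
    then show ?thesis by (simp add: \<rho>_def \<alpha>_def \<beta>_def)
  next
    case False
    then have "1 - J * D / 2 = 0" using D(2) by (simp add: \<rho>_def)
    then show ?thesis using \<alpha>_pos \<beta>_nn by (simp add: \<alpha>_def \<beta>_def)
  qed
qed

section \<open>Members of the Hoelder class\<close>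

text \<open>A class of bounded functions closed under differentiation. It gives bounds on all
  derivatives of the bump without computing them.\<close>

inductive_set trig_polys :: "(real \<Rightarrow> real) set" where
  const: "(\<lambda>_. c) \<in> trig_polys"
| sin: "(\<lambda>u. sin (pi * u)) \<in> trig_polys"
| cos: "(\<lambda>u. cos (pi * u)) \<in> trig_polys"
| add: "p \<in> trig_polys \<Longrightarrow> q \<in> trig_polys \<Longrightarrow> (\<lambda>u. p u + q u) \<in> trig_polys"
| mult: "p \<in> trig_polys \<Longrightarrow> q \<in> trig_polys \<Longrightarrow> (\<lambda>u. p u * q u) \<in> trig_polys"

lemma trig_polys_bounded: "q \<in> trig_polys \<Longrightarrow> \<exists>B. \<forall>u. \<bar>q u\<bar> \<le> B"
proof (induction rule: trig_polys.induct)
  case (add p q)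
  then obtain B C where *: "\<And>u. \<bar>p u\<bar> \<le> B" "\<And>u. \<bar>q u\<bar> \<le> C" by blast
  have "\<bar>p u + q u\<bar> \<le> B + C" for u using *(1)[of u] *(2)[of u] by linarith
  then show ?case by blast
next
  case (mult p q)
  then obtain B C where *: "\<And>u. \<bar>p u\<bar> \<le> B" "\<And>u. \<bar>q u\<bar> \<le> C" by blast
  have "\<bar>p u * q u\<bar> \<le> B * C" for u
    unfolding abs_mult using *(1)[of u] *(2)[of u] by (intro mult_mono) auto
  then show ?case by blast
qed (auto intro: exI[of _ 1])

lemma trig_polys_has_derivative:
  "q \<in> trig_polys \<Longrightarrow> \<exists>q'\<in>trig_polys. \<forall>u. (q has_real_derivative q' u) (at u)"
proof (induction rule: trig_polys.induct)
  case (const c)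
  show ?case by (rule bexI[of _ "\<lambda>_. 0"]) (auto intro: trig_polys.intros)
next
  case sin
  have "(\<lambda>u. pi * cos (pi * u)) \<in> trig_polys" by (intro trig_polys.intros)
  then show ?case by (rule bexI[rotated]) (auto intro!: derivative_eq_intros)
next
  case cos
  have "(\<lambda>u. - pi * sin (pi * u)) \<in> trig_polys" by (intro trig_polys.intros)
  then show ?case by (rule bexI[rotated]) (auto intro!: derivative_eq_intros)
next
  case (add p q)
  then obtain p' q' where *: "p' \<in> trig_polys" "\<And>u. (p has_real_derivative p' u) (at u)"
    "q' \<in> trig_polys" "\<And>u. (q has_real_derivative q' u) (at u)" by blast
  have "(\<lambda>u. p' u + q' u) \<in> trig_polys" by (intro trig_polys.intros *)
  then show ?case by (rule bexI[rotated]) (auto intro!: derivative_eq_intros *)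
next
  case (mult p q)
  then obtain p' q' where *: "p' \<in> trig_polys" "\<And>u. (p has_real_derivative p' u) (at u)"
    "q' \<in> trig_polys" "\<And>u. (q has_real_derivative q' u) (at u)" by blast
  have "(\<lambda>u. p' u * q u + q' u * p u) \<in> trig_polys" by (intro trig_polys.intros * mult)
  then show ?case by (rule bexI[rotated]) (intro allI DERIV_mult *)
qed

text \<open>All derivatives of \<open>sin (\<pi> u) ^ (s + 2)\<close> up to order \<open>s + 1\<close> retain a factor
  \<open>sin (\<pi> u)\<close>, so they vanish at the integers.\<close>

lemma sin_power_derivatives:
  obtains \<phi> :: "nat \<Rightarrow> real \<Rightarrow> real" and A where
    "\<phi> 0 = (\<lambda>u. sin (pi * u) ^ (s + 2))"
    "\<And>k u. k \<le> s \<Longrightarrow> (\<phi> k has_real_derivative \<phi> (Suc k) u) (at u)"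
    "\<And>k j. k \<le> Suc s \<Longrightarrow> \<phi> k (of_int j) = 0"
    "\<And>k u. k \<le> Suc s \<Longrightarrow> \<bar>\<phi> k u\<bar> \<le> A" "A \<ge> 1"
proof -
  have "\<forall>q. \<exists>q'. q \<in> trig_polys \<longrightarrow> q' \<in> trig_polys \<and> (\<forall>u. (q has_real_derivative q' u) (at u))"
    using trig_polys_has_derivative by blast
  then obtain D where D: "\<And>q. q \<in> trig_polys \<Longrightarrow> D q \<in> trig_polys"
    "\<And>q u. q \<in> trig_polys \<Longrightarrow> (q has_real_derivative D q u) (at u)" by metis
  \<comment> \<open>\<open>q k\<close> is the cofactor of \<open>sin (pi * u) ^ (s + 2 - k)\<close>
    in the \<open>k\<close>-th derivative; the recursion is the product rule with one sine factored
    out.\<close>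
  define q where "q = rec_nat (\<lambda>_. 1)
    (\<lambda>k p u. real (s + 2 - k) * pi * cos (pi * u) * p u + sin (pi * u) * D p u)"
  have q0: "q 0 = (\<lambda>_. 1)" by (simp add: q_def)
  have qS: "q (Suc k) = (\<lambda>u. real (s + 2 - k) * pi * cos (pi * u) * q k u + sin (pi * u) * D (q k) u)" for k
    by (simp add: q_def)
  have qT: "q k \<in> trig_polys" for k
    by (induction k) (auto simp: q0 qS intro!: trig_polys.intros D)
  define \<phi> where "\<phi> k u = sin (pi * u) ^ (s + 2 - k) * q k u" for k u
  have "\<exists>B. \<forall>u. \<bar>\<phi> k u\<bar> \<le> B" for k
  proof -
    obtain B where B: "\<And>u. \<bar>q k u\<bar> \<le> B" using trig_polys_bounded[OF qT] by blast
    have "\<bar>\<phi> k u\<bar> \<le> 1 * B" for u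
      unfolding \<phi>_def abs_mult power_abs using B[of u]
      by (intro mult_mono power_le_one) auto
    then show ?thesis by blast
  qed
  then obtain b where b: "\<And>k u. \<bar>\<phi> k u\<bar> \<le> b k" by metis
  show ?thesis
  proof (rule that[of \<phi> "1 + (\<Sum>k\<le>Suc s. b k)"])
    show "\<phi> 0 = (\<lambda>u. sin (pi * u) ^ (s + 2))" by (simp add: \<phi>_def q0 fun_eq_iff)
    show "(\<phi> k has_real_derivative \<phi> (Suc k) u) (at u)" if "k \<le> s" for k u
    proof -
      define m where "m = Suc s - k"
      have m: "s + 2 - k = Suc m" "s + 2 - Suc k = m" using that by (auto simp: m_def)
      have "((\<lambda>u. sin (pi * u)) has_real_derivative cos (pi * u) * pi) (at u)"
        by (auto intro!: derivative_eq_intros)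
      from DERIV_mult[OF DERIV_power[OF this, of "Suc m"] D(2)[OF qT[of k]]]
      have "((\<lambda>u. sin (pi * u) ^ Suc m * q k u) has_real_derivative
         (real (Suc m) * (sin (pi * u) ^ m * (cos (pi * u) * pi))) * q k u + D (q k) u * sin (pi * u) ^ Suc m) (at u)"
        by (simp add: mult_ac)
      moreover have "(real (Suc m) * (sin (pi * u) ^ m * (cos (pi * u) * pi))) * q k u + D (q k) u * sin (pi * u) ^ Suc m
         = \<phi> (Suc k) u"
        unfolding \<phi>_def qS m by (simp add: algebra_simps)
      ultimately show ?thesis unfolding \<phi>_def[of k, abs_def] m by simp
    qed
    show "\<phi> k (of_int j) = 0" if "k \<le> Suc s" for k j
    proof -
      have "sin (pi * of_int j) = 0" by (subst sin_zero_iff_int2) (auto intro!: exI[of _ j])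
      moreover have "0 < s + 2 - k" using that by simp
      ultimately show ?thesis by (simp add: \<phi>_def)
    qed
    have b0: "0 \<le> b k" for k using b[of k 0] by linarith
    show "\<bar>\<phi> k u\<bar> \<le> 1 + (\<Sum>k\<le>Suc s. b k)" if "k \<le> Suc s" for k u
    proof -
      have "b k \<le> (\<Sum>k\<le>Suc s. b k)" using that b0 by (intro member_le_sum) auto
      then show ?thesis using b[of k u] by linarith
    qed
    show "1 + (\<Sum>k\<le>Suc s. b k) \<ge> 1" using b0 by (simp add: sum_nonneg)
  qed
qed

text \<open>Off the integers the weight is locally constant. At an integer both
  \<open>\<phi>\<close> and \<open>\<phi>'\<close> vanish, so a bounded weight leaves the limit 0 of
  the difference quotient unchanged even if it jumps.\<close>

lemma has_real_derivative_floor_weight: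
  fixes w :: "int \<Rightarrow> real"
  assumes w: "\<And>i. \<bar>w i\<bar> \<le> 1"
    and d: "\<And>u. (\<phi> has_real_derivative \<phi>' u) (at u)"
    and z: "\<And>j. \<phi> (of_int j) = 0" "\<And>j. \<phi>' (of_int j) = 0"
  shows "((\<lambda>u. w \<lfloor>u\<rfloor> * \<phi> u) has_real_derivative w \<lfloor>u\<rfloor> * \<phi>' u) (at u)"
proof (cases "u \<in> \<int>")
  case False
  have "((\<lambda>v. w \<lfloor>u\<rfloor> * \<phi> v) has_real_derivative w \<lfloor>u\<rfloor> * \<phi>' u) (at u)"
    by (rule DERIV_cmult[OF d])
  moreover have "open {of_int \<lfloor>u\<rfloor> <..< of_int \<lfloor>u\<rfloor> + 1 :: real}" by simp
  moreover have "of_int \<lfloor>u\<rfloor> \<noteq> u" using False by (metis Ints_of_int)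
  then have "u \<in> {of_int \<lfloor>u\<rfloor> <..< of_int \<lfloor>u\<rfloor> + 1}"
    using of_int_floor_le[of u] floor_correct[of u] by (auto simp: less_le)
  moreover have "w \<lfloor>u\<rfloor> * \<phi> v = w \<lfloor>v\<rfloor> * \<phi> v" if "v \<in> {of_int \<lfloor>u\<rfloor> <..< of_int \<lfloor>u\<rfloor> + 1}" for v
  proof -
    have "\<lfloor>v\<rfloor> = \<lfloor>u\<rfloor>" using that by (intro floor_unique) auto
    then show ?thesis by simp
  qed
  ultimately show ?thesis by (rule has_field_derivative_transform_within_open)
next
  case True
  then obtain j where j: "u = of_int j" by (auto elim: Ints_cases)
  have "((\<lambda>h. (\<phi> (u + h) - \<phi> u) / h) \<longlongrightarrow> 0) (at 0)"
    using d[of u] z(2)[of j] j by (simp add: DERIV_def)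
  then have lim: "((\<lambda>h. \<phi> (u + h) / h) \<longlongrightarrow> 0) (at 0)"
    using z(1)[of j] j by simp
  have "((\<lambda>h. (w \<lfloor>u + h\<rfloor> * \<phi> (u + h) - w \<lfloor>u\<rfloor> * \<phi> u) / h) \<longlongrightarrow> 0) (at 0)"
  proof (rule Lim_null_comparison[OF _ tendsto_rabs_zero[OF lim]])
    show "\<forall>\<^sub>F h in at 0. norm ((w \<lfloor>u + h\<rfloor> * \<phi> (u + h) - w \<lfloor>u\<rfloor> * \<phi> u) / h) \<le> \<bar>\<phi> (u + h) / h\<bar>"
    proof (rule always_eventually, rule allI)
      fix h
      have "\<bar>w \<lfloor>u + h\<rfloor>\<bar> * \<bar>\<phi> (u + h) / h\<bar> \<le> 1 * \<bar>\<phi> (u + h) / h\<bar>"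
        by (intro mult_right_mono w) auto
      then show "norm ((w \<lfloor>u + h\<rfloor> * \<phi> (u + h) - w \<lfloor>u\<rfloor> * \<phi> u) / h) \<le> \<bar>\<phi> (u + h) / h\<bar>"
        using z(1)[of j] j by (simp add: abs_mult)
    qed
  qed
  then show ?thesis using z(2)[of j] j by (simp add: DERIV_def)
qed

text \<open>Interpolation: an increment of \<open>G s\<close> is at most \<open>2 * A\<close> and at
  most \<open>\<Lambda>\<close> times the distance, and the geometric mean of the two with weights
  \<open>1 - \<gamma>\<close> and \<open>\<gamma>\<close> is a Hoelder bound.\<close>

lemma hoelder_classI:
  fixes G :: "nat \<Rightarrow> real \<Rightarrow> real"
  assumes d: "\<And>k z. k \<le> s \<Longrightarrow> (G k has_real_derivative G (Suc k) z) (at z)"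
    and B: "\<And>k z. k \<le> s \<Longrightarrow> \<bar>G k z\<bar> \<le> B k"
    and A: "\<And>z. \<bar>G s z\<bar> \<le> A" and \<Lambda>: "\<And>z. \<bar>G (Suc s) z\<bar> \<le> \<Lambda>" "0 < \<Lambda>" and A0: "0 < A"
    and L: "(2 * A) powr (1 - \<gamma>) * \<Lambda> powr \<gamma> \<le> L" and \<gamma>: "0 < \<gamma>" "\<gamma> \<le> 1"
  shows "G 0 \<in> hoelder_class s \<gamma> L B"
proof -
  have deriv: "(deriv ^^ k) (G 0) = G k" if "k \<le> s" for k
    using that
  proof (induction k)
    case (Suc k)
    then have "(deriv ^^ Suc k) (G 0) = deriv (G k)" by simp
    also have "\<dots> = G (Suc k)" using d[of k] Suc by (intro ext DERIV_imp_deriv) auto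
    finally show ?case .
  qed simp
  have holder: "\<bar>G s y - G s z\<bar> \<le> L * \<bar>y - z\<bar> powr \<gamma>" for y z
  proof (cases "G s y = G s z")
    case True
    have "0 \<le> (2 * A) powr (1 - \<gamma>) * \<Lambda> powr \<gamma>" by simp
    then have "0 \<le> L" using L by linarith
    then show ?thesis using True by simp
  next
    case False
    let ?m = "\<bar>G s y - G s z\<bar>"
    have m: "?m > 0" using False by simp
    have m1: "?m \<le> 2 * A" using A[of y] A[of z] by linarith
    have "norm (G s y - G s z) \<le> \<Lambda> * norm (y - z)"
      using d[of s] \<Lambda>(1) by (intro field_differentiable_bound[where S = UNIV and f' = "G (Suc s)"]) auto
    then have m2: "?m \<le> \<Lambda> * \<bar>y - z\<bar>" by simp
    have "?m = ?m powr ((1 - \<gamma>) + \<gamma>)" using m by simp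
    also have "\<dots> = ?m powr (1 - \<gamma>) * ?m powr \<gamma>" by (rule powr_add)
    also have "\<dots> \<le> (2 * A) powr (1 - \<gamma>) * (\<Lambda> * \<bar>y - z\<bar>) powr \<gamma>"
      using m m1 m2 \<gamma> by (intro mult_mono powr_mono2) auto
    also have "\<dots> = ((2 * A) powr (1 - \<gamma>) * \<Lambda> powr \<gamma>) * \<bar>y - z\<bar> powr \<gamma>"
      using \<Lambda>(2) by (simp add: powr_mult)
    also have "\<dots> \<le> L * \<bar>y - z\<bar> powr \<gamma>" by (intro mult_right_mono L) auto
    finally show ?thesis .
  qed
  show ?thesis
    unfolding hoelder_class_def mem_Collect_eq
  proof (intro conjI allI impI)
    show "(deriv ^^ k) (G 0) differentiable at z" if "k < s" for k z
      using d[of k z] that deriv[of k] by (auto simp: real_differentiable_def)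
    show "\<bar>(deriv ^^ s) (G 0) y - (deriv ^^ s) (G 0) z\<bar> \<le> L * \<bar>y - z\<bar> powr \<gamma>" for y z
      using holder deriv[of s] by simp
    show "\<bar>(deriv ^^ k) (G 0) z\<bar> \<le> B k" if "k \<le> s" for k z
      using B[OF that] deriv[OF that] by simp
  qed
qed

lemma hoelder_class_continuous:
  assumes g: "g \<in> hoelder_class s \<gamma> L B" and \<gamma>: "0 < \<gamma>"
  shows "continuous_on UNIV g"
proof (cases "s = 0")
  case True
  have lip: "\<bar>g y - g z\<bar> \<le> L * \<bar>y - z\<bar> powr \<gamma>" for y z
    using g True by (simp add: hoelder_class_def)
  show ?thesis
    unfolding continuous_on_def
  proof
    fix z :: real
    have "((\<lambda>y. L * \<bar>y - z\<bar> powr \<gamma>) \<longlongrightarrow> L * \<bar>z - z\<bar> powr \<gamma>) (at z within UNIV)"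
      using \<gamma> by (intro tendsto_intros) auto
    then have "((\<lambda>y. L * \<bar>y - z\<bar> powr \<gamma>) \<longlongrightarrow> 0) (at z within UNIV)"
      using \<gamma> by simp
    then have "((\<lambda>y. g y - g z) \<longlongrightarrow> 0) (at z within UNIV)"
      by (rule Lim_null_comparison[rotated]) (use lip in auto)
    then show "(g \<longlongrightarrow> g z) (at z within UNIV)" using LIM_zero_iff by blast
  qed
next
  case False
  then have "\<forall>z. (deriv ^^ 0) g differentiable at z" using g unfolding hoelder_class_def by blast
  then show ?thesis
    by (intro continuous_at_imp_continuous_on) (auto intro: differentiable_imp_continuous_within)
qed

lemma multi_index_class_continuous:
  fixes \<mu> :: "real ^ 'd::finite \<Rightarrow> real"
  assumes "\<mu> \<in> multi_index_class p s \<gamma> L B" "0 < \<gamma>"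
  shows "continuous_on UNIV \<mu>"
proof -
  from assms obtain g b where \<mu>: "\<mu> = (\<lambda>x. \<Sum>i<p. g i (b i \<bullet> x))" and g: "\<And>i. i < p \<Longrightarrow> g i \<in> hoelder_class s \<gamma> L B"
    by (auto simp: multi_index_class_def)
  show ?thesis unfolding \<mu>
  proof (rule continuous_on_sum)
    fix i assume "i \<in> {..<p}"
    then have "continuous_on UNIV (g i)" using hoelder_class_continuous[OF g assms(2)] by simp
    then show "continuous_on UNIV (\<lambda>x. g i (b i \<bullet> x))"
      by (rule continuous_on_compose2) (auto intro!: continuous_on_inner continuous_on_const continuous_on_id)
  qed
qed

text \<open>Supplies the fixed non-constant components next to the perturbed one. Derivatives of the
  sine are its shifts by multiples of \<open>pi / 2\<close>, so one amplitude bounds all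
  orders.\<close>

lemma scaled_sin_in_hoelder_class:
  assumes \<epsilon>: "0 < \<epsilon>" "\<And>k. k \<le> s \<Longrightarrow> \<epsilon> \<le> B k" "2 * \<epsilon> \<le> L" and \<gamma>: "0 < \<gamma>" "\<gamma> \<le> 1"
  shows "(\<lambda>z. \<epsilon> * sin z) \<in> hoelder_class s \<gamma> L B"
proof -
  define G where "G k z = \<epsilon> * sin (z + real k * (pi / 2))" for k z
  have bd: "\<bar>G k z\<bar> \<le> \<epsilon>" for k z
    using \<epsilon>(1) by (simp add: G_def abs_mult)
  have "(2 * \<epsilon>) powr (1 - \<gamma>) * \<epsilon> powr \<gamma> \<le> (2 * \<epsilon>) powr (1 - \<gamma>) * (2 * \<epsilon>) powr \<gamma>"
    using \<epsilon> \<gamma> by (intro mult_left_mono powr_mono2) auto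
  also have "\<dots> = 2 * \<epsilon>" using \<epsilon> by (simp add: powr_add[symmetric])
  finally have L: "(2 * \<epsilon>) powr (1 - \<gamma>) * \<epsilon> powr \<gamma> \<le> L" using \<epsilon> by simp
  have "G 0 \<in> hoelder_class s \<gamma> L B"
  proof (rule hoelder_classI[OF _ _ bd bd _ _ L])
    show "(G k has_real_derivative G (Suc k) z) (at z)" for k z
    proof -
      have d: "(G k has_real_derivative \<epsilon> * cos (z + real k * (pi / 2))) (at z)"
        unfolding G_def by (auto intro!: derivative_eq_intros)
      have "z + real (Suc k) * (pi / 2) = z + real k * (pi / 2) + pi / 2"
        by (simp add: field_simps)
      moreover have "sin (y + pi / 2) = cos y" for y by (simp add: sin_add)
      ultimately have "sin (z + real (Suc k) * (pi / 2)) = cos (z + real k * (pi / 2))"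
        by (simp only:)
      then show ?thesis using d by (simp only: G_def)
    qed
    show "\<bar>G k z\<bar> \<le> B k" if "k \<le> s" for k z using bd[of k z] \<epsilon>(2)[OF that] by linarith
  qed (use \<epsilon> \<gamma> in auto)
  then show ?thesis by (simp add: G_def[abs_def])
qed

text \<open>The factor \<open>M powr (- (real s + \<gamma>))\<close> cancels both the growth
  \<open>M ^ s\<close> of the derivative of order \<open>s\<close> and the further
  \<open>M powr \<gamma>\<close> from interpolating with the next derivative. Hence
  \<open>a0\<close> can be chosen independently of the resolution \<open>M\<close> and of the signs
  \<open>w\<close>.\<close>

lemma bump_in_hoelder_class:
  assumes \<gamma>: "0 < \<gamma>" "\<gamma> \<le> 1" and L: "0 < L" and B: "\<And>k. k \<le> s \<Longrightarrow> 0 < B k"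
  obtains a0 where "0 < a0"
    "\<And>w M a. \<lbrakk>\<And>i. \<bar>w i\<bar> \<le> (1::real); 1 \<le> M; 0 < a; a \<le> a0\<rbrakk> \<Longrightarrow>
       (\<lambda>z. a * M powr (- (real s + \<gamma>)) * (w \<lfloor>M * z\<rfloor> * sin (pi * (M * z)) ^ (s + 2))) \<in> hoelder_class s \<gamma> L B"
proof -
  obtain \<phi> A where \<phi>: "\<phi> 0 = (\<lambda>u. sin (pi * u) ^ (s + 2))"
    "\<And>k u. k \<le> s \<Longrightarrow> (\<phi> k has_real_derivative \<phi> (Suc k) u) (at u)"
    "\<And>k j. k \<le> Suc s \<Longrightarrow> \<phi> k (of_int j) = 0"
    "\<And>k u. k \<le> Suc s \<Longrightarrow> \<bar>\<phi> k u\<bar> \<le> A" and A: "A \<ge> 1" using sin_power_derivatives[of s] by blast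
  define \<beta> where "\<beta> = Min (B ` {..s})"
  have \<beta>: "0 < \<beta>" "\<And>k. k \<le> s \<Longrightarrow> \<beta> \<le> B k"
    using B by (auto simp: \<beta>_def)
  \<comment> \<open>\<open>\<beta>\<close> serves the bounds on the derivatives,
    \<open>L / 2\<close> the Hoelder constant, where interpolation produces
    \<open>2 * (a * A)\<close>.\<close>
  define a0 where "a0 = min \<beta> (L / 2) / A"
  show ?thesis
  proof (rule that[of a0])
    show "0 < a0" using \<beta> L A by (simp add: a0_def)
    fix w :: "int \<Rightarrow> real" and M a :: real
    assume w: "\<And>i. \<bar>w i\<bar> \<le> 1" and M: "1 \<le> M" and a: "0 < a" "a \<le> a0"
    have aA: "a * A \<le> \<beta>" "2 * (a * A) \<le> L"
      using a(2) A unfolding a0_def by (simp_all add: pos_le_divide_eq)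
    define c where "c = a * M powr (- (real s + \<gamma>))"
    have c: "c > 0" using a M by (simp add: c_def)
    define G where "G k z = c * M ^ k * (w \<lfloor>M * z\<rfloor> * \<phi> k (M * z))" for k z
    have bd: "\<bar>G k z\<bar> \<le> c * M ^ k * A" if "k \<le> Suc s" for k z
    proof -
      have "\<bar>w \<lfloor>M * z\<rfloor> * \<phi> k (M * z)\<bar> \<le> 1 * A"
        unfolding abs_mult using w \<phi>(4)[OF that] by (intro mult_mono) auto
      then show ?thesis using c M by (simp add: G_def abs_mult mult_left_mono)
    qed
    have "(2 * (c * M ^ s * A)) powr (1 - \<gamma>) * (c * M ^ Suc s * A) powr \<gamma>
       \<le> (2 * (c * M ^ s * A)) powr (1 - \<gamma>) * (2 * (c * M ^ s * A) * M) powr \<gamma>"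
      using c M A \<gamma> by (intro mult_left_mono powr_mono2) (auto simp: mult_ac)
    also have "\<dots> = (2 * (c * M ^ s * A)) powr (1 - \<gamma>) * ((2 * (c * M ^ s * A)) powr \<gamma> * M powr \<gamma>)"
      using c M A by (subst powr_mult) auto
    also have "\<dots> = (2 * (c * M ^ s * A)) powr (1 - \<gamma> + \<gamma>) * M powr \<gamma>"
      by (simp only: powr_add mult.assoc)
    also have "\<dots> = 2 * (c * M ^ s * A) * M powr \<gamma>" using c M A by simp
    also have "\<dots> = 2 * (a * A) * (M powr (- (real s + \<gamma>)) * (M powr real s * M powr \<gamma>))"
      using M by (simp add: c_def powr_realpow)
    also have "M powr (- (real s + \<gamma>)) * (M powr real s * M powr \<gamma>) = 1"
      using M by (simp add: powr_add[symmetric])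
    finally have LL: "(2 * (c * M ^ s * A)) powr (1 - \<gamma>) * (c * M ^ Suc s * A) powr \<gamma> \<le> L"
      using aA by simp
    have "G 0 \<in> hoelder_class s \<gamma> L B"
    proof (rule hoelder_classI[OF _ _ bd bd _ _ LL])
      fix k z assume k: "k \<le> s"
      have "((\<lambda>u. w \<lfloor>u\<rfloor> * \<phi> k u) has_real_derivative w \<lfloor>M * z\<rfloor> * \<phi> (Suc k) (M * z)) (at (M * z))"
        using k by (intro has_real_derivative_floor_weight w \<phi>) auto
      then have "((\<lambda>z. w \<lfloor>M * z\<rfloor> * \<phi> k (M * z)) has_real_derivative (w \<lfloor>M * z\<rfloor> * \<phi> (Suc k) (M * z)) * M) (at z)"
        by (rule DERIV_chain2[where g = "\<lambda>z. M * z" and x = z]) (auto intro!: derivative_eq_intros)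
      from DERIV_cmult[OF this, of "c * M ^ k"]
      show "(G k has_real_derivative G (Suc k) z) (at z)"
        by (simp add: G_def[abs_def] mult_ac)
      have "c * M ^ k * A \<le> \<beta>"
      proof -
        have "M ^ k * M powr (- (real s + \<gamma>)) = M powr (real k - (real s + \<gamma>))"
          using M by (simp add: powr_realpow[symmetric] powr_add[symmetric] algebra_simps)
        also have "\<dots> \<le> M powr 0" using M k \<gamma> by (intro powr_mono) auto
        finally have "M ^ k * M powr (- (real s + \<gamma>)) \<le> 1" using M by simp
        then have "(a * A) * (M ^ k * M powr (- (real s + \<gamma>))) \<le> (a * A) * 1"
          using a A by (intro mult_left_mono) auto
        then show ?thesis using aA by (simp add: c_def mult_ac)
      qed
      then show "\<bar>G k z\<bar> \<le> B k" using bd[of k z] \<beta>(2)[OF k] k by linarith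
    qed (use c M A \<gamma> in auto)
    then show "(\<lambda>z. a * M powr (- (real s + \<gamma>)) * (w \<lfloor>M * z\<rfloor> * sin (pi * (M * z)) ^ (s + 2))) \<in> hoelder_class s \<gamma> L B"
      by (simp add: G_def[abs_def] c_def \<phi>(1))
  qed
qed

section \<open>Lower bound\<close>

text \<open>The first direction is a coordinate axis, so that the perturbations live on slabs of the
  cube. The remaining ones come from the opposite vector if \<open>p \<le> 2\<close>, and otherwise
  from equally spaced angles below \<open>pi\<close>, which the cosine separates.\<close>

lemma unit_vectors_exist:
  fixes k :: "'d::finite"
  assumes "CARD('d) \<ge> 2 \<or> p \<le> 2"
  obtains b :: "nat \<Rightarrow> real ^ 'd" where "b 0 = axis k 1" "\<And>i. i < p \<Longrightarrow> norm (b i) = 1" "inj_on b {..<p}"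
proof (cases "p \<le> 2")
  case True
  define b :: "nat \<Rightarrow> real ^ 'd" where "b i = (if i = 0 then axis k 1 else - axis k 1)" for i
  have ne: "axis k (1::real) \<noteq> - axis k 1"
  proof
    assume "axis k (1::real) = - axis k 1"
    then have "axis k (1::real) $ k = (- axis k 1) $ k" by (rule arg_cong)
    then show False by (simp add: axis_def)
  qed
  have "inj_on b {..<p}"
  proof (rule inj_onI)
    fix i j assume *: "i \<in> {..<p}" "j \<in> {..<p}" "b i = b j"
    then have "i < 2" "j < 2" using True by auto
    then show "i = j" using *(3) ne ne[symmetric] by (auto simp: b_def split: if_splits)
  qed
  then show ?thesis by (intro that[of b]) (auto simp: b_def)
next
  case False
  then have "CARD('d) \<ge> 2" using assms by simp
  then obtain l :: 'd where l: "l \<noteq> k"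
    by (metis UNIV_I card_2_iff' card_le_Suc0_iff_eq finite numeral_2_eq_2 not_less_eq_eq)
  define \<theta> where "\<theta> i = pi * real i / real p" for i
  define b :: "nat \<Rightarrow> real ^ 'd" where "b i = cos (\<theta> i) *\<^sub>R axis k 1 + sin (\<theta> i) *\<^sub>R axis l 1" for i
  have "norm (b i) = 1" for i
  proof -
    have "b i \<bullet> b i = (cos (\<theta> i))\<^sup>2 + (sin (\<theta> i))\<^sup>2"
      using l by (simp add: b_def inner_add_left inner_add_right inner_axis_axis power2_eq_square)
    then show ?thesis by (simp add: norm_eq_1)
  qed
  moreover have "inj_on b {..<p}"
  proof (rule inj_onI)
    fix i j assume ij: "i \<in> {..<p}" "j \<in> {..<p}" "b i = b j"
    then have "b i $ k = b j $ k" by simp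
    then have "cos (\<theta> i) = cos (\<theta> j)" using l by (simp add: b_def axis_def)
    moreover have "0 \<le> \<theta> m \<and> \<theta> m \<le> pi" if "m < p" for m
      using that by (simp add: \<theta>_def divide_le_eq)
    ultimately have "\<theta> i = \<theta> j"
      using ij cos_inj_pi[of "\<theta> i" "\<theta> j"] by simp
    then show "i = j" using False by (simp add: \<theta>_def)
  qed
  ultimately show ?thesis by (intro that[of b]) (auto simp: b_def \<theta>_def)
qed

lemma emeasure_slab:
  fixes k :: "'d::finite"
  assumes "0 \<le> l" "l \<le> u" "u \<le> 1"
  shows "{x \<in> cbox 0 (1 :: real ^ 'd). l \<le> x $ k \<and> x $ k \<le> u} \<in> sets borel"
    and "emeasure lborel {x \<in> cbox 0 (1 :: real ^ 'd). l \<le> x $ k \<and> x $ k \<le> u} = ennreal (u - l)"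
proof -
  let ?a = "(\<chi> i. if i = k then l else 0) :: real ^ 'd" and ?b = "(\<chi> i. if i = k then u else 1) :: real ^ 'd"
  have eq: "{x \<in> cbox 0 (1 :: real ^ 'd). l \<le> x $ k \<and> x $ k \<le> u} = cbox ?a ?b"
    using assms by (auto simp: mem_box_cart intro: order_trans split: if_splits) (metis order_trans)+
  show "{x \<in> cbox 0 (1 :: real ^ 'd). l \<le> x $ k \<and> x $ k \<le> u} \<in> sets borel" unfolding eq by simp
  have "cbox ?a ?b \<noteq> {}" using assms by (auto simp: interval_ne_empty_cart)
  then have "measure lborel (cbox ?a ?b) = (\<Prod>i\<in>UNIV. ?b $ i - ?a $ i)" by (rule content_cbox_cart)
  also have "\<dots> = (\<Prod>i\<in>UNIV. if i = k then u - l else 1)" by (intro prod.cong) auto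
  also have "\<dots> = u - l" by simp
  finally show "emeasure lborel {x \<in> cbox 0 (1 :: real ^ 'd). l \<le> x $ k \<and> x $ k \<le> u} = ennreal (u - l)"
    unfolding eq using emeasure_lborel_cbox_finite[of ?a ?b]
    by (subst emeasure_eq_ennreal_measure) (auto simp: less_top)
qed

lemma uniform_in_covariate_densities:
  assumes "C > 1"
  shows "indicator (cbox 0 1) \<in> (covariate_densities C :: (real ^ 'd::finite \<Rightarrow> real) set)"
proof -
  have "cbox 0 (1 :: real ^ 'd) = {x \<in> cbox 0 1. 0 \<le> x $ undefined \<and> x $ undefined \<le> 1}"
    by (auto simp: mem_box_cart)
  then have "emeasure lborel (cbox 0 (1 :: real ^ 'd)) = 1"
    using emeasure_slab(2)[of 0 1 "undefined :: 'd"] by simp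
  then show ?thesis
    using assms by (auto simp: covariate_densities_def divide_le_eq ennreal_indicator)
qed

lemma unit_scale_in_scale_functions:
  assumes "C' > 0"
  shows "(\<lambda>_. 1) \<in> (scale_functions C' :: (real ^ 'd::finite \<Rightarrow> real) set)"
  using assms unfolding scale_functions_def by (auto intro!: exI[of _ 0])

lemma sets_sample_law [measurable_cong]:
  "sets (sample_law n f \<mu> \<sigma> h) = sets (PiM {..<n} (\<lambda>_. borel))"
  unfolding sample_law_def by (intro sets_PiM_cong) auto

lemma prob_space_sample_law:
  assumes "regular_error f" "h \<in> covariate_densities C"
    and "\<mu> \<in> borel_measurable borel" "\<sigma> \<in> borel_measurable borel"
  shows "prob_space (sample_law n f \<mu> \<sigma> h)"
  unfolding sample_law_def by (intro prob_space_PiM prob_space_observation_law[OF assms])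

text \<open>The loss dominates the sum of the local losses on the disjoint cells. Averaged over all
  sign patterns, the loss on cell \<open>j\<close> is estimated by pairing each pattern with its
  flip at \<open>j\<close>; the two-point bound \<open>\<Delta> * r / 4\<close> is shared by the
  pair, which leaves \<open>\<Delta> * r / 8\<close> per cell.\<close>

lemma assouad:
  fixes \<mu> :: "nat set \<Rightarrow> real ^ 'd::finite \<Rightarrow> real" and A :: "nat \<Rightarrow> (real ^ 'd) set"
    and C d v r :: real
  assumes f: "regular_error f" and C: "C > 1"
    and \<mu>[measurable]: "\<And>\<omega>. \<mu> \<omega> \<in> borel_measurable borel"
    and A[measurable]: "\<And>j. A j \<in> sets borel" and A_sub: "\<And>j. j < M \<Longrightarrow> A j \<subseteq> cbox 0 1"
    and disj: "disjoint_family_on A {..<M}"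
    and vol: "\<And>j. j < M \<Longrightarrow> ennreal v \<le> emeasure lborel (A j)"
    and sep: "\<And>\<omega> j x. j < M \<Longrightarrow> x \<in> A j \<Longrightarrow> d \<le> \<bar>\<mu> \<omega> x - \<mu> (sym_diff \<omega> {j}) x\<bar>"
    and d: "0 < d" and v: "0 < v" and r: "0 < r"
    and aff: "\<And>\<omega> j. j < M \<Longrightarrow> affinity_bound (sample_law n f (\<mu> \<omega>) (\<lambda>_. 1) (indicator (cbox 0 1)))
        (sample_law n f (\<mu> (sym_diff \<omega> {j})) (\<lambda>_. 1) (indicator (cbox 0 1))) r"
    and m: "m \<in> estimators n"
    and R: "\<And>\<omega>. risk n f m (\<mu> \<omega>) (\<lambda>_. 1) (indicator (cbox 0 1)) \<le> R"
  shows "ennreal (real M * (d\<^sup>2 / 2 * v * r / 8)) \<le> R"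
proof -
  let ?h = "indicator (cbox 0 1) :: real ^ 'd \<Rightarrow> real"
  define P where "P \<omega> = sample_law n f (\<mu> \<omega>) (\<lambda>_. 1) ?h" for \<omega>
  note h = uniform_in_covariate_densities[OF C, where 'd = 'd]
  have P: "prob_space (P \<omega>)" for \<omega>
    unfolding P_def using f h by (intro prob_space_sample_law) auto
  have sets_P [measurable_cong]: "sets (P \<omega>) = sets (PiM {..<n} (\<lambda>_. borel))" for \<omega>
    unfolding P_def by (rule sets_sample_law)
  have m': "(\<lambda>(z, x). m z x) \<in> borel_measurable (PiM {..<n} (\<lambda>_. borel) \<Otimes>\<^sub>M borel)"
    using m by (simp add: estimators_def)
  have m1[measurable]: "(\<lambda>(z, x). m z x) \<in> borel_measurable (P \<omega> \<Otimes>\<^sub>M lborel)" for \<omega>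
    using m' by (subst measurable_cong_sets[OF sets_pair_measure_cong refl]) (auto simp: sets_P)
  define S where "S \<omega> j z = (\<integral>\<^sup>+x. ennreal ((\<mu> \<omega> x - m z x)\<^sup>2) * indicator (A j) x \<partial>lborel)" for \<omega> j z
  have S_meas: "S \<omega> j \<in> borel_measurable (P \<omega>')" for \<omega> \<omega>' j
    unfolding S_def by measurable
  have mz: "m z \<in> borel_measurable borel" if "z \<in> space (P \<omega>)" for z \<omega>
    using measurable_Pair2[OF m1 that] by simp
  define T where "T \<omega> j = (\<integral>\<^sup>+z. S \<omega> j z \<partial>P \<omega>)" for \<omega> j
  \<comment> \<open>The squared errors at two values \<open>d\<close> apart sum to at least
    \<open>d\<^sup>2 / 2\<close>; this is integrated over a cell of volume at least
    \<open>v\<close>.\<close>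
  define \<Delta> where "\<Delta> = d\<^sup>2 / 2 * v"
  have \<Delta>: "0 < \<Delta>" using d v by (simp add: \<Delta>_def)
  have sum_le: "(\<Sum>j<M. T \<omega> j) \<le> R" for \<omega>
  proof -
    have "(\<Sum>j<M. T \<omega> j) = (\<integral>\<^sup>+z. (\<Sum>j<M. S \<omega> j z) \<partial>P \<omega>)"
      unfolding T_def using S_meas by (subst nn_integral_sum) auto
    also have "\<dots> \<le> (\<integral>\<^sup>+z. sq_loss ?h (\<mu> \<omega>) (m z) \<partial>P \<omega>)"
    proof (intro nn_integral_mono)
      fix z assume z: "z \<in> space (P \<omega>)"
      note [measurable] = mz[OF z]
      have "(\<Sum>j<M. S \<omega> j z) = (\<integral>\<^sup>+x. (\<Sum>j<M. ennreal ((\<mu> \<omega> x - m z x)\<^sup>2) * indicator (A j) x) \<partial>lborel)"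
        unfolding S_def by (subst nn_integral_sum) auto
      also have "\<dots> \<le> (\<integral>\<^sup>+x. ennreal ((\<mu> \<omega> x - m z x)\<^sup>2 * ?h x) \<partial>lborel)"
      proof (intro nn_integral_mono)
        fix x :: "real ^ 'd"
        have "(\<Sum>j<M. indicator (A j) x :: ennreal) = indicator (\<Union>j<M. A j) x"
          using disj by (intro indicator_UN_disjoint[symmetric]) auto
        also have "\<dots> \<le> indicator (cbox 0 1) x"
          using A_sub by (intro indicator_leI) auto
        finally have "ennreal ((\<mu> \<omega> x - m z x)\<^sup>2) * (\<Sum>j<M. indicator (A j) x)
            \<le> ennreal ((\<mu> \<omega> x - m z x)\<^sup>2) * indicator (cbox 0 1) x"
          by (rule mult_left_mono) simp
        then show "(\<Sum>j<M. ennreal ((\<mu> \<omega> x - m z x)\<^sup>2) * indicator (A j) x) \<le> ennreal ((\<mu> \<omega> x - m z x)\<^sup>2 * ?h x)"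
          by (simp add: sum_distrib_left[symmetric] split: split_indicator_asm split_indicator)
      qed
      finally show "(\<Sum>j<M. S \<omega> j z) \<le> sq_loss ?h (\<mu> \<omega>) (m z)" by (simp add: sq_loss_def)
    qed
    also have "\<dots> \<le> R" using R[of \<omega>] by (simp add: risk_def P_def)
    finally show ?thesis .
  qed
  have pair: "ennreal (\<Delta> * r / 4) \<le> T \<omega> j + T (sym_diff \<omega> {j}) j" if j: "j < M" for \<omega> j
    unfolding T_def
  proof (rule affinity_bound_two_point[OF P P _ _ r \<Delta> S_meas S_meas])
    let ?\<omega>' = "sym_diff \<omega> {j}"
    show "sets (P \<omega>) = sets (P ?\<omega>')" by (simp add: sets_P)
    show "affinity_bound (P \<omega>) (P ?\<omega>') r" unfolding P_def by (rule aff[OF j])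
    fix z assume z: "z \<in> space (P \<omega>)"
    note [measurable] = mz[OF z]
    have "ennreal \<Delta> = ennreal (d\<^sup>2 / 2) * ennreal v" using d v unfolding \<Delta>_def by (intro ennreal_mult) auto
    also have "\<dots> \<le> ennreal (d\<^sup>2 / 2) * emeasure lborel (A j)" by (intro mult_left_mono vol j) auto
    also have "\<dots> = (\<integral>\<^sup>+x. ennreal (d\<^sup>2 / 2) * indicator (A j) x \<partial>lborel)" by (simp add: nn_integral_cmult)
    also have "\<dots> \<le> (\<integral>\<^sup>+x. ennreal ((\<mu> \<omega> x - m z x)\<^sup>2) * indicator (A j) x
        + ennreal ((\<mu> ?\<omega>' x - m z x)\<^sup>2) * indicator (A j) x \<partial>lborel)"
    proof (intro nn_integral_mono)
      fix x :: "real ^ 'd"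
      show "ennreal (d\<^sup>2 / 2) * indicator (A j) x \<le> ennreal ((\<mu> \<omega> x - m z x)\<^sup>2) * indicator (A j) x
          + ennreal ((\<mu> ?\<omega>' x - m z x)\<^sup>2) * indicator (A j) x"
      proof (cases "x \<in> A j")
        case True
        let ?a = "\<mu> \<omega> x - m z x" and ?b = "\<mu> ?\<omega>' x - m z x"
        have "d\<^sup>2 \<le> \<bar>?a - ?b\<bar>\<^sup>2" using sep[OF j True, of \<omega>] d by (intro power_mono) auto
        also have "\<dots> \<le> 2 * (?a\<^sup>2 + ?b\<^sup>2)"
          using zero_le_power2[of "?a + ?b"] by (simp add: power2_eq_square algebra_simps)
        finally have "ennreal (d\<^sup>2 / 2) \<le> ennreal (?a\<^sup>2 + ?b\<^sup>2)" by (intro ennreal_leI) simp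
        then show ?thesis using True by simp
      qed simp
    qed
    also have "\<dots> = S \<omega> j z + S ?\<omega>' j z"
      unfolding S_def by (subst nn_integral_add) auto
    finally show "ennreal \<Delta> \<le> S \<omega> j z + S ?\<omega>' j z" .
  qed
  \<comment> \<open>Flipping one sign is an involution of the set of patterns.\<close>
  have flip: "(\<Sum>\<omega>\<in>Pow {..<M}. T (sym_diff \<omega> {j}) j) = (\<Sum>\<omega>\<in>Pow {..<M}. T \<omega> j)" if j: "j < M" for j
    by (rule sum.reindex_bij_witness[where i = "\<lambda>\<omega>. sym_diff \<omega> {j}" and j = "\<lambda>\<omega>. sym_diff \<omega> {j}"])
       (use j in auto)
  have half: "2 ^ M * ennreal (\<Delta> * r / 4) \<le> 2 * (\<Sum>\<omega>\<in>Pow {..<M}. T \<omega> j)" if j: "j < M" for j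
  proof -
    have "2 ^ M * ennreal (\<Delta> * r / 4) = (\<Sum>\<omega>\<in>Pow {..<M}. ennreal (\<Delta> * r / 4))"
      by (simp add: card_Pow)
    also have "\<dots> \<le> (\<Sum>\<omega>\<in>Pow {..<M}. T \<omega> j + T (sym_diff \<omega> {j}) j)"
      by (intro sum_mono pair j)
    also have "\<dots> = 2 * (\<Sum>\<omega>\<in>Pow {..<M}. T \<omega> j)"
      unfolding sum.distrib flip[OF j] by (simp add: mult_2)
    finally show ?thesis .
  qed
  have "of_nat M * (2 ^ M * ennreal (\<Delta> * r / 4)) = (\<Sum>j<M. 2 ^ M * ennreal (\<Delta> * r / 4))" by simp
  also have "\<dots> \<le> (\<Sum>j<M. 2 * (\<Sum>\<omega>\<in>Pow {..<M}. T \<omega> j))" by (intro sum_mono half) auto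
  also have "\<dots> = 2 * (\<Sum>\<omega>\<in>Pow {..<M}. \<Sum>j<M. T \<omega> j)"
    by (subst sum.swap) (simp add: sum_distrib_left)
  also have "\<dots> \<le> 2 * (\<Sum>\<omega>\<in>Pow {..<M}. R)" by (intro mult_left_mono sum_mono sum_le) auto
  also have "\<dots> = 2 ^ M * (2 * R)" by (simp add: card_Pow mult_ac)
  finally have "2 ^ M * (of_nat M * ennreal (\<Delta> * r / 4)) \<le> 2 ^ M * (2 * R)" by (simp add: mult_ac)
  then have *: "of_nat M * ennreal (\<Delta> * r / 4) \<le> 2 * R"
    by (subst (asm) ennreal_mult_le_mult_iff) (auto simp: power_eq_top_ennreal)
  have "of_nat M * ennreal (\<Delta> * r / 4) = 2 * ennreal (real M * (\<Delta> * r / 8))"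
  proof -
    have "of_nat M * ennreal (\<Delta> * r / 4) = ennreal (real M) * ennreal (\<Delta> * r / 4)"
      by (simp add: ennreal_of_nat_eq_real_of_nat)
    also have "\<dots> = ennreal (2 * (real M * (\<Delta> * r / 8)))"
      using \<Delta> r by (simp add: ennreal_mult'[symmetric])
    also have "\<dots> = ennreal 2 * ennreal (real M * (\<Delta> * r / 8))" by (rule ennreal_mult') simp
    finally show ?thesis by simp
  qed
  with * have "2 * ennreal (real M * (\<Delta> * r / 8)) \<le> 2 * R" by simp
  then have "ennreal (real M * (\<Delta> * r / 8)) \<le> R"
    by (subst (asm) ennreal_mult_le_mult_iff) auto
  then show ?thesis by (simp add: \<Delta>_def)
qed

lemma abs_sin_pi_ge_half:
  assumes "of_int j + 1 / 4 \<le> u" "u \<le> of_int j + 3 / 4"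
  shows "1 / 2 \<le> \<bar>sin (pi * u)\<bar>"
proof -
  define v where "v = u - of_int j"
  have v: "1 / 4 \<le> v" "v \<le> 3 / 4" using assms by (auto simp: v_def)
  have s0: "sin (pi * of_int j) = 0" by (subst sin_zero_iff_int2) (auto intro!: exI[of _ j])
  have c1: "\<bar>cos (pi * of_int j)\<bar> = 1"
    using sin_cos_squared_add[of "pi * of_int j"] s0 by (simp add: abs_square_eq_1)
  have "pi * u = pi * v + pi * of_int j" by (simp add: v_def algebra_simps)
  then have "\<bar>sin (pi * u)\<bar> = \<bar>sin (pi * v)\<bar>"
    by (simp add: sin_add s0 abs_mult c1)
  moreover have "sin (pi * v) = cos \<bar>pi / 2 - pi * v\<bar>" by (simp add: cos_diff)
  moreover have "cos (pi / 3) \<le> cos \<bar>pi / 2 - pi * v\<bar>"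
  proof (rule cos_monotone_0_pi_le)
    have "pi / 2 - pi * v = pi * (1 / 2 - v)" by (simp add: algebra_simps)
    then have "\<bar>pi / 2 - pi * v\<bar> = pi * \<bar>1 / 2 - v\<bar>" by (simp add: abs_mult)
    \<comment> \<open>The distance is even at most 1/4; 1/3 is taken because
      \<open>cos (pi / 3) = 1 / 2\<close>.\<close>
    also have "\<bar>1 / 2 - v\<bar> \<le> 1 / 3" using v by linarith
    then have "pi * \<bar>1 / 2 - v\<bar> \<le> pi * (1 / 3)" by (intro mult_left_mono) auto
    finally show "\<bar>pi / 2 - pi * v\<bar> \<le> pi / 3" by simp
  qed auto
  ultimately show ?thesis by (simp add: cos_60)
qed

lemma minimax_lower_bound:
  fixes B :: "nat \<Rightarrow> real"
  assumes f: "regular_error f" and p: "p \<ge> 1" and dim: "CARD('d::finite) \<ge> 2 \<or> p \<le> 2"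
    and \<gamma>: "0 < \<gamma>" "\<gamma> \<le> 1" and L: "L > 0" and B: "\<And>k. k \<le> s \<Longrightarrow> B k > 0"
    and C: "C > 1" and C': "C' > 0" and \<alpha>: "\<alpha> = real s + \<gamma>"
  shows "\<exists>c>0. \<forall>n\<ge>1. ennreal (c * real n powr (- (2 * \<alpha> / (2 * \<alpha> + 1))))
     \<le> minimax_risk n f (multi_index_class p s \<gamma> L B :: (real ^ 'd \<Rightarrow> real) set) (scale_functions C') (covariate_densities C)"
proof -
  obtain J where J: "0 \<le> J" and
    shift: "\<And>v lo hi \<delta> t. \<lbrakk>v \<in> borel_measurable borel; 0 < lo; \<And>e. lo \<le> v e; \<And>e. v e \<le> hi; \<bar>\<delta>\<bar> \<le> 1; 0 < t\<rbrakk>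
      \<Longrightarrow> t * (2 - J * \<delta>\<^sup>2) \<le> t\<^sup>2 * (\<integral>e. v e \<partial>lborel_density f)
            + (\<integral>e. 1 / v (e - \<delta>) \<partial>lborel_density f)"
    using regular_error_shift[OF f] by blast
  obtain a0 where a0: "0 < a0" and
    bump: "\<And>w M a. \<lbrakk>\<And>i. \<bar>w i\<bar> \<le> (1::real); 1 \<le> M; 0 < a; a \<le> a0\<rbrakk> \<Longrightarrow>
       (\<lambda>z. a * M powr (- (real s + \<gamma>)) * (w \<lfloor>M * z\<rfloor> * sin (pi * (M * z)) ^ (s + 2))) \<in> hoelder_class s \<gamma> L B"
    using bump_in_hoelder_class[where s = s and B = B, OF \<gamma> L B] by blast
  define k :: 'd where "k = undefined"
  obtain b :: "nat \<Rightarrow> real ^ 'd" where b: "b 0 = axis k 1" "\<And>i. i < p \<Longrightarrow> norm (b i) = 1" "inj_on b {..<p}"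
    using unit_vectors_exist[OF dim] by blast
  define \<epsilon> where "\<epsilon> = min (Min (B ` {..s})) (L / 2)"
  have "0 < Min (B ` {..s})" using B by (subst Min_gr_iff) auto
  then have \<epsilon>: "0 < \<epsilon>" "2 * \<epsilon> \<le> L" using L by (auto simp: \<epsilon>_def)
  have \<epsilon>B: "\<epsilon> \<le> B i" if "i \<le> s" for i
  proof -
    have "Min (B ` {..s}) \<le> B i" using that by (intro Min_le) auto
    then show ?thesis by (simp add: \<epsilon>_def min_le_iff_disj)
  qed
  \<comment> \<open>\<open>a0\<close> keeps the bumps in the Hoelder class, 1/2 keeps a flip below 1
    as the shift bound demands, and the last term limits the loss of affinity over all
    \<open>n\<close> observations through \<open>Ja\<close>.\<close>
  define a where "a = min a0 (min (1 / 2) (1 / (8 * (J + 1))))"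
  have a: "0 < a" "a \<le> a0" "a \<le> 1 / 2" "a \<le> 1 / (8 * (J + 1))" 
    using a0 J unfolding a_def by (simp_all only: min_less_iff_conj min.bounded_iff) (auto simp: min_le_iff_disj)
  have "a\<^sup>2 \<le> a * 1" unfolding power2_eq_square using a by (intro mult_left_mono) auto
  then have "a\<^sup>2 * (8 * (J + 1)) \<le> a * (8 * (J + 1))" using J by (intro mult_right_mono) auto
  also have "\<dots> \<le> 1" using a(4) J by (simp add: field_simps)
  finally have "a\<^sup>2 * (8 * (J + 1)) \<le> 1" .
  then have "8 * a\<^sup>2 + 2 * (J * (4 * a\<^sup>2)) \<le> 1" by (simp add: algebra_simps)
  then have Ja: "J * (4 * a\<^sup>2) \<le> 1 / 2" using zero_le_power2[of a] by linarith
  have \<alpha>0: "\<alpha> > 0" using \<alpha> \<gamma> by simp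
  \<comment> \<open>The factor \<open>2 powr (- 2 * \<alpha>)\<close> pays for rounding
    \<open>t\<close> up to an integer at most twice as large; the final division by 4 is
    slack.\<close>
  define c0 where "c0 = (a * (1 / 2) ^ (s + 2))\<^sup>2 / 16 * 2 powr (- 2 * \<alpha>) / 4"
  have c0: "c0 > 0" using a by (simp add: c0_def)
  have main: "ennreal (c0 * real n powr (- (2 * \<alpha> / (2 * \<alpha> + 1))))
     \<le> minimax_risk n f (multi_index_class p s \<gamma> L B :: (real ^ 'd \<Rightarrow> real) set) (scale_functions C') (covariate_densities C)"
    if n: "n \<ge> 1" for n
  proof -
    define t where "t = real n powr (1 / (2 * \<alpha> + 1))"
    have t1: "1 \<le> t" using n \<alpha>0 by (simp add: t_def ge_one_powr_ge_zero)
    define m where "m = nat \<lceil>t\<rceil>"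
    define M where "M = real m"
    have tM: "t \<le> M" "M \<le> 2 * t" using t1 unfolding M_def m_def by linarith+
    have M1: "1 \<le> M" using t1 tM by simp
    have tn: "t powr (2 * \<alpha> + 1) = real n" using n \<alpha>0 by (simp add: t_def powr_powr)
    have "real n \<le> M powr (2 * \<alpha> + 1)" unfolding tn[symmetric] using t1 tM \<alpha>0 by (intro powr_mono2) auto
    \<comment> \<open>This is the calibration of \<open>M\<close>: up to constants, \<open>n\<close>
      times the squared distance caused by one flip stays bounded.\<close>
    then have nM: "real n * M powr (- (2 * \<alpha> + 1)) \<le> 1"
      using M1 by (subst powr_minus) (simp add: divide_simps)
    define c where "c = a * M powr (- (real s + \<gamma>))"
    have c: "c > 0" using a M1 by (simp add: c_def)
    have cM: "M powr (- (real s + \<gamma>)) \<le> 1" using M1 \<gamma> powr_mono[of "- (real s + \<gamma>)" 0 M] by simp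
    have ca: "c \<le> 1 / 2" using mult_mono[OF a(3) cM] a by (simp add: c_def)
    have c2: "c\<^sup>2 = a\<^sup>2 * M powr (- 2 * \<alpha>)"
      using M1 by (simp add: c_def power_mult_distrib powr_powr \<alpha> powr_power)
    have c2M: "c\<^sup>2 / M = a\<^sup>2 * M powr (- (2 * \<alpha> + 1))"
      using M1 unfolding c2 by (simp add: powr_diff)
    define w where "w \<omega> i = (if i \<in> int ` \<omega> then 1 else - 1 :: real)" for \<omega> :: "nat set" and i
    have w: "\<bar>w \<omega> i\<bar> = 1" for \<omega> i by (simp add: w_def)
    define lam where "lam \<omega> z = c * (w \<omega> \<lfloor>M * z\<rfloor> * sin (pi * (M * z)) ^ (s + 2))" for \<omega> z
    have lamH: "lam \<omega> \<in> hoelder_class s \<gamma> L B" for \<omega>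
      unfolding lam_def c_def using w M1 a by (intro bump) auto
    define g where "g \<omega> i = (if i = 0 then lam \<omega> else (\<lambda>z. \<epsilon> * sin z))" for \<omega> and i :: nat
    define \<mu> where "\<mu> \<omega> x = (\<Sum>i<p. g \<omega> i (b i \<bullet> x))" for \<omega> x
    have \<mu>Q: "\<mu> \<omega> \<in> multi_index_class p s \<gamma> L B" for \<omega>
    proof -
      have "\<not> lam \<omega> constant_on UNIV"
      proof
        assume "lam \<omega> constant_on UNIV"
        then obtain y where y: "\<And>z. lam \<omega> z = y" by (auto simp: constant_on_def)
        have "lam \<omega> 0 = 0" by (simp add: lam_def)
        \<comment> \<open>The midpoint of the first cell, where the sine is 1.\<close>
        moreover have "\<bar>lam \<omega> (1 / (2 * M))\<bar> = c" using c M1 w by (simp add: lam_def abs_mult)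
        ultimately show False using y c by simp
      qed
      moreover have "\<not> (\<lambda>z. \<epsilon> * sin z) constant_on UNIV"
      proof
        assume "(\<lambda>z. \<epsilon> * sin z) constant_on UNIV"
        then obtain y where y: "\<And>z. \<epsilon> * sin z = y" by (auto simp: constant_on_def)
        from y[of 0] y[of "pi / 2"] show False using \<epsilon> by simp
      qed
      moreover have "(\<lambda>z. \<epsilon> * sin z) \<in> hoelder_class s \<gamma> L B"
        using \<epsilon> \<epsilon>B \<gamma> by (intro scaled_sin_in_hoelder_class) auto
      ultimately show ?thesis
        using lamH b unfolding multi_index_class_def \<mu>_def[abs_def]
        by (auto intro!: exI[of _ "g \<omega>"] exI[of _ b] simp: g_def split: if_splits)
    qed
    have \<mu>m[measurable]: "\<mu> \<omega> \<in> borel_measurable borel" for \<omega>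
      using multi_index_class_continuous[OF \<mu>Q \<gamma>(1)] by (rule borel_measurable_continuous_onI)
    have diff: "\<mu> \<omega> x - \<mu> \<omega>' x = lam \<omega> (x $ k) - lam \<omega>' (x $ k)" for \<omega> \<omega>' x
    proof -
      have "\<mu> \<omega> x - \<mu> \<omega>' x = (\<Sum>i<p. if i = 0 then lam \<omega> (b i \<bullet> x) - lam \<omega>' (b i \<bullet> x) else 0)"
        unfolding \<mu>_def sum_subtractf[symmetric] by (intro sum.cong) (auto simp: g_def)
      also have "\<dots> = lam \<omega> (b 0 \<bullet> x) - lam \<omega>' (b 0 \<bullet> x)" using p by (subst sum.delta) auto
      finally show ?thesis by (simp add: b inner_axis')
    qed
    have w_flip: "\<bar>w \<omega> i - w (sym_diff \<omega> {j}) i\<bar> = (if i = int j then 2 else 0)" for \<omega> i j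
      by (auto simp: w_def)
    have adiff: "\<bar>\<mu> \<omega> x - \<mu> (sym_diff \<omega> {j}) x\<bar>
        = c * (if \<lfloor>M * x $ k\<rfloor> = int j then 2 else 0) * \<bar>sin (pi * (M * x $ k))\<bar> ^ (s + 2)" for \<omega> x j
    proof -
      have "\<mu> \<omega> x - \<mu> (sym_diff \<omega> {j}) x
         = c * (w \<omega> \<lfloor>M * x $ k\<rfloor> - w (sym_diff \<omega> {j}) \<lfloor>M * x $ k\<rfloor>) * sin (pi * (M * x $ k)) ^ (s + 2)"
        unfolding diff lam_def by (simp only: right_diff_distrib left_diff_distrib mult.assoc)
      then show ?thesis using c by (simp only: abs_mult w_flip power_abs abs_of_pos)
    qed
    have adiff_le: "\<bar>\<mu> \<omega> x - \<mu> (sym_diff \<omega> {j}) x\<bar> \<le> 2 * c" for \<omega> x j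
    proof -
      have "\<bar>sin (pi * (M * x $ k))\<bar> ^ (s + 2) \<le> 1" by (intro power_le_one) auto
      then show ?thesis unfolding adiff using c by simp
    qed
    \<comment> \<open>The middle half of the \<open>j\<close>-th cell, where the sine is at least
      1/2 in absolute value; the full cell would include its zeros.\<close>
    define A where "A j = {x \<in> cbox 0 (1 :: real ^ 'd). (real j + 1 / 4) / M \<le> x $ k \<and> x $ k \<le> (real j + 3 / 4) / M}" for j
    have A_range: "0 \<le> (real j + 1 / 4) / M" "(real j + 1 / 4) / M \<le> (real j + 3 / 4) / M" "(real j + 3 / 4) / M \<le> 1"
      if "j < m" for j
      using that M1 by (auto simp: M_def divide_le_eq intro!: divide_right_mono)
    have A_sets: "A j \<in> sets borel" for j
    proof -
      have "closed (A j)" unfolding A_def Collect_conj_eq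
        by (auto intro!: closed_Collect_conj closed_Collect_le continuous_intros closed_cbox simp: conj_assoc[symmetric] Collect_conj_eq[symmetric])
      then show ?thesis by simp
    qed
    have A_vol: "emeasure lborel (A j) = ennreal (1 / (2 * M))" if "j < m" for j
      unfolding A_def using emeasure_slab(2)[OF A_range[OF that], of k] by (simp add: diff_divide_distrib[symmetric])
    have A_floor: "of_int (int j) + 1 / 4 \<le> M * x $ k" "M * x $ k \<le> of_int (int j) + 3 / 4" "\<lfloor>M * x $ k\<rfloor> = int j"
      if "x \<in> A j" for x j
    proof -
      show 1: "of_int (int j) + 1 / 4 \<le> M * x $ k" "M * x $ k \<le> of_int (int j) + 3 / 4"
        using that M1 by (auto simp: A_def field_simps)
      show "\<lfloor>M * x $ k\<rfloor> = int j" using 1 by (intro floor_unique) auto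
    qed
    have "disjoint_family_on A {..<m}"
      unfolding disjoint_family_on_def using A_floor(3) by (metis disjoint_iff of_nat_eq_iff)
    moreover have "2 * c * (1 / 2) ^ (s + 2) \<le> \<bar>\<mu> \<omega> x - \<mu> (sym_diff \<omega> {j}) x\<bar>" if "x \<in> A j" for \<omega> x j
    proof -
      have "(1 / 2) ^ (s + 2) \<le> \<bar>sin (pi * (M * x $ k))\<bar> ^ (s + 2)"
        using abs_sin_pi_ge_half[OF A_floor(1,2)[OF that]] by (intro power_mono) auto
      then show ?thesis unfolding adiff using A_floor(3)[OF that] c by simp
    qed
    moreover have "affinity_bound (sample_law n f (\<mu> \<omega>) (\<lambda>_. 1) (indicator (cbox 0 1)))
        (sample_law n f (\<mu> (sym_diff \<omega> {j})) (\<lambda>_. 1) (indicator (cbox 0 1))) (1 / 2)" if j: "j < m" for \<omega> j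
    proof -
      let ?\<omega>' = "sym_diff \<omega> {j}" and ?h = "indicator (cbox 0 1) :: real ^ 'd \<Rightarrow> real"
      \<comment> \<open>The whole cell, of volume \<open>1 / M\<close>: it supports the difference
        of the two regression functions, which is at most \<open>2 * c\<close>.\<close>
      let ?S = "{x \<in> cbox 0 (1 :: real ^ 'd). real j / M \<le> x $ k \<and> x $ k \<le> (real j + 1) / M}"
      note h = uniform_in_covariate_densities[OF C, where 'd = 'd]
      have rng: "0 \<le> real j / M" "real j / M \<le> (real j + 1) / M" "(real j + 1) / M \<le> 1"
        using j M1 by (auto simp: M_def divide_le_eq intro!: divide_right_mono)
      note slab = emeasure_slab[OF rng, of k]
      have "(\<integral>x. (\<mu> \<omega> x - \<mu> ?\<omega>' x)\<^sup>2 \<partial>lborel_density ?h)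
         = (\<integral>x. ?h x * (\<mu> \<omega> x - \<mu> ?\<omega>' x)\<^sup>2 \<partial>lborel)"
        by (subst integral_density) auto
      also have "\<dots> \<le> (\<integral>x. 4 * c\<^sup>2 * indicator ?S x \<partial>lborel)"
      proof (rule integral_mono')
        show "integrable lborel (\<lambda>x. 4 * c\<^sup>2 * indicator ?S x :: real)"
          using slab by (intro integrable_mult_right integrable_real_indicator) auto
        show "0 \<le> 4 * c\<^sup>2 * indicator ?S x" for x by simp
        fix x :: "real ^ 'd"
        show "?h x * (\<mu> \<omega> x - \<mu> ?\<omega>' x)\<^sup>2 \<le> 4 * c\<^sup>2 * indicator ?S x"
        proof (cases "x \<in> cbox 0 1 \<and> \<lfloor>M * x $ k\<rfloor> = int j")
          case True
          then have "real j \<le> M * x $ k" "M * x $ k \<le> real j + 1"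
            using floor_correct[of "M * x $ k"] by auto
          then have "x \<in> ?S" using True M1 by (auto simp: field_simps)
          moreover have "(\<mu> \<omega> x - \<mu> ?\<omega>' x)\<^sup>2 \<le> (2 * c)\<^sup>2"
            using power_mono[OF adiff_le[of \<omega> x j], of 2] by simp
          ultimately show ?thesis by (simp add: power_mult_distrib split: split_indicator)
        next
          case False
          then have 0: "?h x * (\<mu> \<omega> x - \<mu> ?\<omega>' x)\<^sup>2 = 0"
            using adiff[of \<omega> x j] by (auto split: split_indicator)
          show ?thesis unfolding 0 by simp
        qed
      qed
      also have "\<dots> = 4 * (c\<^sup>2 / M)"
        using slab M1 by (simp add: measure_def diff_divide_distrib[symmetric])
      finally have D: "(\<integral>x. (\<mu> \<omega> x - \<mu> ?\<omega>' x)\<^sup>2 \<partial>lborel_density ?h) \<le> 4 * (c\<^sup>2 / M)" .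
      have JD: "real n * (J * (4 * (c\<^sup>2 / M))) \<le> 1 / 2"
      proof -
        have "real n * (J * (4 * (c\<^sup>2 / M))) = (J * (4 * a\<^sup>2)) * (real n * M powr (- (2 * \<alpha> + 1)))"
          unfolding c2M by simp
        also have "\<dots> \<le> (J * (4 * a\<^sup>2)) * 1" using nM J by (intro mult_left_mono) auto
        finally show ?thesis using Ja by simp
      qed
      have "1 * (J * (4 * (c\<^sup>2 / M))) \<le> real n * (J * (4 * (c\<^sup>2 / M)))"
        using n J M1 by (intro mult_right_mono) auto
      then have JD1: "J * (4 * (c\<^sup>2 / M)) \<le> 1 / 2" using JD by simp
      have "affinity_bound (observation_law f (\<mu> \<omega>) (\<lambda>_. 1) ?h) (observation_law f (\<mu> ?\<omega>') (\<lambda>_. 1) ?h)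
          ((1 - J * (4 * (c\<^sup>2 / M)) / 2)\<^sup>2)"
      proof (rule affinity_bound_observation_law[OF f h J shift])
        show "\<bar>\<mu> \<omega> x - \<mu> ?\<omega>' x\<bar> \<le> 1" for x using adiff_le[of \<omega> x j] ca by linarith
      qed (use D JD1 in auto)
      then have "affinity_bound (sample_law n f (\<mu> \<omega>) (\<lambda>_. 1) ?h) (sample_law n f (\<mu> ?\<omega>') (\<lambda>_. 1) ?h)
          (((1 - J * (4 * (c\<^sup>2 / M)) / 2)\<^sup>2) ^ card {..<n})"
        unfolding sample_law_def using f h
        by (intro affinity_bound_PiM prob_space_observation_law) auto
      moreover have "1 / 2 \<le> ((1 - J * (4 * (c\<^sup>2 / M)) / 2)\<^sup>2) ^ card {..<n}"
      proof -
        let ?y = "J * (4 * (c\<^sup>2 / M)) / 2"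
        \<comment> \<open>The affinity of one observation is a square, so \<open>n\<close> of them
          give the power \<open>2 * n\<close> of \<open>1 - ?y\<close>; Bernoulli's inequality keeps
          it above 1/2.\<close>
        have "1 / 2 \<le> 1 + real (2 * n) * (- ?y)" using JD by simp
        also have "\<dots> \<le> (1 + (- ?y)) ^ (2 * n)" using JD1 by (intro Bernoulli_inequality) simp
        finally show ?thesis by (simp add: power_mult)
      qed
      ultimately show ?thesis by (rule affinity_bound_mono)
    qed
    moreover have "ennreal (1 / (2 * M)) \<le> emeasure lborel (A j)" if "j < m" for j using A_vol[OF that] by simp
    moreover have "A j \<subseteq> cbox 0 1" for j by (auto simp: A_def)
    ultimately have bound: "ennreal (real m * ((2 * c * (1 / 2) ^ (s + 2))\<^sup>2 / 2 * (1 / (2 * M)) * (1 / 2) / 8)) \<le> R"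
      if "e \<in> estimators n" "\<And>\<omega>. risk n f e (\<mu> \<omega>) (\<lambda>_. 1) (indicator (cbox 0 1)) \<le> R" for e R
      using that c M1 A_sets
      by (intro assouad[OF f C, of \<mu> A m "1 / (2 * M)" "2 * c * (1 / 2) ^ (s + 2)" "1 / 2" n e R]) auto
    have "c0 * real n powr (- (2 * \<alpha> / (2 * \<alpha> + 1)))
       \<le> real m * ((2 * c * (1 / 2) ^ (s + 2))\<^sup>2 / 2 * (1 / (2 * M)) * (1 / 2) / 8)"
    proof -
      have "real n powr (- (2 * \<alpha> / (2 * \<alpha> + 1))) = t powr (- 2 * \<alpha>)"
        by (simp add: t_def powr_powr)
      also have "2 powr (- 2 * \<alpha>) * t powr (- 2 * \<alpha>) = (2 * t) powr (- 2 * \<alpha>)"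
        using t1 by (simp add: powr_mult)
      also have "\<dots> \<le> M powr (- 2 * \<alpha>)" using tM M1 \<alpha>0 by (intro powr_mono2') auto
      finally have le: "2 powr (- 2 * \<alpha>) * real n powr (- (2 * \<alpha> / (2 * \<alpha> + 1))) \<le> M powr (- 2 * \<alpha>)"
        by (simp add: t_def powr_powr)
      let ?q = "(1 / 2 :: real) ^ (s + 2)"
      have "c0 * real n powr (- (2 * \<alpha> / (2 * \<alpha> + 1)))
         = (a * ?q)\<^sup>2 / 64 * (2 powr (- 2 * \<alpha>) * real n powr (- (2 * \<alpha> / (2 * \<alpha> + 1))))"
        by (simp add: c0_def)
      also have "\<dots> \<le> (a * ?q)\<^sup>2 / 64 * M powr (- 2 * \<alpha>)"
        by (intro mult_left_mono le) auto
      also have "\<dots> = c\<^sup>2 * ?q\<^sup>2 / 64" by (simp only: c2 power_mult_distrib) simp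
      also have "\<dots> \<le> c\<^sup>2 * ?q\<^sup>2 / 16" by simp
      also have "\<dots> = real m * ((2 * c * ?q)\<^sup>2 / 2 * (1 / (2 * M)) * (1 / 2) / 8)"
      proof -
        have "c\<^sup>2 * q\<^sup>2 / 16 = M * ((2 * c * q)\<^sup>2 / 2 * (1 / (2 * M)) * (1 / 2) / 8)" for q
          using M1 by (simp add: power_mult_distrib)
        then show ?thesis by (simp only: M_def)
      qed
      finally show ?thesis .
    qed
    then have "ennreal (c0 * real n powr (- (2 * \<alpha> / (2 * \<alpha> + 1))))
       \<le> ennreal (real m * ((2 * c * (1 / 2) ^ (s + 2))\<^sup>2 / 2 * (1 / (2 * M)) * (1 / 2) / 8))"
      by (rule ennreal_leI)
    also have "\<dots> \<le> minimax_risk n f (multi_index_class p s \<gamma> L B :: (real ^ 'd \<Rightarrow> real) set) (scale_functions C') (covariate_densities C)"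
      unfolding minimax_risk_def
    proof (rule INF_greatest, rule bound)
      fix e :: "(nat \<Rightarrow> (real ^ 'd) \<times> real) \<Rightarrow> real ^ 'd \<Rightarrow> real" and \<omega>
      assume "e \<in> estimators n"
      show "risk n f e (\<mu> \<omega>) (\<lambda>_. 1) (indicator (cbox 0 1))
         \<le> (SUP \<mu>\<in>multi_index_class p s \<gamma> L B. SUP \<sigma>\<in>scale_functions C'. SUP h\<in>covariate_densities C. risk n f e \<mu> \<sigma> h)"
        using \<mu>Q unit_scale_in_scale_functions[OF C'] uniform_in_covariate_densities[OF C]
        by (intro SUP_upper2[of "\<mu> \<omega>"] SUP_upper2[of "\<lambda>_. 1"] SUP_upper2[of "indicator (cbox 0 1)"]) auto
    qed auto
    finally show ?thesis .
  qed
  show ?thesis using c0 main by blast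
qed

section \<open>Aggregation by exponential weights\<close>

text \<open>As a function of \<open>u\<close>, \<open>exp (- (w - u)\<^sup>2 / 2)\<close> has a
  second derivative with the sign of \<open>(w - u)\<^sup>2 - 1\<close>, hence is concave while
  \<open>\<bar>w - u\<bar> \<le> 1\<close>; the rest is Jensen's inequality.\<close>

lemma exp_square_concave:
  fixes w :: real
  assumes w: "0 \<le> w" "w \<le> 1" and fin: "finite J" and a: "\<And>j. j \<in> J \<Longrightarrow> 0 \<le> a j" and pos: "0 < (\<Sum>j\<in>J. a j)"
    and q: "\<And>j. j \<in> J \<Longrightarrow> 0 \<le> q j \<and> q j \<le> 1"
  shows "(\<Sum>j\<in>J. a j * exp (- (w - q j)\<^sup>2 / 2))
    \<le> (\<Sum>j\<in>J. a j) * exp (- (w - (\<Sum>j\<in>J. a j * q j) / (\<Sum>j\<in>J. a j))\<^sup>2 / 2)"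
proof -
  let ?\<phi> = "\<lambda>u. - exp (- (w - u)\<^sup>2 / 2)" and ?S = "\<Sum>j\<in>J. a j"
  have conv: "convex_on {0..1} ?\<phi>"
  proof (rule f''_ge0_imp_convex)
    have d: "((\<lambda>u. exp (- (w - u)\<^sup>2 / 2)) has_real_derivative (w - u) * exp (- (w - u)\<^sup>2 / 2)) (at u)" for u
    proof -
      have "((\<lambda>u. - (w - u)\<^sup>2 / 2) has_real_derivative w - u) (at u)"
        by (auto intro!: derivative_eq_intros simp: field_simps)
      from DERIV_fun_exp[OF this] show ?thesis by (simp add: mult.commute)
    qed
    show "(?\<phi> has_real_derivative - ((w - u) * exp (- (w - u)\<^sup>2 / 2))) (at u)" for u
      by (rule DERIV_minus[OF d])
    have "((\<lambda>u. w - u) has_real_derivative - 1) (at u)" for u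
      by (auto intro!: derivative_eq_intros)
    from DERIV_minus[OF DERIV_mult[OF this d]]
    show "((\<lambda>u. - ((w - u) * exp (- (w - u)\<^sup>2 / 2))) has_real_derivative
        (1 - (w - u)\<^sup>2) * exp (- (w - u)\<^sup>2 / 2)) (at u)" for u
      by (rule DERIV_cong) (simp add: power2_eq_square algebra_simps)
    show "0 \<le> (1 - (w - u)\<^sup>2) * exp (- (w - u)\<^sup>2 / 2)" if "u \<in> {0..1}" for u
      using that w by (auto simp: abs_square_le_1)
  qed auto
  have "?\<phi> (\<Sum>j\<in>J. (a j / ?S) *\<^sub>R q j) \<le> (\<Sum>j\<in>J. (a j / ?S) * ?\<phi> (q j))"
  proof (rule convex_on_sum[OF fin _ conv])
    show "J \<noteq> {}" using pos by auto
    show "(\<Sum>j\<in>J. a j / ?S) = 1" using pos by (simp add: sum_divide_distrib[symmetric])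
  qed (use a q pos in auto)
  then have "?S * ?\<phi> (\<Sum>j\<in>J. (a j / ?S) *\<^sub>R q j) \<le> ?S * (\<Sum>j\<in>J. (a j / ?S) * ?\<phi> (q j))"
    using pos by (intro mult_left_mono) auto
  also have "\<dots> = (\<Sum>j\<in>J. a j * ?\<phi> (q j))"
    using pos by (simp add: sum_distrib_left)
  also have "(\<Sum>j\<in>J. (a j / ?S) *\<^sub>R q j) = (\<Sum>j\<in>J. a j * q j) / ?S"
    by (simp add: sum_divide_distrib)
  finally show ?thesis by (simp add: sum_negf)
qed

definition cum_loss :: "(nat \<Rightarrow> real) \<Rightarrow> ('j \<Rightarrow> nat \<Rightarrow> real) \<Rightarrow> nat \<Rightarrow> 'j \<Rightarrow> real" where
  "cum_loss w q i j = (\<Sum>k<i. (w k - q j k)\<^sup>2)"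

text \<open>The learning rate 1/2 is the one for which the exponentiated square loss is concave on
  the unit interval.\<close>

definition weighted_average :: "'j set \<Rightarrow> ('j \<Rightarrow> real) \<Rightarrow> ('j \<Rightarrow> real) \<Rightarrow> real" where
  "weighted_average J L q = (\<Sum>j\<in>J. exp (- L j / 2) * q j) / (\<Sum>j\<in>J. exp (- L j / 2))"

lemma weighted_average_bounds:
  assumes fin: "finite J" "J \<noteq> {}" and q: "\<And>j. j \<in> J \<Longrightarrow> 0 \<le> q j \<and> q j \<le> 1"
  shows "0 \<le> weighted_average J L q" "weighted_average J L q \<le> 1"
proof -
  have pos: "0 < (\<Sum>j\<in>J. exp (- L j / 2))" using fin by (intro sum_pos) auto
  show "0 \<le> weighted_average J L q" unfolding weighted_average_def
    using q pos by (intro divide_nonneg_pos sum_nonneg) auto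
  have "(\<Sum>j\<in>J. exp (- L j / 2) * q j) \<le> (\<Sum>j\<in>J. exp (- L j / 2) * 1)"
    using q by (intro sum_mono mult_left_mono) auto
  then show "weighted_average J L q \<le> 1" unfolding weighted_average_def using pos by simp
qed

text \<open>The total weight \<open>\<Phi>\<close> starts at \<open>card J\<close>, is multiplied in
  each round by at most the exponential of minus half the forecaster's loss, and ends no smaller
  than the weight of \<open>j\<close>. Logarithms give the bound.\<close>

lemma exponential_weights_regret:
  assumes fin: "finite J" and j: "j \<in> J"
    and w: "\<And>k. k < n \<Longrightarrow> 0 \<le> w k \<and> w k \<le> 1" and q: "\<And>j k. j \<in> J \<Longrightarrow> 0 \<le> q j k \<and> q j k \<le> 1"
  shows "(\<Sum>i<n. (w i - weighted_average J (cum_loss w q i) (\<lambda>j. q j i))\<^sup>2)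
     \<le> cum_loss w q n j + 2 * ln (real (card J))"
proof -
  let ?p = "\<lambda>i. weighted_average J (cum_loss w q i) (\<lambda>j. q j i)"
  define \<Phi> where "\<Phi> i = (\<Sum>j\<in>J. exp (- cum_loss w q i j / 2))" for i
  have ne: "J \<noteq> {}" using j by auto
  have pos: "0 < \<Phi> i" for i unfolding \<Phi>_def using fin ne by (intro sum_pos) auto
  have step: "\<Phi> (Suc i) \<le> \<Phi> i * exp (- (w i - ?p i)\<^sup>2 / 2)" if "i < n" for i
  proof -
    have "\<Phi> (Suc i) = (\<Sum>j\<in>J. exp (- cum_loss w q i j / 2) * exp (- (w i - q j i)\<^sup>2 / 2))"
      unfolding \<Phi>_def cum_loss_def by (intro sum.cong refl) (simp add: exp_add[symmetric] field_simps)
    also have "\<dots> \<le> \<Phi> i * exp (- (w i - (\<Sum>j\<in>J. exp (- cum_loss w q i j / 2) * q j i) / \<Phi> i)\<^sup>2 / 2)"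
      unfolding \<Phi>_def using w[OF that] fin q pos[of i] by (intro exp_square_concave) (auto simp: \<Phi>_def)
    finally show ?thesis by (simp add: weighted_average_def \<Phi>_def)
  qed
  have "\<Phi> m \<le> real (card J) * exp (- (\<Sum>i<m. (w i - ?p i)\<^sup>2) / 2)" if "m \<le> n" for m
    using that
  proof (induction m)
    case 0
    show ?case by (simp add: \<Phi>_def cum_loss_def)
  next
    case (Suc m)
    have "\<Phi> (Suc m) \<le> \<Phi> m * exp (- (w m - ?p m)\<^sup>2 / 2)" using Suc by (intro step) auto
    also have "\<dots> \<le> (real (card J) * exp (- (\<Sum>i<m. (w i - ?p i)\<^sup>2) / 2)) * exp (- (w m - ?p m)\<^sup>2 / 2)"
      using Suc by (intro mult_right_mono) auto
    also have "\<dots> = real (card J) * exp (- (\<Sum>i<Suc m. (w i - ?p i)\<^sup>2) / 2)"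
      by (simp only: mult.assoc exp_add[symmetric]) (simp add: field_simps)
    finally show ?case .
  qed
  from this[of n] have le: "\<Phi> n \<le> real (card J) * exp (- (\<Sum>i<n. (w i - ?p i)\<^sup>2) / 2)" by simp
  have "exp (- cum_loss w q n j / 2) \<le> \<Phi> n"
    unfolding \<Phi>_def using fin j by (intro member_le_sum[of j J "\<lambda>j. exp (- cum_loss w q n j / 2)"]) auto
  with le have "exp (- cum_loss w q n j / 2) \<le> real (card J) * exp (- (\<Sum>i<n. (w i - ?p i)\<^sup>2) / 2)" by linarith
  then have "ln (exp (- cum_loss w q n j / 2)) \<le> ln (real (card J) * exp (- (\<Sum>i<n. (w i - ?p i)\<^sup>2) / 2))"
    by (subst ln_le_cancel_iff) (use fin ne in \<open>auto simp: card_gt_0_iff\<close>)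
  also have "\<dots> = ln (real (card J)) - (\<Sum>i<n. (w i - ?p i)\<^sup>2) / 2"
    using fin ne by (simp add: ln_mult card_gt_0_iff)
  finally show ?thesis by simp
qed

section \<open>From regret to risk\<close>

text \<open>\<open>orth\<close> expresses that \<open>r0\<close> is the conditional expectation of
  the response \<open>W\<close> given the covariate, through bounded test functions of the
  covariate.\<close>

locale bounded_regression = prob_space P
  for P :: "((real ^ 'd::finite) \<times> real) measure" +
  fixes W :: "(real ^ 'd) \<times> real \<Rightarrow> real" and r0 :: "real ^ 'd \<Rightarrow> real"
  assumes sets_P [measurable_cong]: "sets P = sets borel"
    and W [measurable]: "W \<in> borel_measurable borel" and W01: "\<And>z. 0 \<le> W z" "\<And>z. W z \<le> 1"
    and r0 [measurable]: "r0 \<in> borel_measurable borel" and r01: "\<And>x. 0 \<le> r0 x" "\<And>x. r0 x \<le> 1"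
    and orth: "\<And>g. g \<in> borel_measurable borel \<Longrightarrow> (\<And>x. \<bar>g x\<bar> \<le> 1) \<Longrightarrow>
      (\<integral>z. g (fst z) * (W z - r0 (fst z)) \<partial>P) = 0"
begin

text \<open>After expanding the squares, the cross term vanishes by \<open>orth\<close> with the
  test function \<open>u - r0\<close>.\<close>

lemma excess_loss:
  assumes u[measurable]: "u \<in> borel_measurable borel" and u01: "\<And>x. 0 \<le> u x" "\<And>x. u x \<le> 1"
  shows "(\<integral>z. (W z - u (fst z))\<^sup>2 - (W z - r0 (fst z))\<^sup>2 \<partial>P) = (\<integral>z. (u (fst z) - r0 (fst z))\<^sup>2 \<partial>P)"
proof -
  have b: "\<bar>u x - r0 x\<bar> \<le> 1" for x using u01[of x] r01[of x] by linarith
  have "\<bar>(u (fst z) - r0 (fst z)) * (W z - r0 (fst z))\<bar> \<le> 1 * 1" for z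
    unfolding abs_mult using b[of "fst z"] W01[of z] r01[of "fst z"] by (intro mult_mono) auto
  then have i1: "integrable P (\<lambda>z. (u (fst z) - r0 (fst z)) * (W z - r0 (fst z)))"
    by (intro integrable_const_bound[where B = 1] AE_I2) auto
  have i2: "integrable P (\<lambda>z. (u (fst z) - r0 (fst z))\<^sup>2)"
    using b by (intro integrable_const_bound[where B = 1] AE_I2) (auto simp: abs_square_le_1)
  have "(\<integral>z. (W z - u (fst z))\<^sup>2 - (W z - r0 (fst z))\<^sup>2 \<partial>P)
      = (\<integral>z. (u (fst z) - r0 (fst z))\<^sup>2 - 2 * ((u (fst z) - r0 (fst z)) * (W z - r0 (fst z))) \<partial>P)"
    by (intro Bochner_Integration.integral_cong) (auto simp: power2_eq_square algebra_simps)
  also have "\<dots> = (\<integral>z. (u (fst z) - r0 (fst z))\<^sup>2 \<partial>P) - 2 * (\<integral>z. (u (fst z) - r0 (fst z)) * (W z - r0 (fst z)) \<partial>P)"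
    using i1 i2 by simp
  also have "(\<integral>z. (u (fst z) - r0 (fst z)) * (W z - r0 (fst z)) \<partial>P) = 0"
    using b by (intro orth[of "\<lambda>x. u x - r0 x"]) auto
  finally show ?thesis by simp
qed

lemma loss_bounds:
  assumes "0 \<le> g" "g \<le> 1"
  shows "(g - r0 x)\<^sup>2 \<le> 1" and "\<bar>(W y - g)\<^sup>2 - (W y - r0 (fst y))\<^sup>2\<bar> \<le> 1"
proof -
  have "\<bar>W y - g\<bar> \<le> 1" "\<bar>W y - r0 (fst y)\<bar> \<le> 1" "\<bar>g - r0 x\<bar> \<le> 1"
    using assms W01[of y] r01[of "fst y"] r01[of x] by linarith+
  then have "(W y - g)\<^sup>2 \<le> 1" "(W y - r0 (fst y))\<^sup>2 \<le> 1" and *: "(g - r0 x)\<^sup>2 \<le> 1"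
    by (auto simp: abs_square_le_1)
  then show "\<bar>(W y - g)\<^sup>2 - (W y - r0 (fst y))\<^sup>2\<bar> \<le> 1"
    using zero_le_power2[of "W y - g"] zero_le_power2[of "W y - r0 (fst y)"] by linarith
  show "(g - r0 x)\<^sup>2 \<le> 1" by (rule *)
qed

text \<open>Since \<open>G\<close> does not read observation \<open>i\<close>, that observation is a
  fresh draw given the others, and \<open>excess_loss\<close> applies to the inner integral.\<close>

lemma excess_loss_PiM:
  fixes i n :: nat
  assumes i: "i < n" and G[measurable]: "(\<lambda>(z, x). G z x) \<in> borel_measurable (PiM {..<n} (\<lambda>_. borel) \<Otimes>\<^sub>M borel)"
    and G01: "\<And>z x. 0 \<le> G z x" "\<And>z x. G z x \<le> 1"
    and indep: "\<And>z y. G (z(i := y)) = G z"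
  shows "(\<integral>z. (W (z i) - G z (fst (z i)))\<^sup>2 - (W (z i) - r0 (fst (z i)))\<^sup>2 \<partial>PiM {..<n} (\<lambda>_. P))
    = (\<integral>z. (\<integral>y. (G z (fst y) - r0 (fst y))\<^sup>2 \<partial>P) \<partial>PiM {..<n} (\<lambda>_. P))"
proof -
  let ?Pn = "PiM {..<n} (\<lambda>_. P)"
  interpret PP: product_prob_space "\<lambda>_. P" by standard
  interpret Pn: prob_space "?Pn" by (rule prob_space_PiM) (rule prob_space_axioms)
  let ?I = "{..<n} - {i}"
  have ins: "insert i ?I = {..<n}" using i by auto
  have sets_n: "sets ?Pn = sets (PiM {..<n} (\<lambda>_. borel))"
    by (intro sets_PiM_cong refl sets_P)
  have G'[measurable]: "(\<lambda>(z, x). G z x) \<in> borel_measurable (?Pn \<Otimes>\<^sub>M borel)"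
    using G by (subst measurable_cong_sets[OF sets_pair_measure_cong[OF sets_n refl] refl])
  have zi[measurable]: "(\<lambda>z. z i) \<in> measurable ?Pn P"
    using i by (intro measurable_component_singleton) auto
  have Gz: "G z \<in> borel_measurable borel" if "z \<in> space ?Pn" for z
    using measurable_Pair2[OF G' that] by simp
  have "(\<lambda>z. fst (z i)) \<in> borel_measurable ?Pn"
    by (rule measurable_compose[OF zi]) measurable
  then have Gii: "(\<lambda>z. G z (fst (z i))) \<in> borel_measurable ?Pn"
    using measurable_compose[OF measurable_Pair[OF measurable_ident_sets[OF refl]] G'] by simp
  have [measurable]: "(\<lambda>z. W (z i)) \<in> borel_measurable ?Pn"
      "(\<lambda>z. r0 (fst (z i))) \<in> borel_measurable ?Pn"
    by (rule measurable_compose[OF zi]; measurable)+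
  note [measurable] = Gii
  have int1: "integrable (PiM (insert i ?I) (\<lambda>_. P)) (\<lambda>z. (W (z i) - G z (fst (z i)))\<^sup>2 - (W (z i) - r0 (fst (z i)))\<^sup>2)"
    unfolding ins using loss_bounds(2) G01 Gii by (intro Pn.integrable_const_bound[where B = 1] AE_I2) auto
  have D_meas: "(\<lambda>z. \<integral>y. (G z (fst y) - r0 (fst y))\<^sup>2 \<partial>P) \<in> borel_measurable ?Pn"
    by measurable
  have D_b: "\<bar>\<integral>y. (G z (fst y) - r0 (fst y))\<^sup>2 \<partial>P\<bar> \<le> 1" if "z \<in> space ?Pn" for z
  proof -
    note [measurable] = Gz[OF that]
    show ?thesis
      using integral_between(2,3)[of "\<lambda>y. (G z (fst y) - r0 (fst y))\<^sup>2" 0 1] loss_bounds(1) G01 by auto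
  qed
  have int2: "integrable (PiM (insert i ?I) (\<lambda>_. P)) (\<lambda>z. \<integral>y. (G z (fst y) - r0 (fst y))\<^sup>2 \<partial>P)"
    unfolding ins using D_meas D_b by (intro Pn.integrable_const_bound[where B = 1] AE_I2) auto
  have "(\<integral>z. (W (z i) - G z (fst (z i)))\<^sup>2 - (W (z i) - r0 (fst (z i)))\<^sup>2 \<partial>PiM (insert i ?I) (\<lambda>_. P))
    = (\<integral>z. (\<integral>y. (W y - G z (fst y))\<^sup>2 - (W y - r0 (fst y))\<^sup>2 \<partial>P) \<partial>PiM ?I (\<lambda>_. P))"
    by (subst PP.product_integral_insert[OF _ _ int1]) (auto simp: indep)
  also have "\<dots> = (\<integral>z. (\<integral>y. (G z (fst y) - r0 (fst y))\<^sup>2 \<partial>P) \<partial>PiM ?I (\<lambda>_. P))"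
  proof (rule Bochner_Integration.integral_cong[OF refl])
    fix z assume z: "z \<in> space (PiM ?I (\<lambda>_. P))"
    \<comment> \<open>A point of the smaller product is completed at \<open>i\<close> only to land
      in the full sample space, where measurability of the section is known; by \<open>indep\<close>
      the section is the same.\<close>
    have "z(i := undefined) \<in> space ?Pn"
      using z i sets_eq_imp_space_eq[OF sets_P] by (auto simp: space_PiM PiE_def extensional_def)
    from Gz[OF this] have "G z \<in> borel_measurable borel" by (simp add: indep)
    then show "(\<integral>y. (W y - G z (fst y))\<^sup>2 - (W y - r0 (fst y))\<^sup>2 \<partial>P) = (\<integral>y. (G z (fst y) - r0 (fst y))\<^sup>2 \<partial>P)"
      using G01 by (intro excess_loss) auto
  qed
  also have "\<dots> = (\<integral>z. (\<integral>y. (G z (fst y) - r0 (fst y))\<^sup>2 \<partial>P) \<partial>PiM (insert i ?I) (\<lambda>_. P))"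
    by (subst PP.product_integral_insert[OF _ _ int2]) (auto simp: indep prob_space)
  finally show ?thesis unfolding ins .
qed

text \<open>Only observations with index below \<open>i\<close> enter, which makes the forecast
  independent of observation \<open>i\<close>.\<close>

definition forecast :: "'j set \<Rightarrow> ('j \<Rightarrow> real ^ 'd \<Rightarrow> real) \<Rightarrow> nat \<Rightarrow> (nat \<Rightarrow> (real ^ 'd) \<times> real) \<Rightarrow> real ^ 'd \<Rightarrow> real" where
  "forecast J r i z x = weighted_average J (cum_loss (\<lambda>k. W (z k)) (\<lambda>j k. r j (fst (z k))) i) (\<lambda>j. r j x)"

end

text \<open>Online-to-batch conversion by averaging the forecasts made before each observation. The
  formula takes the response and the candidates alone, so it defines an estimator that does not know
  the sampling law.\<close>

definition aggregate ::
    "('a \<times> 'b \<Rightarrow> real) \<Rightarrow> 'j set \<Rightarrow> ('j \<Rightarrow> 'a \<Rightarrow> real) \<Rightarrow> nat \<Rightarrow> (nat \<Rightarrow> 'a \<times> 'b) \<Rightarrow> 'a \<Rightarrow> real" where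
  "aggregate W J r n z x =
     (\<Sum>i<n. weighted_average J (cum_loss (\<lambda>k. W (z k)) (\<lambda>j k. r j (fst (z k))) i) (\<lambda>j. r j x)) / real n"

context bounded_regression
begin

lemma aggregate_eq: "aggregate W J r n z x = (\<Sum>i<n. forecast J r i z x) / real n"
  by (simp add: aggregate_def forecast_def)

lemma forecast_measurable:
  assumes "finite J" "i \<le> n" and r[measurable]: "\<And>j. j \<in> J \<Longrightarrow> r j \<in> borel_measurable borel"
  shows "(\<lambda>(z, x). forecast J r i z x) \<in> borel_measurable (PiM {..<n} (\<lambda>_. borel) \<Otimes>\<^sub>M borel)"
proof -
  have zk[measurable]: "(\<lambda>z. z k) \<in> measurable (PiM {..<n} (\<lambda>_. borel)) borel" if "k < i" for k
    using that assms by (intro measurable_component_singleton) auto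
  have L[measurable]: "(\<lambda>z. cum_loss (\<lambda>k. W (z k)) (\<lambda>j k. r j (fst (z k))) i j) \<in> borel_measurable (PiM {..<n} (\<lambda>_. borel))"
    if j: "j \<in> J" for j
    unfolding cum_loss_def
  proof (rule borel_measurable_sum)
    fix k assume k: "k \<in> {..<i}"
    then have [measurable]: "(\<lambda>z. z k) \<in> measurable (PiM {..<n} (\<lambda>_. borel)) borel" by (intro zk) auto
    note [measurable] = r[OF j]
    show "(\<lambda>z. (W (z k) - r j (fst (z k)))\<^sup>2) \<in> borel_measurable (PiM {..<n} (\<lambda>_. borel))"
      by measurable
  qed
  have 1: "(\<lambda>p. exp (- cum_loss (\<lambda>k. W (fst p k)) (\<lambda>j k. r j (fst (fst p k))) i j / 2) * r j (snd p))
      \<in> borel_measurable (PiM {..<n} (\<lambda>_. borel) \<Otimes>\<^sub>M borel)" if j: "j \<in> J" for j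
  proof -
    note [measurable] = r[OF j] measurable_compose[OF measurable_fst L[OF j]]
    show ?thesis by measurable
  qed
  have 2: "(\<lambda>p. exp (- cum_loss (\<lambda>k. W (fst p k)) (\<lambda>j k. r j (fst (fst p k))) i j / 2))
      \<in> borel_measurable (PiM {..<n} (\<lambda>_. borel) \<Otimes>\<^sub>M borel)" if j: "j \<in> J" for j
  proof -
    note [measurable] = measurable_compose[OF measurable_fst L[OF j]]
    show ?thesis by measurable
  qed
  show ?thesis
    unfolding forecast_def weighted_average_def split_beta'
    by (intro borel_measurable_divide borel_measurable_sum 1 2)
qed

lemma aggregate_measurable:
  assumes "finite J" and "\<And>j. j \<in> J \<Longrightarrow> r j \<in> borel_measurable borel"
  shows "(\<lambda>(z, x). aggregate W J r n z x) \<in> borel_measurable (PiM {..<n} (\<lambda>_. borel) \<Otimes>\<^sub>M borel)"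
proof -
  have "(\<lambda>p. forecast J r i (fst p) (snd p)) \<in> borel_measurable (PiM {..<n} (\<lambda>_. borel) \<Otimes>\<^sub>M borel)" if "i < n" for i
    using forecast_measurable[OF assms(1) less_imp_le[OF that] assms(2)] by (simp add: split_beta')
  then show ?thesis
    unfolding aggregate_eq split_beta' by (intro borel_measurable_divide borel_measurable_sum) auto
qed

lemma aggregate_bounds:
  assumes "finite J" "J \<noteq> {}" and "\<And>j x. j \<in> J \<Longrightarrow> 0 \<le> r j x \<and> r j x \<le> 1" and n: "n \<ge> 1"
  shows "0 \<le> aggregate W J r n z x" "aggregate W J r n z x \<le> 1"
proof -
  have b: "0 \<le> forecast J r i z x" "forecast J r i z x \<le> 1" for i
    unfolding forecast_def using assms by (intro weighted_average_bounds; simp)+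
  show "0 \<le> aggregate W J r n z x" unfolding aggregate_eq using b by (intro divide_nonneg_nonneg sum_nonneg) auto
  have "(\<Sum>i<n. forecast J r i z x) \<le> (\<Sum>i<n. 1)" using b by (intro sum_mono) auto
  then show "aggregate W J r n z x \<le> 1" unfolding aggregate_eq using n by simp
qed

lemma aggregate_risk_integrable:
  assumes J: "finite J" "J \<noteq> {}" and r: "\<And>j. j \<in> J \<Longrightarrow> r j \<in> borel_measurable borel"
    and r_bounds: "\<And>j x. j \<in> J \<Longrightarrow> 0 \<le> r j x \<and> r j x \<le> 1" and n: "n \<ge> 1"
  shows "integrable (PiM {..<n} (\<lambda>_. P)) (\<lambda>z. \<integral>y. (aggregate W J r n z (fst y) - r0 (fst y))\<^sup>2 \<partial>P)"
proof -
  let ?Pn = "PiM {..<n} (\<lambda>_. P)"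
  interpret Pn: prob_space "?Pn" by (rule prob_space_PiM) (rule prob_space_axioms)
  have sets_n: "sets ?Pn = sets (PiM {..<n} (\<lambda>_. borel))"
    by (intro sets_PiM_cong refl sets_P)
  have m[measurable]: "(\<lambda>(z, x). aggregate W J r n z x) \<in> borel_measurable (?Pn \<Otimes>\<^sub>M borel)"
    using aggregate_measurable[OF J(1) r]
    by (subst measurable_cong_sets[OF sets_pair_measure_cong[OF sets_n refl] refl])
  show ?thesis
  proof (intro Pn.integrable_const_bound[where B = 1] AE_I2)
    show "(\<lambda>z. \<integral>y. (aggregate W J r n z (fst y) - r0 (fst y))\<^sup>2 \<partial>P) \<in> borel_measurable ?Pn"
      by measurable
    fix z assume z: "z \<in> space ?Pn"
    have [measurable]: "aggregate W J r n z \<in> borel_measurable borel"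
      using measurable_Pair2[OF m z] by simp
    have "0 \<le> aggregate W J r n z x" "aggregate W J r n z x \<le> 1" for x
      by (rule aggregate_bounds[OF J r_bounds n]; assumption)+
    then have "\<bar>aggregate W J r n z x - r0 x\<bar> \<le> 1" for x
      using r01[of x] by (smt (verit))
    then have "(aggregate W J r n z x - r0 x)\<^sup>2 \<le> 1" for x by (simp add: abs_square_le_1)
    then show "norm (\<integral>y. (aggregate W J r n z (fst y) - r0 (fst y))\<^sup>2 \<partial>P) \<le> 1"
      using integral_between(2,3)[of "\<lambda>y. (aggregate W J r n z (fst y) - r0 (fst y))\<^sup>2" 0 1] by auto
  qed
qed

text \<open>By convexity the risk of the average is at most the average of the forecast risks. In
  expectation each forecast risk is the excess loss on the next observation, and the regret bound
  compares the sum of these with the candidate \<open>j\<close>, whose expected excess is at most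
  \<open>e\<close> per round. Only expectations occur, so no concentration argument enters.\<close>

lemma aggregate_risk:
  fixes n :: nat
  assumes J: "finite J" "j \<in> J" and r: "\<And>j. j \<in> J \<Longrightarrow> r j \<in> borel_measurable borel"
    and r_bounds: "\<And>j x. j \<in> J \<Longrightarrow> 0 \<le> r j x \<and> r j x \<le> 1" and n: "n \<ge> 1"
    and approx: "(\<integral>y. (r j (fst y) - r0 (fst y))\<^sup>2 \<partial>P) \<le> e"
  shows "(\<integral>z. (\<integral>y. (aggregate W J r n z (fst y) - r0 (fst y))\<^sup>2 \<partial>P) \<partial>PiM {..<n} (\<lambda>_. P))
    \<le> 2 * ln (real (card J)) / real n + e"
proof -
  let ?Pn = "PiM {..<n} (\<lambda>_. P)"
  interpret Pn: prob_space "?Pn" by (rule prob_space_PiM) (rule prob_space_axioms)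
  have ne: "J \<noteq> {}" using J by auto
  have sets_n: "sets ?Pn = sets (PiM {..<n} (\<lambda>_. borel))"
    by (intro sets_PiM_cong refl sets_P)
  have fb: "0 \<le> forecast J r i z x" "forecast J r i z x \<le> 1" for i z x
    unfolding forecast_def using J ne r_bounds by (intro weighted_average_bounds; simp)+
  have fm: "(\<lambda>(z, x). forecast J r i z x) \<in> borel_measurable (PiM {..<n} (\<lambda>_. borel) \<Otimes>\<^sub>M borel)" if "i < n" for i
    using that J r by (intro forecast_measurable) auto
  have fm'[measurable]: "(\<lambda>(z, x). forecast J r i z x) \<in> borel_measurable (?Pn \<Otimes>\<^sub>M borel)" if "i < n" for i
    using fm[OF that] by (subst measurable_cong_sets[OF sets_pair_measure_cong[OF sets_n refl] refl])
  have zi[measurable]: "(\<lambda>z. z i) \<in> measurable ?Pn P" if "i < n" for i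
    using that by (intro measurable_component_singleton) auto
  have fz: "forecast J r i z \<in> borel_measurable borel" if "i < n" "z \<in> space ?Pn" for z i
    using measurable_Pair2[OF fm'[OF that(1)] that(2)] by simp
  have indep: "forecast J r i (z(i := y)) = forecast J r i z" for i z y
  proof -
    have "cum_loss (\<lambda>k. W ((z(i := y)) k)) (\<lambda>j k. r j (fst ((z(i := y)) k))) i
        = cum_loss (\<lambda>k. W (z k)) (\<lambda>j k. r j (fst (z k))) i"
      by (auto simp: cum_loss_def fun_eq_iff intro!: sum.cong)
    then show ?thesis by (simp only: forecast_def[abs_def])
  qed
  have zim: "(\<lambda>z. W (z i)) \<in> borel_measurable ?Pn"
      "(\<lambda>z. fst (z i)) \<in> borel_measurable ?Pn"
      "(\<lambda>z. r0 (fst (z i))) \<in> borel_measurable ?Pn" if "i < n" for i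
    by (rule measurable_compose[OF zi[OF that]]; measurable)+
  \<comment> \<open>\<open>D\<close> is the risk of the \<open>i\<close>-th forecast,
    \<open>E\<close> its excess loss on observation \<open>i\<close>, and \<open>F\<close> the
    excess loss of the candidate \<open>j\<close> there.\<close>
  define D where "D i z = (\<integral>y. (forecast J r i z (fst y) - r0 (fst y))\<^sup>2 \<partial>P)" for i z
  define E where "E i z = (W (z i) - forecast J r i z (fst (z i)))\<^sup>2 - (W (z i) - r0 (fst (z i)))\<^sup>2" for i :: nat and z
  define F where "F i z = (W (z i) - r j (fst (z i)))\<^sup>2 - (W (z i) - r0 (fst (z i)))\<^sup>2" for i :: nat and z
  have D_int: "integrable ?Pn (D i)" if i: "i < n" for i
  proof (intro Pn.integrable_const_bound[where B = 1] AE_I2)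
    note [measurable] = fm'[OF i]
    show "D i \<in> borel_measurable ?Pn" unfolding D_def by measurable
    fix z assume z: "z \<in> space ?Pn"
    note [measurable] = fz[OF i z]
    show "norm (D i z) \<le> 1" unfolding D_def
      using integral_between(2,3)[of "\<lambda>y. (forecast J r i z (fst y) - r0 (fst y))\<^sup>2" 0 1] loss_bounds(1) fb by auto
  qed
  have E_int: "integrable ?Pn (E i)" if i: "i < n" for i
  proof (intro Pn.integrable_const_bound[where B = 1] AE_I2)
    note [measurable] = fm'[OF i] zim[OF i]
    have [measurable]: "(\<lambda>z. forecast J r i z (fst (z i))) \<in> borel_measurable ?Pn"
      using measurable_compose[OF measurable_Pair[OF measurable_ident_sets[OF refl] zim(2)[OF i]] fm'[OF i]] by simp
    show "E i \<in> borel_measurable ?Pn" unfolding E_def by measurable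
    show "norm (E i z) \<le> 1" for z unfolding E_def using loss_bounds(2) fb by auto
  qed
  have F_int: "integrable ?Pn (F i)" if i: "i < n" for i
  proof (intro Pn.integrable_const_bound[where B = 1] AE_I2)
    note [measurable] = zim[OF i] measurable_compose[OF zim(2)[OF i] r[OF J(2)]]
    show "F i \<in> borel_measurable ?Pn" unfolding F_def by measurable
    show "norm (F i z) \<le> 1" for z unfolding F_def using loss_bounds(2) r_bounds[OF J(2)] by auto
  qed
  have DE: "(\<integral>z. D i z \<partial>?Pn) = (\<integral>z. E i z \<partial>?Pn)" if i: "i < n" for i
    unfolding D_def E_def using excess_loss_PiM[OF i fm[OF i] fb indep] by simp
  have Fe: "(\<integral>z. F i z \<partial>?Pn) \<le> e" if i: "i < n" for i
  proof -
    note [measurable] = r[OF J(2)]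
    have "(\<integral>z. F i z \<partial>?Pn) = (\<integral>z. (\<integral>y. (r j (fst y) - r0 (fst y))\<^sup>2 \<partial>P) \<partial>?Pn)"
      unfolding F_def using r_bounds[OF J(2)]
      by (intro excess_loss_PiM[OF i, of "\<lambda>_. r j"]) (auto simp: split_beta')
    then show ?thesis using approx by (simp add: Pn.prob_space)
  qed
  have regret: "(\<Sum>i<n. E i z) \<le> (\<Sum>i<n. F i z) + 2 * ln (real (card J))" for z
  proof -
    have "(\<Sum>i<n. (W (z i) - forecast J r i z (fst (z i)))\<^sup>2)
       \<le> cum_loss (\<lambda>k. W (z k)) (\<lambda>j k. r j (fst (z k))) n j + 2 * ln (real (card J))"
      unfolding forecast_def using J W01 r_bounds
      by (intro exponential_weights_regret[where q = "\<lambda>j k. r j (fst (z k))"]) auto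
    then show ?thesis by (simp add: E_def F_def sum_subtractf cum_loss_def)
  qed
  have conv: "(\<integral>y. (aggregate W J r n z (fst y) - r0 (fst y))\<^sup>2 \<partial>P) \<le> (\<Sum>i<n. D i z) / real n"
    if z: "z \<in> space ?Pn" for z
  proof -
    have int: "integrable P (\<lambda>y. (forecast J r i z (fst y) - r0 (fst y))\<^sup>2)" if "i < n" for i
    proof -
      note [measurable] = fz[OF that z]
      show ?thesis using loss_bounds(1) fb by (intro integral_between(1)[where lo = 0 and hi = 1]) auto
    qed
    have "(\<integral>y. (aggregate W J r n z (fst y) - r0 (fst y))\<^sup>2 \<partial>P)
       \<le> (\<integral>y. (\<Sum>i<n. (forecast J r i z (fst y) - r0 (fst y))\<^sup>2) / real n \<partial>P)"
    proof (rule integral_mono')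
      show "integrable P (\<lambda>y. (\<Sum>i<n. (forecast J r i z (fst y) - r0 (fst y))\<^sup>2) / real n)"
        using int by (intro integrable_divide_zero Bochner_Integration.integrable_sum) auto
      show "0 \<le> (\<Sum>i<n. (forecast J r i z (fst y) - r0 (fst y))\<^sup>2) / real n" for y
        by (intro divide_nonneg_nonneg sum_nonneg) auto
      fix y
      have "(\<Sum>i<n. forecast J r i z (fst y)) / real n - r0 (fst y)
          = (\<Sum>i<n. 1 * (forecast J r i z (fst y) - r0 (fst y))) / real n"
        using n by (simp add: sum_subtractf field_simps)
      then have "(aggregate W J r n z (fst y) - r0 (fst y))\<^sup>2
          = (\<Sum>i<n. 1 * (forecast J r i z (fst y) - r0 (fst y)))\<^sup>2 / (real n)\<^sup>2"
        by (simp add: aggregate_eq power_divide)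
      also have "\<dots> \<le> ((\<Sum>i<n. 1\<^sup>2) * (\<Sum>i<n. (forecast J r i z (fst y) - r0 (fst y))\<^sup>2)) / (real n)\<^sup>2"
        by (intro divide_right_mono Cauchy_Schwarz_ineq_sum) auto
      also have "\<dots> = (\<Sum>i<n. (forecast J r i z (fst y) - r0 (fst y))\<^sup>2) / real n"
        using n by (simp add: power2_eq_square)
      finally show "(aggregate W J r n z (fst y) - r0 (fst y))\<^sup>2
          \<le> (\<Sum>i<n. (forecast J r i z (fst y) - r0 (fst y))\<^sup>2) / real n" .
    qed
    also have "\<dots> = (\<Sum>i<n. D i z) / real n"
      unfolding D_def using int by simp
    finally show ?thesis .
  qed
  have D0: "0 \<le> D i z" for i z unfolding D_def by (intro Bochner_Integration.integral_nonneg) auto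
  have "(\<integral>z. (\<integral>y. (aggregate W J r n z (fst y) - r0 (fst y))\<^sup>2 \<partial>P) \<partial>?Pn)
     \<le> (\<integral>z. (\<Sum>i<n. D i z) / real n \<partial>?Pn)"
  proof (rule integral_mono_AE')
    show "integrable ?Pn (\<lambda>z. (\<Sum>i<n. D i z) / real n)"
      using D_int by (intro integrable_divide_zero Bochner_Integration.integrable_sum) auto
    show "AE z in ?Pn. (\<integral>y. (aggregate W J r n z (fst y) - r0 (fst y))\<^sup>2 \<partial>P) \<le> (\<Sum>i<n. D i z) / real n"
      using conv by (intro AE_I2)
    show "AE z in ?Pn. 0 \<le> (\<Sum>i<n. D i z) / real n"
      using D0 by (intro AE_I2 divide_nonneg_nonneg sum_nonneg) auto
  qed
  also have "\<dots> = (\<Sum>i<n. (\<integral>z. D i z \<partial>?Pn)) / real n"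
    using D_int by simp
  also have "(\<Sum>i<n. (\<integral>z. D i z \<partial>?Pn)) = (\<Sum>i<n. (\<integral>z. E i z \<partial>?Pn))"
    using DE by simp
  also have "\<dots> = (\<integral>z. (\<Sum>i<n. E i z) \<partial>?Pn)"
    using E_int by simp
  also have "\<dots> \<le> (\<integral>z. (\<Sum>i<n. F i z) + 2 * ln (real (card J)) \<partial>?Pn)"
    using E_int F_int regret by (intro integral_mono Bochner_Integration.integrable_add Bochner_Integration.integrable_sum) auto
  also have "\<dots> = (\<Sum>i<n. (\<integral>z. F i z \<partial>?Pn)) + 2 * ln (real (card J))"
  proof -
    have "integrable ?Pn (\<lambda>z. \<Sum>i<n. F i z)"
      using F_int by (intro Bochner_Integration.integrable_sum) auto
    moreover have "(\<integral>z. (\<Sum>i<n. F i z) \<partial>?Pn) = (\<Sum>i<n. (\<integral>z. F i z \<partial>?Pn))"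
      using F_int by (intro Bochner_Integration.integral_sum) auto
    ultimately show ?thesis by (simp add: Pn.prob_space)
  qed
  also have "\<dots> \<le> (\<Sum>i<n. e) + 2 * ln (real (card J))" using Fe by (intro add_mono sum_mono) auto
  finally show ?thesis using n by (simp add: field_simps divide_right_mono)
qed

end

section \<open>Entropy of the function classes\<close>

text \<open>Net points are taken inside \<open>G\<close>, so that they inherit the regularity and
  the bounds of the class.\<close>

definition has_net :: "'g set \<Rightarrow> ('g \<Rightarrow> 'g \<Rightarrow> bool) \<Rightarrow> real \<Rightarrow> bool" where
  "has_net G close N \<longleftrightarrow>
     (\<exists>A\<subseteq>G. finite A \<and> real (card A) \<le> N \<and> (\<forall>g\<in>G. \<exists>a\<in>A. close g a))"

text \<open>One representative is chosen for every code that occurs; counting codes bounds the size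
  of the net.\<close>

lemma has_net_code:
  assumes code: "\<And>g. g \<in> G \<Longrightarrow> F g \<in> C" and fin: "finite C" and card: "real (card C) \<le> N"
    and close: "\<And>g g'. g \<in> G \<Longrightarrow> g' \<in> G \<Longrightarrow> F g = F g' \<Longrightarrow> close g g'"
  shows "has_net G close N"
proof -
  define pick where "pick c = (SOME g. g \<in> G \<and> F g = c)" for c
  have pick: "pick (F g) \<in> G \<and> F (pick (F g)) = F g" if "g \<in> G" for g
    unfolding pick_def by (rule someI[of _ g]) (use that in auto)
  have sub: "F ` G \<subseteq> C" using code by auto
  have "card (pick ` F ` G) \<le> card (F ` G)" by (intro card_image_le finite_subset[OF sub fin])
  also have "\<dots> \<le> card C" by (intro card_mono fin sub)
  finally have "real (card (pick ` F ` G)) \<le> N" using card by linarith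
  moreover have "\<exists>a\<in>pick ` F ` G. close g a" if "g \<in> G" for g
    using pick[OF that] that by (intro bexI[of _ "pick (F g)"] close) auto
  ultimately show ?thesis
    unfolding has_net_def using pick finite_subset[OF sub fin]
    by (intro exI[of _ "pick ` F ` G"]) auto
qed

lemma hoelder_class_deriv:
  "g \<in> hoelder_class s \<gamma> L B \<Longrightarrow> k < s \<Longrightarrow>
     ((deriv ^^ k) g has_real_derivative (deriv ^^ Suc k) g z) (at z)"
  by (auto simp: hoelder_class_def DERIV_deriv_iff_real_differentiable)

text \<open>Lagrange's remainder contains the derivative of order \<open>s\<close> at an
  intermediate point. Replacing it by the value at \<open>c\<close> completes the Taylor polynomial
  and costs one Hoelder increment. All orders \<open>k\<close> are covered because the encoding
  predicts every derivative, and expansion to the right is enough for a grid traversed from left to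
  right.\<close>

lemma hoelder_class_taylor:
  assumes g: "g \<in> hoelder_class s \<gamma> L B" and k: "k \<le> s" and y: "c \<le> y" and \<gamma>: "0 < \<gamma>" and L: "0 \<le> L"
  shows "\<bar>(deriv ^^ k) g y - (\<Sum>l\<le>s - k. (deriv ^^ (k + l)) g c / fact l * (y - c) ^ l)\<bar>
    \<le> L * (y - c) powr (real (s - k) + \<gamma>)"
proof -
  have hol: "\<bar>(deriv ^^ s) g u - (deriv ^^ s) g v\<bar> \<le> L * \<bar>u - v\<bar> powr \<gamma>" for u v
    using g by (auto simp: hoelder_class_def)
  define n where "n = s - k"
  have split: "(\<Sum>l\<le>n. (deriv ^^ (k + l)) g c / fact l * (y - c) ^ l)
      = (\<Sum>l<n. (deriv ^^ (k + l)) g c / fact l * (y - c) ^ l) + (deriv ^^ (k + n)) g c / fact n * (y - c) ^ n"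
    by (simp add: lessThan_Suc_atMost[symmetric])
  consider "c = y" | "c < y" "n = 0" | "c < y" "n > 0" using y by linarith
  then show ?thesis
  proof cases
    case 1
    have "(\<Sum>l\<le>n. (deriv ^^ (k + l)) g c / fact l * (y - c) ^ l)
       = (\<Sum>l\<le>n. if l = 0 then (deriv ^^ k) g c else 0)"
      using 1 by (intro sum.cong) auto
    then show ?thesis using 1 L by (simp add: n_def)
  next
    case 2
    then have "k = s" using k by (simp add: n_def)
    then show ?thesis using hol[of y c] 2 by simp
  next
    case 3
    have "\<exists>t>c. t < y \<and> (deriv ^^ k) g y = (\<Sum>l<n. (deriv ^^ (k + l)) g c / fact l * (y - c) ^ l)
        + (deriv ^^ (k + n)) g t / fact n * (y - c) ^ n"
    proof (rule Taylor_up[where a = c and diff = "\<lambda>l. (deriv ^^ (k + l)) g"])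
      show "\<forall>m t. m < n \<and> c \<le> t \<and> t \<le> y \<longrightarrow>
        ((deriv ^^ (k + m)) g has_real_derivative (deriv ^^ (k + Suc m)) g t) (at t)"
        using hoelder_class_deriv[OF g] by (auto simp: n_def)
    qed (use 3 in auto)
    then obtain t where t: "c < t" "t < y" and
      eq: "(deriv ^^ k) g y = (\<Sum>l<n. (deriv ^^ (k + l)) g c / fact l * (y - c) ^ l)
        + (deriv ^^ (k + n)) g t / fact n * (y - c) ^ n" by blast
    have kn: "k + n = s" using k by (simp add: n_def)
    have "(deriv ^^ k) g y - (\<Sum>l\<le>n. (deriv ^^ (k + l)) g c / fact l * (y - c) ^ l)
       = ((deriv ^^ s) g t - (deriv ^^ s) g c) / fact n * (y - c) ^ n"
      unfolding eq split kn by (simp add: field_simps)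
    then have "\<bar>(deriv ^^ k) g y - (\<Sum>l\<le>n. (deriv ^^ (k + l)) g c / fact l * (y - c) ^ l)\<bar>
       = \<bar>(deriv ^^ s) g t - (deriv ^^ s) g c\<bar> / fact n * (y - c) ^ n"
      using y by (simp add: abs_mult)
    also have "\<dots> \<le> (L * (y - c) powr \<gamma>) / 1 * (y - c) ^ n"
    proof (intro mult_right_mono frac_le)
      have "L * \<bar>t - c\<bar> powr \<gamma> \<le> L * (y - c) powr \<gamma>"
        using t L \<gamma> by (intro mult_left_mono powr_mono2) auto
      then show "\<bar>(deriv ^^ s) g t - (deriv ^^ s) g c\<bar> \<le> L * (y - c) powr \<gamma>" using hol[of t c] by linarith
      show "(1::real) \<le> fact n" by (simp add: fact_ge_1)
    qed (use L y in auto)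
    also have "\<dots> = L * (y - c) powr (real n + \<gamma>)"
      using 3 by (simp add: powr_add powr_realpow)
    finally show ?thesis by (simp add: n_def)
  qed
qed

lemma ln_inverse_le:
  fixes \<delta> :: real
  assumes "0 < \<delta>"
  shows "ln (1 / \<delta>) \<le> 1 / \<delta>"
  using ln_le_minus_one[of "1 / \<delta>"] assms by simp

text \<open>Kolmogorov and Tikhomirov's encoding: the rounded derivatives at one grid point predict those
  at the next grid point up to boundedly many alternatives, so that no logarithmic factor appears.\<close>

lemma hoelder_class_net:
  fixes B :: "nat \<Rightarrow> real"
  assumes \<gamma>: "0 < \<gamma>" and L: "0 \<le> L" and R: "0 < R" and \<alpha>: "\<alpha> = real s + \<gamma>"
  obtains K where "0 < K" "\<And>\<delta>. 0 < \<delta> \<Longrightarrow> \<delta> \<le> 1 \<Longrightarrow>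
     has_net (hoelder_class s \<gamma> L B) (\<lambda>g g'. \<forall>z\<in>{-R..R}. \<bar>g z - g' z\<bar> \<le> K * \<delta> powr \<alpha>) (exp (K / \<delta>))"
proof -
  define Bm where "Bm = (\<Sum>k\<le>s. \<bar>B k\<bar>)"
  have Bm: "0 \<le> Bm" "\<And>k. k \<le> s \<Longrightarrow> B k \<le> Bm"
  proof -
    show "0 \<le> Bm" by (simp add: Bm_def sum_nonneg)
    fix k assume "k \<le> s"
    then have "\<bar>B k\<bar> \<le> Bm" unfolding Bm_def by (intro member_le_sum[of k "{..s}" "\<lambda>k. \<bar>B k\<bar>"]) auto
    then show "B k \<le> Bm" by linarith
  qed
  \<comment> \<open>Bound on the prediction error in rounding units: \<open>L\<close> from Taylor's
    formula, \<open>s + 1\<close> from the rounded inputs, the rest for the outer floors.\<close>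
  define Q where "Q = \<lceil>real s + 3 + L\<rceil>"
  have Q0: "0 \<le> Q" using L by (simp add: Q_def)
  define K1 where "K1 = real (s + 1) * (ln (2 * Bm + 5) + \<alpha>) + (2 * R + 1) * real (s + 1) * ln (2 * real_of_int Q + 1)"
  define K where "K = K1 + (real s + 1 + 2 * L)"
  have lnB: "0 \<le> ln (2 * Bm + 5)" using Bm by simp
  have lnQ: "0 \<le> ln (2 * real_of_int Q + 1)" using Q0 by simp
  have \<alpha>0: "0 < \<alpha>" using \<alpha> \<gamma> by simp
  have K1: "0 \<le> K1" unfolding K1_def using lnB lnQ \<alpha>0 R by (intro add_nonneg_nonneg mult_nonneg_nonneg) auto
  show ?thesis
  proof (rule that[of K])
    show "0 < K" using K1 L by (simp add: K_def)
    fix \<delta> :: real assume \<delta>: "0 < \<delta>" "\<delta> \<le> 1"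
    define m where "m = nat \<lceil>2 * R / \<delta>\<rceil>"
    have m: "2 * R / \<delta> \<le> real m" "real m \<le> 2 * R / \<delta> + 1"
    proof -
      have "0 \<le> 2 * R / \<delta>" using R \<delta> by simp
      then show "2 * R / \<delta> \<le> real m" "real m \<le> 2 * R / \<delta> + 1" unfolding m_def by linarith+
    qed
    define x where "x i = - R + real i * \<delta>" for i
    \<comment> \<open>The rounding unit of the \<open>k\<close>-th derivative. By \<open>qd\<close>
      an error of one unit in any derivative costs the same \<open>\<delta> powr \<alpha>\<close> in
      the function one mesh width away, and in these units powers of \<open>\<delta>\<close> vanish
      from Taylor's formula.\<close>
    define q where "q k = \<delta> powr (\<alpha> - real k)" for k
    have q: "0 < q k" for k using \<delta> by (simp add: q_def)
    have qd: "q (k + l) * \<delta> ^ l = q k" for k l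
      using \<delta> by (simp add: q_def powr_realpow[symmetric] powr_add[symmetric])
    define G where "G g i k = (deriv ^^ k) g (x i) / q k" for g i k
    define A where "A g i k = \<lfloor>G g i k\<rfloor>" for g i k
    \<comment> \<open>The Taylor prediction for the next grid point, computed from rounded data
      alone so that a decoder can reproduce it.\<close>
    define Pr where "Pr a k = \<lfloor>\<Sum>l\<le>s - k. real_of_int (a (k + l)) / fact l\<rfloor>" for a :: "nat \<Rightarrow> int" and k
    define N where "N = \<lceil>Bm * \<delta> powr (- \<alpha>)\<rceil> + 1"
    \<comment> \<open>Absolute values are recorded at the first grid point, prediction errors at all
      later ones.\<close>
    define F where "F g = restrict (\<lambda>(i, k). case i of 0 \<Rightarrow> A g 0 k | Suc i' \<Rightarrow> A g i k - Pr (A g i') k) ({..m} \<times> {..s})" for g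
    define C where "C = (\<Pi>\<^sub>E ik\<in>{..m} \<times> {..s}. if fst ik = 0 then {- N..N} else {- Q..Q})"
    have step: "\<bar>G g (Suc i) k - (\<Sum>l\<le>s - k. G g i (k + l) / fact l)\<bar> \<le> L"
      if g: "g \<in> hoelder_class s \<gamma> L B" and k: "k \<le> s" for g i k
    proof -
      have xs: "x (Suc i) - x i = \<delta>" by (simp add: x_def algebra_simps)
      have "\<bar>(deriv ^^ k) g (x (Suc i)) - (\<Sum>l\<le>s - k. (deriv ^^ (k + l)) g (x i) / fact l * \<delta> ^ l)\<bar>
         \<le> L * \<delta> powr (real (s - k) + \<gamma>)"
        using hoelder_class_taylor[OF g k, of "x i" "x (Suc i)"] \<gamma> L \<delta> xs by simp
      also have "real (s - k) + \<gamma> = \<alpha> - real k" using k by (simp add: \<alpha>)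
      finally have "\<bar>(deriv ^^ k) g (x (Suc i)) - (\<Sum>l\<le>s - k. (deriv ^^ (k + l)) g (x i) / fact l * \<delta> ^ l)\<bar> / q k \<le> L"
        using q[of k] by (simp add: pos_divide_le_eq q_def)
      moreover have "\<bar>(deriv ^^ k) g (x (Suc i)) - (\<Sum>l\<le>s - k. (deriv ^^ (k + l)) g (x i) / fact l * \<delta> ^ l)\<bar> / q k
         = \<bar>G g (Suc i) k - (\<Sum>l\<le>s - k. G g i (k + l) / fact l)\<bar>"
      proof -
        have "(deriv ^^ (k + l)) g (x i) / fact l * \<delta> ^ l / q k = G g i (k + l) / fact l" for l
          using q[of "k + l"] \<delta> unfolding G_def qd[of k l, symmetric] by simp
        then have "(\<Sum>l\<le>s - k. (deriv ^^ (k + l)) g (x i) / fact l * \<delta> ^ l) / q k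
            = (\<Sum>l\<le>s - k. G g i (k + l) / fact l)"
          by (simp add: sum_divide_distrib)
        then have "((deriv ^^ k) g (x (Suc i)) - (\<Sum>l\<le>s - k. (deriv ^^ (k + l)) g (x i) / fact l * \<delta> ^ l)) / q k
            = G g (Suc i) k - (\<Sum>l\<le>s - k. G g i (k + l) / fact l)"
          by (simp add: diff_divide_distrib G_def[of g "Suc i"])
        from arg_cong[OF this, of abs] show ?thesis using q[of k] by (simp only: abs_divide abs_of_pos)
      qed
      ultimately show ?thesis by simp
    qed
    show "has_net (hoelder_class s \<gamma> L B) (\<lambda>g g'. \<forall>z\<in>{-R..R}. \<bar>g z - g' z\<bar> \<le> K * \<delta> powr \<alpha>) (exp (K / \<delta>))"
    proof (rule has_net_code[where F = F and C = C])
      show "finite C" unfolding C_def by (intro finite_PiE) auto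
      fix g assume g: "g \<in> hoelder_class s \<gamma> L B"
      have b: "\<bar>(deriv ^^ k) g z\<bar> \<le> Bm" if "k \<le> s" for k z
      proof -
        have "\<bar>(deriv ^^ k) g z\<bar> \<le> B k" using g that by (simp add: hoelder_class_def)
        then show ?thesis using Bm(2)[OF that] by linarith
      qed
      have init: "A g 0 k \<in> {- N..N}" if k: "k \<le> s" for k
      proof -
        have "\<bar>G g 0 k\<bar> = \<bar>(deriv ^^ k) g (x 0)\<bar> * \<delta> powr (- (\<alpha> - real k))"
          using \<delta> by (simp add: G_def q_def abs_mult divide_inverse powr_minus[symmetric])
        also have "\<dots> \<le> Bm * \<delta> powr (- \<alpha>)"
          using b[OF k] \<delta> Bm by (intro mult_mono powr_mono') auto
        finally have "\<bar>G g 0 k\<bar> \<le> Bm * \<delta> powr (- \<alpha>)" .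
        then show ?thesis unfolding A_def N_def by (auto; linarith)
      qed
      have incr: "A g (Suc i) k - Pr (A g i) k \<in> {- Q..Q}" if k: "k \<le> s" for i k
      proof -
        have "\<bar>(\<Sum>l\<le>s - k. G g i (k + l) / fact l) - (\<Sum>l\<le>s - k. real_of_int (A g i (k + l)) / fact l)\<bar>
           \<le> (\<Sum>l\<le>s - k. \<bar>G g i (k + l) / fact l - real_of_int (A g i (k + l)) / fact l\<bar>)"
          unfolding sum_subtractf[symmetric] by (rule sum_abs)
        also have "\<dots> \<le> (\<Sum>l\<le>s - k. 1)"
        proof (rule sum_mono)
          fix l
          have "\<bar>G g i (k + l) - real_of_int (A g i (k + l))\<bar> \<le> 1" unfolding A_def by linarith
          then have "\<bar>G g i (k + l) - real_of_int (A g i (k + l))\<bar> / fact l \<le> 1 / 1"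
            by (intro frac_le) (auto simp: fact_ge_1)
          then show "\<bar>G g i (k + l) / fact l - real_of_int (A g i (k + l)) / fact l\<bar> \<le> 1"
            by (simp add: diff_divide_distrib[symmetric])
        qed
        also have "\<dots> \<le> real s + 1" using k by simp
        finally have "\<bar>G g (Suc i) k - (\<Sum>l\<le>s - k. real_of_int (A g i (k + l)) / fact l)\<bar> \<le> L + (real s + 1)"
          using step[OF g k, of i] by linarith
        then show ?thesis unfolding A_def[of g "Suc i"] Pr_def Q_def by (auto; linarith)
      qed
      show "F g \<in> C"
        unfolding F_def C_def
        by (rule restrict_PiE_iff[THEN iffD2]) (use init incr in \<open>auto split: nat.split\<close>)
    next
      fix g g' assume g: "g \<in> hoelder_class s \<gamma> L B" and g': "g' \<in> hoelder_class s \<gamma> L B" and eq: "F g = F g'"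
      \<comment> \<open>Decoding: equal data at a grid point give equal predictions for the next,
        and equal recorded errors then give equal data there.\<close>
      have same: "\<forall>k\<le>s. A g i k = A g' i k" if "i \<le> m" for i
        using that
      proof (induction i)
        case 0
        show ?case
        proof (intro allI impI)
          fix k assume "k \<le> s"
          then show "A g 0 k = A g' 0 k" using fun_cong[OF eq, of "(0, k)"] by (simp add: F_def)
        qed
      next
        case (Suc i)
        show ?case
        proof (intro allI impI)
          fix k assume k: "k \<le> s"
          have "Pr (A g i) k = Pr (A g' i) k"
            unfolding Pr_def using Suc k by (intro arg_cong[where f = floor] sum.cong) auto
          then show "A g (Suc i) k = A g' (Suc i) k"
            using fun_cong[OF eq, of "(Suc i, k)"] k Suc(2) by (simp add: F_def)
        qed
      qed
      show "\<forall>z\<in>{-R..R}. \<bar>g z - g' z\<bar> \<le> K * \<delta> powr \<alpha>"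
      proof
        fix z assume z: "z \<in> {-R..R}"
        \<comment> \<open>The last grid point not to the right of \<open>z\<close>.\<close>
        define i where "i = nat \<lfloor>(z + R) / \<delta>\<rfloor>"
        have zR: "0 \<le> (z + R) / \<delta>" using z \<delta> by simp
        have i1: "real i \<le> (z + R) / \<delta>" "(z + R) / \<delta> < real i + 1"
          using zR unfolding i_def by linarith+
        have "(z + R) / \<delta> \<le> 2 * R / \<delta>" using z \<delta> by (intro divide_right_mono) auto
        then have im: "i \<le> m" using i1(1) m(1) by linarith
        have xi: "x i \<le> z" "z - x i \<le> \<delta>"
          using i1 \<delta> by (auto simp: x_def field_simps)
        define h where "h = z - x i"
        have h: "0 \<le> h" "h \<le> \<delta>" using xi by (auto simp: h_def)
        have T: "\<bar>u z - (\<Sum>l\<le>s. (deriv ^^ l) u (x i) / fact l * h ^ l)\<bar> \<le> L * \<delta> powr \<alpha>"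
          if u: "u \<in> hoelder_class s \<gamma> L B" for u
        proof -
          have "\<bar>u z - (\<Sum>l\<le>s. (deriv ^^ l) u (x i) / fact l * h ^ l)\<bar> \<le> L * h powr \<alpha>"
            using hoelder_class_taylor[OF u le0 xi(1) \<gamma> L] by (simp add: h_def \<alpha>)
          also have "\<dots> \<le> L * \<delta> powr \<alpha>" using h L \<alpha>0 by (intro mult_left_mono powr_mono2) auto
          finally show ?thesis .
        qed
        have "\<bar>(\<Sum>l\<le>s. (deriv ^^ l) g (x i) / fact l * h ^ l) - (\<Sum>l\<le>s. (deriv ^^ l) g' (x i) / fact l * h ^ l)\<bar>
            \<le> (\<Sum>l\<le>s. \<bar>(deriv ^^ l) g (x i) / fact l * h ^ l - (deriv ^^ l) g' (x i) / fact l * h ^ l\<bar>)"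
          unfolding sum_subtractf[symmetric] by (rule sum_abs)
        also have "\<dots> \<le> (\<Sum>l\<le>s. \<delta> powr \<alpha>)"
        proof (rule sum_mono)
          fix l assume "l \<in> {..s}"
          then have l: "l \<le> s" by simp
          have "\<bar>G g i l - G g' i l\<bar> \<le> 1"
            using same[OF im, rule_format, OF l] unfolding A_def by linarith
          then have "\<bar>(deriv ^^ l) g (x i) - (deriv ^^ l) g' (x i)\<bar> \<le> q l"
            using q[of l] by (simp add: G_def diff_divide_distrib[symmetric] abs_divide)
          then have "\<bar>(deriv ^^ l) g (x i) - (deriv ^^ l) g' (x i)\<bar> / fact l * h ^ l \<le> q l / 1 * \<delta> ^ l"
            using h q[of l] by (intro mult_mono frac_le power_mono) (auto simp: fact_ge_1)
          also have "\<dots> = \<delta> powr \<alpha>" using qd[of 0 l] by (simp add: q_def)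
          finally show "\<bar>(deriv ^^ l) g (x i) / fact l * h ^ l - (deriv ^^ l) g' (x i) / fact l * h ^ l\<bar> \<le> \<delta> powr \<alpha>"
            using h by (simp add: left_diff_distrib[symmetric] diff_divide_distrib[symmetric] abs_mult)
        qed
        also have "\<dots> = (real s + 1) * \<delta> powr \<alpha>" by (simp add: algebra_simps)
        finally have "\<bar>g z - g' z\<bar> \<le> (real s + 1) * \<delta> powr \<alpha> + L * \<delta> powr \<alpha> + L * \<delta> powr \<alpha>"
          using T[OF g] T[OF g'] by linarith
        also have "\<dots> = (real s + 1 + 2 * L) * \<delta> powr \<alpha>" by (simp add: algebra_simps)
        also have "\<dots> \<le> K * \<delta> powr \<alpha>" using K1 by (intro mult_right_mono) (auto simp: K_def)
        finally show "\<bar>g z - g' z\<bar> \<le> K * \<delta> powr \<alpha>" .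
      qed
    next
      have "0 \<le> Bm * \<delta> powr (- \<alpha>)" using Bm by simp
      then have N0: "1 \<le> N" unfolding N_def by linarith
      have "card C = (\<Prod>ik\<in>{..m} \<times> {..s}. card (if fst ik = 0 then {- N..N} else {- Q..Q}))"
        unfolding C_def by (rule card_PiE) auto
      also have "\<dots> = (\<Prod>i\<le>m. \<Prod>k\<le>s. card (if i = 0 then {- N..N} else {- Q..Q}))"
        unfolding prod.cartesian_product by (intro prod.cong) auto
      also have "\<dots> = (\<Prod>i\<le>m. (if i = 0 then nat (2 * N + 1) else nat (2 * Q + 1)) ^ (s + 1))"
        by (intro prod.cong refl) (simp add: algebra_simps)
      also have "\<dots> = nat (2 * N + 1) ^ (s + 1) * (nat (2 * Q + 1) ^ (s + 1)) ^ m"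
        unfolding lessThan_Suc_atMost[symmetric] prod.lessThan_Suc_shift by simp
      finally have "real (card C) = (2 * real_of_int N + 1) ^ (s + 1) * ((2 * real_of_int Q + 1) ^ (s + 1)) ^ m"
        using N0 Q0 by (simp only: of_nat_mult of_nat_power of_nat_nat) (simp add: of_nat_nat)
      then have "ln (real (card C)) = real (s + 1) * ln (2 * real_of_int N + 1) + real m * (real (s + 1) * ln (2 * real_of_int Q + 1))"
      proof -
        have "ln (u ^ b * (v ^ b) ^ m) = real b * ln u + real m * (real b * ln v)" if "0 < u" "0 < v" for u v :: real and b
          using that by (simp add: ln_mult ln_realpow)
        from this[of "2 * real_of_int N + 1" "2 * real_of_int Q + 1" "s + 1"] N0 Q0
        show ?thesis by (simp only: \<open>real (card C) = _\<close>)
      qed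
      \<comment> \<open>The first grid point contributes the logarithm of a power of
        \<open>1 / \<delta>\<close>, which is at most a multiple of \<open>1 / \<delta>\<close>;
        each later one contributes a constant, and there are at most
        \<open>(2 * R + 1) / \<delta>\<close> of them.\<close>
      also have "\<dots> \<le> real (s + 1) * ((ln (2 * Bm + 5) + \<alpha>) / \<delta>) + ((2 * R + 1) / \<delta>) * (real (s + 1) * ln (2 * real_of_int Q + 1))"
      proof (intro add_mono mult_left_mono mult_right_mono)
        have d1: "1 \<le> \<delta> powr (- \<alpha>)" using \<delta> \<alpha>0 powr_mono'[of "- \<alpha>" 0 \<delta>] by simp
        have "real_of_int N \<le> Bm * \<delta> powr (- \<alpha>) + 2" unfolding N_def by linarith
        then have "2 * real_of_int N + 1 \<le> (2 * Bm + 5) * \<delta> powr (- \<alpha>)" using d1 by (simp add: algebra_simps)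
        then have "ln (2 * real_of_int N + 1) \<le> ln ((2 * Bm + 5) * \<delta> powr (- \<alpha>))"
          using N0 by (subst ln_le_cancel_iff) (use \<delta> Bm in auto)
        also have "\<dots> = ln (2 * Bm + 5) + \<alpha> * ln (1 / \<delta>)"
          using \<delta> Bm by (simp add: ln_mult ln_powr ln_div)
        also have "\<dots> \<le> ln (2 * Bm + 5) / \<delta> + \<alpha> * (1 / \<delta>)"
        proof (intro add_mono mult_left_mono ln_inverse_le \<delta>)
          show "ln (2 * Bm + 5) \<le> ln (2 * Bm + 5) / \<delta>"
            using \<delta> lnB by (simp add: pos_le_divide_eq mult_left_le)
        qed (use \<alpha>0 in auto)
        finally show "ln (2 * real_of_int N + 1) \<le> (ln (2 * Bm + 5) + \<alpha>) / \<delta>" by (simp add: add_divide_distrib)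
        have "1 \<le> 1 / \<delta>" using \<delta> by simp
        then show "real m \<le> (2 * R + 1) / \<delta>" using m(2) by (simp add: add_divide_distrib)
      qed (use lnQ in auto)
      also have "\<dots> = K1 / \<delta>" using \<delta> by (simp add: K1_def field_simps)
      also have "\<dots> \<le> K / \<delta>" using \<delta> L by (intro divide_right_mono) (auto simp: K_def)
      finally have lnC: "ln (real (card C)) \<le> K / \<delta>" .
      show "real (card C) \<le> exp (K / \<delta>)"
      proof (cases "card C = 0")
        case False
        then have "real (card C) = exp (ln (real (card C)))" by simp
        also have "\<dots> \<le> exp (K / \<delta>)" using lnC by simp
        finally show ?thesis .
      qed simp
    qed
  qed
qed

text \<open>Rounding of coordinates needs a number of codes polynomial in
  \<open>1 / \<delta>\<close>; the much weaker form \<open>exp (K / \<delta>)\<close> matches the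
  Hoelder net. \<open>D\<close> will be the dimension, so that inner products with points of the
  cube move by at most \<open>\<delta> powr a\<close>.\<close>

lemma box_net:
  fixes G :: "(real ^ 'd::finite) set"
  assumes G: "\<And>c i. c \<in> G \<Longrightarrow> \<bar>c $ i\<bar> \<le> C" and C: "0 \<le> C" and a: "0 \<le> a" and D: "1 \<le> D"
  obtains K where "0 \<le> K" "\<And>\<delta>. 0 < \<delta> \<Longrightarrow> \<delta> \<le> 1 \<Longrightarrow>
     has_net G (\<lambda>c c'. \<forall>i. \<bar>c $ i - c' $ i\<bar> \<le> \<delta> powr a / D) (exp (K / \<delta>))"
proof -
  define K where "K = real CARD('d) * (ln (2 * (C * D) + 5) + a)"
  have CD: "0 \<le> C * D" using C D by simp
  have lnC: "0 \<le> ln (2 * (C * D) + 5)" using CD by simp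
  show ?thesis
  proof (rule that[of K])
    show "0 \<le> K" unfolding K_def using lnC a by simp
    fix \<delta> :: real assume \<delta>: "0 < \<delta>" "\<delta> \<le> 1"
    define \<eta> where "\<eta> = \<delta> powr a / D"
    have \<eta>: "0 < \<eta>" using \<delta> D by (simp add: \<eta>_def)
    define N where "N = \<lceil>C / \<eta>\<rceil> + 1"
    have "0 \<le> C / \<eta>" using C \<eta> by simp
    then have N0: "1 \<le> N" unfolding N_def by linarith
    let ?C = "(\<Pi>\<^sub>E i\<in>(UNIV :: 'd set). {- N..N})"
    have "has_net G (\<lambda>c c'. \<forall>i. \<bar>c $ i - c' $ i\<bar> \<le> \<eta>) (exp (K / \<delta>))"
    proof (rule has_net_code[where F = "\<lambda>c i. \<lfloor>c $ i / \<eta>\<rfloor>" and C = ?C])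
      show "finite ?C" by (intro finite_PiE) auto
      show "(\<lambda>i. \<lfloor>c $ i / \<eta>\<rfloor>) \<in> ?C" if "c \<in> G" for c
      proof (rule PiE_I)
        fix i
        have "\<bar>c $ i / \<eta>\<bar> \<le> C / \<eta>" using G[OF that, of i] \<eta> by (simp add: abs_divide divide_right_mono)
        then show "\<lfloor>c $ i / \<eta>\<rfloor> \<in> {- N..N}" unfolding N_def by (auto; linarith)
      qed simp
      show "\<forall>i. \<bar>c $ i - c' $ i\<bar> \<le> \<eta>" if eq: "(\<lambda>i. \<lfloor>c $ i / \<eta>\<rfloor>) = (\<lambda>i. \<lfloor>c' $ i / \<eta>\<rfloor>)" for c c' :: "real ^ 'd"
      proof
        fix i
        have "\<bar>c $ i / \<eta> - c' $ i / \<eta>\<bar> \<le> 1" using fun_cong[OF eq, of i] by linarith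
        then show "\<bar>c $ i - c' $ i\<bar> \<le> \<eta>" using \<eta> by (simp add: diff_divide_distrib[symmetric] abs_divide)
      qed
      have "real (card ?C) = (2 * real_of_int N + 1) ^ CARD('d)"
        using N0 by (simp add: card_PiE)
      then have "ln (real (card ?C)) = real CARD('d) * ln (2 * real_of_int N + 1)"
        using N0 by (simp add: ln_realpow)
      also have "\<dots> \<le> real CARD('d) * ((ln (2 * (C * D) + 5) + a) / \<delta>)"
      proof (intro mult_left_mono)
        have d1: "1 \<le> \<delta> powr (- a)" using \<delta> a powr_mono'[of "- a" 0 \<delta>] by simp
        have "C / \<eta> = C * D * \<delta> powr (- a)" using \<delta> D by (simp add: \<eta>_def powr_minus divide_inverse)
        then have "real_of_int N \<le> C * D * \<delta> powr (- a) + 2" unfolding N_def by linarith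
        then have "2 * real_of_int N + 1 \<le> (2 * (C * D) + 5) * \<delta> powr (- a)" using d1 by (simp add: algebra_simps)
        then have "ln (2 * real_of_int N + 1) \<le> ln ((2 * (C * D) + 5) * \<delta> powr (- a))"
          using N0 by (subst ln_le_cancel_iff) (use \<delta> CD in auto)
        also have "\<dots> = ln (2 * (C * D) + 5) + a * ln (1 / \<delta>)"
          using \<delta> CD by (simp add: ln_mult ln_powr ln_div)
        also have "\<dots> \<le> ln (2 * (C * D) + 5) / \<delta> + a * (1 / \<delta>)"
        proof (intro add_mono mult_left_mono ln_inverse_le \<delta>)
          show "ln (2 * (C * D) + 5) \<le> ln (2 * (C * D) + 5) / \<delta>"
            using \<delta> lnC by (simp add: pos_le_divide_eq mult_left_le)
        qed (use a in auto)
        finally show "ln (2 * real_of_int N + 1) \<le> (ln (2 * (C * D) + 5) + a) / \<delta>" by (simp add: add_divide_distrib)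
      qed simp
      also have "\<dots> = K / \<delta>" by (simp add: K_def)
      finally have ln: "ln (real (card ?C)) \<le> K / \<delta>" .
      show "real (card ?C) \<le> exp (K / \<delta>)"
      proof (cases "card ?C = 0")
        case False
        then have "real (card ?C) = exp (ln (real (card ?C)))" by simp
        also have "\<dots> \<le> exp (K / \<delta>)" using ln by simp
        finally show ?thesis .
      qed simp
    qed
    then show "has_net G (\<lambda>c c'. \<forall>i. \<bar>c $ i - c' $ i\<bar> \<le> \<delta> powr a / D) (exp (K / \<delta>))"
      by (simp add: \<eta>_def)
  qed
qed

section \<open>Upper bound\<close>

text \<open>For \<open>s > 0\<close> the members are Lipschitz with constant \<open>B 1\<close>,
  which is weakened to exponent \<open>\<gamma>\<close> to treat all \<open>s\<close> alike. The
  loss is harmless: directions are then rounded at scale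
  \<open>\<delta> powr (\<alpha> / \<gamma>)\<close>, still polynomial in
  \<open>\<delta>\<close>.\<close>

lemma hoelder_class_modulus:
  assumes g: "g \<in> hoelder_class s \<gamma> L B" and \<gamma>: "0 < \<gamma>" "\<gamma> \<le> 1" and L: "0 \<le> L" and uv: "\<bar>u - v\<bar> \<le> 1"
  shows "\<bar>g u - g v\<bar> \<le> (L + \<bar>B 1\<bar>) * \<bar>u - v\<bar> powr \<gamma>"
proof (cases "s = 0")
  case True
  then have "\<bar>g u - g v\<bar> \<le> L * \<bar>u - v\<bar> powr \<gamma>" using g by (simp add: hoelder_class_def)
  also have "\<dots> \<le> (L + \<bar>B 1\<bar>) * \<bar>u - v\<bar> powr \<gamma>" by (intro mult_right_mono) auto
  finally show ?thesis .
next
  case False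
  have b: "\<bar>(deriv ^^ 1) g z\<bar> \<le> B 1" for z
    using g False unfolding hoelder_class_def by (metis (mono_tags, lifting) One_nat_def Suc_leI mem_Collect_eq neq0_conv)
  have "norm (g u - g v) \<le> B 1 * norm (u - v)"
  proof (rule field_differentiable_bound[where S = UNIV and f' = "deriv g"])
    show "(g has_real_derivative deriv g z) (at z within UNIV)" for z
      using hoelder_class_deriv[OF g, of 0] False by simp
    show "norm (deriv g z) \<le> B 1" for z using b[of z] by simp
  qed auto
  then have "\<bar>g u - g v\<bar> \<le> B 1 * \<bar>u - v\<bar>" by simp
  also have "\<dots> \<le> (L + \<bar>B 1\<bar>) * \<bar>u - v\<bar> powr \<gamma>"
  proof (intro mult_mono)
    show "\<bar>u - v\<bar> \<le> \<bar>u - v\<bar> powr \<gamma>"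
      using uv \<gamma> powr_mono'[of \<gamma> 1 "\<bar>u - v\<bar>"] by simp
  qed (use L in auto)
  finally show ?thesis .
qed

lemma abs_inner_cube_le:
  fixes v x :: "real ^ 'd::finite"
  assumes v: "\<And>i. \<bar>v $ i\<bar> \<le> \<eta>" and x: "x \<in> cbox 0 1"
  shows "\<bar>v \<bullet> x\<bar> \<le> real CARD('d) * \<eta>"
proof -
  have "\<bar>v \<bullet> x\<bar> = \<bar>\<Sum>i\<in>UNIV. v $ i * x $ i\<bar>" by (simp add: inner_vec_def)
  also have "\<dots> \<le> (\<Sum>i\<in>UNIV. \<bar>v $ i * x $ i\<bar>)" by (rule sum_abs)
  also have "\<dots> \<le> (\<Sum>i\<in>(UNIV :: 'd set). \<eta>)"
  proof (rule sum_mono)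
    fix i
    have "0 \<le> x $ i" "x $ i \<le> 1" using x by (auto simp: mem_box_cart)
    then have "\<bar>v $ i\<bar> * \<bar>x $ i\<bar> \<le> \<eta> * 1" using v[of i] by (intro mult_mono) auto
    then show "\<bar>v $ i * x $ i\<bar> \<le> \<eta>" by (simp add: abs_mult)
  qed
  finally show ?thesis by simp
qed

lemma multi_index_class_bounded:
  assumes "\<mu> \<in> multi_index_class p s \<gamma> L B"
  shows "\<bar>\<mu> x\<bar> \<le> real p * B 0"
proof -
  from assms obtain g b where \<mu>: "\<mu> = (\<lambda>x. \<Sum>i<p. g i (b i \<bullet> x))" and g: "\<And>i. i < p \<Longrightarrow> g i \<in> hoelder_class s \<gamma> L B"
    by (auto simp: multi_index_class_def)
  have "\<bar>g i z\<bar> \<le> B 0" if "i < p" for i z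
  proof -
    have "\<bar>(deriv ^^ 0) (g i) z\<bar> \<le> B 0" using g[OF that] unfolding hoelder_class_def by blast
    then show ?thesis by simp
  qed
  then have "\<bar>\<mu> x\<bar> \<le> (\<Sum>i<p. B 0)"
    unfolding \<mu> by (intro order_trans[OF sum_abs] sum_mono) auto
  then show ?thesis by simp
qed

text \<open>The approximants need not lie in \<open>Q\<close>: net functions may be constant and
  rounded directions may coincide. Continuity and the common bound are what the candidates of the
  aggregation must satisfy.\<close>

definition uniform_net :: "(real ^ 'd::finite \<Rightarrow> real) set \<Rightarrow> (real ^ 'd \<Rightarrow> real) set \<Rightarrow> real \<Rightarrow> real \<Rightarrow> bool" where
  "uniform_net Q M b e \<longleftrightarrow>
     finite M \<and> (\<forall>m\<in>M. continuous_on UNIV m \<and> (\<forall>x. \<bar>m x\<bar> \<le> b)) \<and>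
     (\<forall>\<mu>\<in>Q. \<exists>m\<in>M. \<forall>x\<in>cbox 0 1. \<bar>\<mu> x - m x\<bar> \<le> e)"

text \<open>In each summand the direction is replaced first, at the cost of the modulus of
  \<open>g i\<close>, and then \<open>g i\<close> by a net function on \<open>[-?D, ?D]\<close>,
  which contains all inner products of net directions with points of the cube. The entropies of
  \<open>p\<close> functions and \<open>p\<close> directions add up.\<close>

lemma multi_index_approximation:
  fixes B :: "nat \<Rightarrow> real"
  assumes \<gamma>: "0 < \<gamma>" "\<gamma> \<le> 1" and L: "0 \<le> L" and \<alpha>: "\<alpha> = real s + \<gamma>"
  obtains K where "0 < K" "\<And>\<delta>. 0 < \<delta> \<Longrightarrow> \<delta> \<le> 1 \<Longrightarrow>
    \<exists>M. uniform_net (multi_index_class p s \<gamma> L B :: (real ^ 'd::finite \<Rightarrow> real) set) M (real p * B 0) (K * \<delta> powr \<alpha>)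
      \<and> real (card M) \<le> exp (K / \<delta>)"
proof -
  let ?D = "real CARD('d)"
  have D: "1 \<le> ?D" by (simp add: Suc_leI)
  have \<alpha>0: "0 < \<alpha>" using \<alpha> \<gamma> by simp
  obtain K1 where K1: "0 < K1" and net1: "\<And>\<delta>. 0 < \<delta> \<Longrightarrow> \<delta> \<le> 1 \<Longrightarrow>
     has_net (hoelder_class s \<gamma> L B) (\<lambda>g g'. \<forall>z\<in>{-?D..?D}. \<bar>g z - g' z\<bar> \<le> K1 * \<delta> powr \<alpha>) (exp (K1 / \<delta>))"
    using hoelder_class_net[OF \<gamma>(1) L _ \<alpha>, of ?D B] D by auto
  define U where "U = {b :: real ^ 'd. norm b = 1}"
  have Ub: "\<bar>b $ i\<bar> \<le> 1" if "b \<in> U" for b i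
    using that component_le_norm_cart[of b i] by (simp add: U_def)
  obtain K2 where K2: "0 \<le> K2" and net2: "\<And>\<delta>. 0 < \<delta> \<Longrightarrow> \<delta> \<le> 1 \<Longrightarrow>
     has_net U (\<lambda>c c'. \<forall>i. \<bar>c $ i - c' $ i\<bar> \<le> \<delta> powr (\<alpha> / \<gamma>) / ?D) (exp (K2 / \<delta>))"
    using box_net[where G = U and C = 1 and a = "\<alpha> / \<gamma>" and D = ?D, OF Ub] D \<alpha>0 \<gamma> by auto
  define \<Lambda> where "\<Lambda> = L + \<bar>B 1\<bar>"
  define K where "K = real p * (K1 + K2) + real p * (K1 + \<Lambda>) + 1"
  have \<Lambda>: "0 \<le> \<Lambda>" using L by (simp add: \<Lambda>_def)
  show ?thesis
  proof (rule that[of K])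
    show "0 < K" unfolding K_def using K1 K2 \<Lambda> by (intro add_nonneg_pos add_nonneg_nonneg) auto
    fix \<delta> :: real assume \<delta>: "0 < \<delta>" "\<delta> \<le> 1"
    obtain AH where AH: "AH \<subseteq> hoelder_class s \<gamma> L B" "finite AH" "real (card AH) \<le> exp (K1 / \<delta>)"
      "\<forall>g\<in>hoelder_class s \<gamma> L B. \<exists>a\<in>AH. \<forall>z\<in>{-?D..?D}. \<bar>g z - a z\<bar> \<le> K1 * \<delta> powr \<alpha>"
      using net1[OF \<delta>] unfolding has_net_def by blast
    obtain AU where AU: "AU \<subseteq> U" "finite AU" "real (card AU) \<le> exp (K2 / \<delta>)"
      "\<forall>b\<in>U. \<exists>b'\<in>AU. \<forall>i. \<bar>b $ i - b' $ i\<bar> \<le> \<delta> powr (\<alpha> / \<gamma>) / ?D"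
      using net2[OF \<delta>] unfolding has_net_def by blast
    define X where "X = (\<Pi>\<^sub>E i\<in>{..<p}. AH) \<times> (\<Pi>\<^sub>E i\<in>{..<p}. AU)"
    define mk where "mk ab x = (\<Sum>i<p. fst ab i (snd ab i \<bullet> x))" for ab :: "(nat \<Rightarrow> real \<Rightarrow> real) \<times> (nat \<Rightarrow> real ^ 'd)" and x
    have finX: "finite X" unfolding X_def using AH AU by (intro finite_cartesian_product finite_PiE) auto
    show "\<exists>M. uniform_net (multi_index_class p s \<gamma> L B :: (real ^ 'd::finite \<Rightarrow> real) set) M (real p * B 0) (K * \<delta> powr \<alpha>)
      \<and> real (card M) \<le> exp (K / \<delta>)"
      unfolding uniform_net_def
    proof (intro exI[of _ "mk ` X"] conjI ballI)
      show "finite (mk ` X)" using finX by simp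
      have "real (card (mk ` X)) \<le> real (card X)" using card_image_le[OF finX] by simp
      also have "\<dots> = real (card AH) ^ p * real (card AU) ^ p"
        by (simp add: X_def card_cartesian_product card_PiE)
      also have "\<dots> \<le> exp (K1 / \<delta>) ^ p * exp (K2 / \<delta>) ^ p"
        using AH AU by (intro mult_mono power_mono) auto
      also have "\<dots> = exp (real p * (K1 + K2) / \<delta>)"
        by (simp add: exp_of_nat_mult[symmetric] exp_add[symmetric] algebra_simps add_divide_distrib)
      also have "\<dots> \<le> exp (K / \<delta>)"
        using \<delta> K1 \<Lambda> by (auto simp: K_def intro!: divide_right_mono)
      finally show "real (card (mk ` X)) \<le> exp (K / \<delta>)" .
    next
      fix m assume "m \<in> mk ` X"
      then obtain a b where ab: "m = mk (a, b)" "a \<in> (\<Pi>\<^sub>E i\<in>{..<p}. AH)" by (auto simp: X_def)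
      then have aH: "a i \<in> hoelder_class s \<gamma> L B" if "i < p" for i using that AH(1) by (auto simp: PiE_def)
      show "continuous_on UNIV m"
        unfolding ab mk_def fst_conv snd_conv
      proof (rule continuous_on_sum)
        fix i assume "i \<in> {..<p}"
        then have "continuous_on UNIV (a i)" using hoelder_class_continuous[OF aH \<gamma>(1)] by simp
        then show "continuous_on UNIV (\<lambda>x. a i (b i \<bullet> x))"
          by (rule continuous_on_compose2) (auto intro!: continuous_on_inner continuous_on_const continuous_on_id)
      qed
      show "\<forall>x. \<bar>m x\<bar> \<le> real p * B 0"
      proof
        fix x
        have "\<bar>a i z\<bar> \<le> B 0" if "i < p" for i z
        proof -
          have "\<bar>(deriv ^^ 0) (a i) z\<bar> \<le> B 0" using aH[OF that] unfolding hoelder_class_def by blast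
          then show ?thesis by simp
        qed
        then have "\<bar>m x\<bar> \<le> (\<Sum>i<p. B 0)"
          unfolding ab mk_def fst_conv snd_conv by (intro order_trans[OF sum_abs] sum_mono) auto
        then show "\<bar>m x\<bar> \<le> real p * B 0" by simp
      qed
    next
      fix \<mu> :: "real ^ 'd \<Rightarrow> real" assume "\<mu> \<in> multi_index_class p s \<gamma> L B"
      then obtain g b where \<mu>: "\<mu> = (\<lambda>x. \<Sum>i<p. g i (b i \<bullet> x))" and g: "\<And>i. i < p \<Longrightarrow> g i \<in> hoelder_class s \<gamma> L B"
        and b: "\<And>i. i < p \<Longrightarrow> b i \<in> U"
        by (auto simp: multi_index_class_def U_def)
      have "\<forall>i. \<exists>a. i < p \<longrightarrow> a \<in> AH \<and> (\<forall>z\<in>{-?D..?D}. \<bar>g i z - a z\<bar> \<le> K1 * \<delta> powr \<alpha>)"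
        using g AH(4) by blast
      then obtain a where a: "\<And>i. i < p \<Longrightarrow> a i \<in> AH"
        "\<And>i z. i < p \<Longrightarrow> z \<in> {-?D..?D} \<Longrightarrow> \<bar>g i z - a i z\<bar> \<le> K1 * \<delta> powr \<alpha>" by metis
      have "\<forall>i. \<exists>b'. i < p \<longrightarrow> b' \<in> AU \<and> (\<forall>l. \<bar>b i $ l - b' $ l\<bar> \<le> \<delta> powr (\<alpha> / \<gamma>) / ?D)"
        using b AU(4) by blast
      then obtain b' where b': "\<And>i. i < p \<Longrightarrow> b' i \<in> AU"
        "\<And>i l. i < p \<Longrightarrow> \<bar>b i $ l - b' i $ l\<bar> \<le> \<delta> powr (\<alpha> / \<gamma>) / ?D" by metis
      show "\<exists>m\<in>mk ` X. \<forall>x\<in>cbox 0 1. \<bar>\<mu> x - m x\<bar> \<le> K * \<delta> powr \<alpha>"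
      proof (intro bexI[of _ "mk (restrict a {..<p}, restrict b' {..<p})"] ballI)
        show "mk (restrict a {..<p}, restrict b' {..<p}) \<in> mk ` X"
          unfolding X_def using a(1) b'(1) by (intro imageI SigmaI iffD2[OF restrict_PiE_iff]) auto
        fix x :: "real ^ 'd" assume x: "x \<in> cbox 0 1"
        have summand: "\<bar>g i (b i \<bullet> x) - a i (b' i \<bullet> x)\<bar> \<le> (K1 + \<Lambda>) * \<delta> powr \<alpha>" if i: "i < p" for i
        proof -
          have "\<bar>(b i - b' i) \<bullet> x\<bar> \<le> ?D * (\<delta> powr (\<alpha> / \<gamma>) / ?D)"
            using b'(2)[OF i] x by (intro abs_inner_cube_le) auto
          then have d: "\<bar>b i \<bullet> x - b' i \<bullet> x\<bar> \<le> \<delta> powr (\<alpha> / \<gamma>)" by (simp add: inner_diff_left)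
          have "\<delta> powr (\<alpha> / \<gamma>) \<le> \<delta> powr 0" using \<delta> \<alpha>0 \<gamma> by (intro powr_mono') auto
          then have d1: "\<bar>b i \<bullet> x - b' i \<bullet> x\<bar> \<le> 1" using d \<delta> by simp
          have "\<bar>g i (b i \<bullet> x) - g i (b' i \<bullet> x)\<bar> \<le> \<Lambda> * \<bar>b i \<bullet> x - b' i \<bullet> x\<bar> powr \<gamma>"
            unfolding \<Lambda>_def by (rule hoelder_class_modulus[OF g[OF i] \<gamma> L d1])
          also have "\<dots> \<le> \<Lambda> * (\<delta> powr (\<alpha> / \<gamma>)) powr \<gamma>"
            using d \<gamma> \<Lambda> by (intro mult_left_mono powr_mono2) auto
          also have "\<dots> = \<Lambda> * \<delta> powr \<alpha>" using \<gamma> by (simp add: powr_powr)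
          finally have 1: "\<bar>g i (b i \<bullet> x) - g i (b' i \<bullet> x)\<bar> \<le> \<Lambda> * \<delta> powr \<alpha>" .
          have "b' i \<in> U" using b'(1)[OF i] AU(1) by auto
          then have "\<bar>b' i \<bullet> x\<bar> \<le> ?D * 1" using Ub x by (intro abs_inner_cube_le) auto
          then have "b' i \<bullet> x \<in> {-?D..?D}" by auto
          from a(2)[OF i this] 1 show ?thesis unfolding distrib_right by linarith
        qed
        have "\<mu> x - mk (restrict a {..<p}, restrict b' {..<p}) x = (\<Sum>i<p. g i (b i \<bullet> x) - a i (b' i \<bullet> x))"
          unfolding \<mu> mk_def sum_subtractf[symmetric] by (intro sum.cong) auto
        then have "\<bar>\<mu> x - mk (restrict a {..<p}, restrict b' {..<p}) x\<bar> \<le> (\<Sum>i<p. \<bar>g i (b i \<bullet> x) - a i (b' i \<bullet> x)\<bar>)"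
          by (simp only: sum_abs)
        also have "\<dots> \<le> (\<Sum>i<p. (K1 + \<Lambda>) * \<delta> powr \<alpha>)" by (intro sum_mono summand) auto
        also have "\<dots> = real p * (K1 + \<Lambda>) * \<delta> powr \<alpha>" by simp
        also have "\<dots> \<le> K * \<delta> powr \<alpha>"
          using K1 K2 by (intro mult_right_mono) (auto simp: K_def)
        finally show "\<bar>\<mu> x - mk (restrict a {..<p}, restrict b' {..<p}) x\<bar> \<le> K * \<delta> powr \<alpha>" .
      qed
    qed
  qed
qed

section \<open>The error distribution function and its inverse\<close>

definition error_cdf :: "(real \<Rightarrow> real) \<Rightarrow> real \<Rightarrow> real" where
  "error_cdf f a = measure (lborel_density f) {..a}"

lemma
  assumes "regular_error f"
  shows error_cdf_mono: "mono (error_cdf f)"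
    and error_cdf_nonneg: "0 \<le> error_cdf f a"
    and error_cdf_le_1: "error_cdf f a \<le> 1"
    and error_cdf_borel: "error_cdf f \<in> borel_measurable borel"
proof -
  interpret prob_space "lborel_density f" using assms by (rule prob_space_regular_error)
  show m: "mono (error_cdf f)" unfolding error_cdf_def by (intro monoI finite_measure_mono) auto
  show "0 \<le> error_cdf f a" "error_cdf f a \<le> 1" by (auto simp: error_cdf_def prob_le_1)
  show "error_cdf f \<in> borel_measurable borel" by (rule borel_measurable_mono[OF m])
qed

lemma regular_error_continuous:
  assumes f: "regular_error f"
  shows "continuous_on UNIV f"
proof -
  obtain W where lip: "\<And>y y'. \<bar>y - y'\<bar> \<le> 1 \<Longrightarrow> \<bar>ln (f y) - ln (f y')\<bar> \<le> W y * \<bar>y - y'\<bar>"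
    using f unfolding regular_error_def by blast
  have "continuous_on UNIV (\<lambda>y. ln (f y))"
    unfolding continuous_on_def
  proof
    fix y
    have "((\<lambda>y'. W y * \<bar>y - y'\<bar>) \<longlongrightarrow> W y * \<bar>y - y\<bar>) (at y within UNIV)" by (intro tendsto_intros)
    then have lim: "((\<lambda>y'. W y * \<bar>y - y'\<bar>) \<longlongrightarrow> 0) (at y within UNIV)" by simp
    have "((\<lambda>y'. ln (f y') - ln (f y)) \<longlongrightarrow> 0) (at y within UNIV)"
    proof (rule Lim_null_comparison[OF _ lim])
      show "\<forall>\<^sub>F y' in at y within UNIV. norm (ln (f y') - ln (f y)) \<le> W y * \<bar>y - y'\<bar>"
        unfolding eventually_at using lip[of y]
        by (intro exI[of _ 1]) (auto simp: dist_real_def abs_minus_commute)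
    qed
    then show "((\<lambda>y. ln (f y)) \<longlongrightarrow> ln (f y)) (at y within UNIV)" using LIM_zero_iff by blast
  qed
  then have "continuous_on UNIV (\<lambda>y. exp (ln (f y)))" by (rule continuous_on_exp)
  then show ?thesis using regular_errorD(2)[OF f] by simp
qed

text \<open>A continuous positive density has a positive minimum and a finite maximum on a compact
  interval; these are the two constants.\<close>

lemma error_cdf_bi_Lipschitz:
  assumes f: "regular_error f" and A: "0 < A"
  obtains c M where "0 < c" "0 \<le> M"
    "\<And>a b. a \<in> {-A..A} \<Longrightarrow> b \<in> {-A..A} \<Longrightarrow> c * \<bar>a - b\<bar> \<le> \<bar>error_cdf f a - error_cdf f b\<bar>"
    "\<And>a b. a \<in> {-A..A} \<Longrightarrow> b \<in> {-A..A} \<Longrightarrow> \<bar>error_cdf f a - error_cdf f b\<bar> \<le> M * \<bar>a - b\<bar>"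
proof -
  interpret prob_space "lborel_density f" using f by (rule prob_space_regular_error)
  note [measurable] = regular_errorD(1)[OF f]
  have cont: "continuous_on {-A..A} f" using regular_error_continuous[OF f] by (rule continuous_on_subset) auto
  have ne: "{-A..A} \<noteq> {}" using A by simp
  obtain u where u: "u \<in> {-A..A}" "\<And>y. y \<in> {-A..A} \<Longrightarrow> f u \<le> f y"
    using continuous_attains_inf[OF compact_Icc ne cont] by blast
  obtain v where v: "v \<in> {-A..A}" "\<And>y. y \<in> {-A..A} \<Longrightarrow> f y \<le> f v"
    using continuous_attains_sup[OF compact_Icc ne cont] by blast
  have main: "f u * (b - a) \<le> error_cdf f b - error_cdf f a \<and> error_cdf f b - error_cdf f a \<le> f v * (b - a)"
    if ab: "a \<in> {-A..A}" "b \<in> {-A..A}" "a \<le> b" for a b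
  proof -
    have "{..b} = {..a} \<union> {a<..b}" using ab by auto
    then have "error_cdf f b = error_cdf f a + prob {a<..b}"
      unfolding error_cdf_def by (simp only:) (rule finite_measure_Union, auto)
    then have diff: "error_cdf f b - error_cdf f a = prob {a<..b}" by simp
    have em: "emeasure (lborel_density f) {a<..b} = (\<integral>\<^sup>+e. ennreal (f e) * indicator {a<..b} e \<partial>lborel)"
      by (intro emeasure_density) auto
    have len: "(\<integral>\<^sup>+e. ennreal k * indicator {a<..b} e \<partial>lborel) = ennreal (k * (b - a))" if "0 \<le> k" for k
      using ab that by (simp add: nn_integral_cmult ennreal_mult)
    have fu: "0 \<le> f u" "0 \<le> f v" using regular_errorD(3)[OF f] by auto
    have "ennreal (f u * (b - a)) \<le> emeasure (lborel_density f) {a<..b}"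
      unfolding em len[OF fu(1), symmetric] using ab u
      by (intro nn_integral_mono) (auto intro!: ennreal_leI split: split_indicator)
    then have 1: "f u * (b - a) \<le> prob {a<..b}" unfolding emeasure_eq_measure by (simp add: ennreal_le_iff)
    have "emeasure (lborel_density f) {a<..b} \<le> ennreal (f v * (b - a))"
      unfolding em len[OF fu(2), symmetric] using ab v
      by (intro nn_integral_mono) (auto intro!: ennreal_leI split: split_indicator)
    then have 2: "prob {a<..b} \<le> f v * (b - a)"
      unfolding emeasure_eq_measure using fu ab by (subst (asm) ennreal_le_iff) auto
    show ?thesis unfolding diff using 1 2 by simp
  qed
  show ?thesis
  proof (rule that[of "f u" "f v"])
    show fu: "0 < f u" "0 \<le> f v" using regular_errorD(2,3)[OF f] by auto
    fix a b assume ab: "a \<in> {-A..A}" "b \<in> {-A..A}"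
    have nn: "0 \<le> f u * \<bar>a - b\<bar>" using fu by simp
    have "f u * \<bar>a - b\<bar> \<le> \<bar>error_cdf f a - error_cdf f b\<bar> \<and> \<bar>error_cdf f a - error_cdf f b\<bar> \<le> f v * \<bar>a - b\<bar>"
    proof (cases "a \<le> b")
      case True
      then have "\<bar>a - b\<bar> = b - a" by simp
      with main[OF ab True] nn show ?thesis by (simp add: abs_minus_commute[of "error_cdf f a"])
    next
      case False
      then have "\<bar>a - b\<bar> = a - b" by simp
      with main[OF ab(2,1)] nn False show ?thesis by simp
    qed
    then show "f u * \<bar>a - b\<bar> \<le> \<bar>error_cdf f a - error_cdf f b\<bar>"
      "\<bar>error_cdf f a - error_cdf f b\<bar> \<le> f v * \<bar>a - b\<bar>" by auto
  qed
qed

text \<open>An estimated probability may fall outside the range of \<open>F\<close> on the interval,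
  so it is clipped first. Clipping is a contraction fixing that range and does not increase the
  error. The preimage is monotone in \<open>u\<close>, hence measurable.\<close>

lemma Lipschitz_left_inverse:
  fixes F :: "real \<Rightarrow> real"
  assumes A: "0 < A" and c: "0 < c" and mono: "mono F"
    and lower: "\<And>a b. a \<in> {-A..A} \<Longrightarrow> b \<in> {-A..A} \<Longrightarrow> c * \<bar>a - b\<bar> \<le> \<bar>F a - F b\<bar>"
    and upper: "\<And>a b. a \<in> {-A..A} \<Longrightarrow> b \<in> {-A..A} \<Longrightarrow> \<bar>F a - F b\<bar> \<le> M * \<bar>a - b\<bar>"
  obtains G where "G \<in> borel_measurable borel" "\<And>u a. a \<in> {-A..A} \<Longrightarrow> \<bar>G u - a\<bar> \<le> \<bar>u - F a\<bar> / c"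
proof -
  define clip where "clip u = max (F (- A)) (min (F A) u)" for u
  have FA: "F (- A) \<le> F A" using mono A by (intro monoD[OF mono]) auto
  have clipF: "clip (F a) = F a" if "a \<in> {-A..A}" for a
    using monoD[OF mono, of "- A" a] monoD[OF mono, of a A] that by (simp add: clip_def)
  have contr: "\<bar>clip u - clip v\<bar> \<le> \<bar>u - v\<bar>" for u v unfolding clip_def by linarith
  have cont: "continuous_on {-A..A} F"
    unfolding continuous_on_def
  proof
    fix a assume a: "a \<in> {-A..A}"
    have "((\<lambda>b. M * \<bar>b - a\<bar>) \<longlongrightarrow> M * \<bar>a - a\<bar>) (at a within {-A..A})" by (intro tendsto_intros)
    then have lim: "((\<lambda>b. M * \<bar>b - a\<bar>) \<longlongrightarrow> 0) (at a within {-A..A})" by simp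
    have "((\<lambda>b. F b - F a) \<longlongrightarrow> 0) (at a within {-A..A})"
    proof (rule Lim_null_comparison[OF _ lim])
      show "\<forall>\<^sub>F b in at a within {-A..A}. norm (F b - F a) \<le> M * \<bar>b - a\<bar>"
        unfolding eventually_at using upper a by (intro exI[of _ 1]) auto
    qed
    then show "(F \<longlongrightarrow> F a) (at a within {-A..A})" using LIM_zero_iff by blast
  qed
  have "\<exists>a\<in>{-A..A}. F a = clip u" for u
  proof -
    have "F (- A) \<le> clip u" "clip u \<le> F A" using FA by (auto simp: clip_def)
    then show ?thesis using IVT'[OF _ _ _ cont, of "clip u"] A by auto
  qed
  then obtain G where G: "\<And>u. G u \<in> {-A..A}" "\<And>u. F (G u) = clip u" by metis
  show ?thesis
  proof (rule that[of G])
    show "\<bar>G u - a\<bar> \<le> \<bar>u - F a\<bar> / c" if a: "a \<in> {-A..A}" for u a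
    proof -
      have "c * \<bar>G u - a\<bar> \<le> \<bar>F (G u) - F a\<bar>" by (intro lower G a)
      also have "\<dots> = \<bar>clip u - clip (F a)\<bar>" by (simp add: G clipF[OF a])
      also have "\<dots> \<le> \<bar>u - F a\<bar>" by (rule contr)
      finally show ?thesis using c by (simp add: pos_le_divide_eq mult.commute)
    qed
    have "mono G"
    proof (rule monoI, rule ccontr)
      fix u v :: real assume uv: "u \<le> v" and "\<not> G u \<le> G v"
      then have lt: "G v < G u" by simp
      then have "F (G v) \<le> F (G u)" by (intro monoD[OF mono]) simp
      moreover have "clip u \<le> clip v" using uv by (auto simp: clip_def)
      ultimately have "F (G v) = F (G u)" by (simp add: G)
      then have "c * \<bar>G v - G u\<bar> \<le> 0" using lower[OF G(1) G(1), of v u] by simp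
      then show False using c lt by (simp add: mult_le_0_iff)
    qed
    then show "G \<in> borel_measurable borel" by (rule borel_measurable_mono)
  qed
qed

section \<open>The threshold estimator\<close>

text \<open>As the scale is positive, the response is at most \<open>t\<close> exactly if the error
  is at most \<open>(t - \<mu> x) / \<sigma> x\<close>; so the conditional mean of the indicator is
  the distribution function at this point.\<close>

lemma bounded_regression_observation_law:
  fixes \<mu> \<sigma> :: "real ^ 'd::finite \<Rightarrow> real"
  assumes f: "regular_error f" and h: "h \<in> covariate_densities C"
    and \<mu>[measurable]: "\<mu> \<in> borel_measurable borel" and \<sigma>[measurable]: "\<sigma> \<in> borel_measurable borel"
    and \<sigma>_pos: "\<And>x. 0 < \<sigma> x"
  shows "bounded_regression (observation_law f \<mu> \<sigma> h) (indicator {z. snd z \<le> t}) (\<lambda>x. error_cdf f ((t - \<mu> x) / \<sigma> x))"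
proof -
  interpret P: prob_space "observation_law f \<mu> \<sigma> h" using assms by (intro prob_space_observation_law)
  interpret F: prob_space "lborel_density f" using f by (rule prob_space_regular_error)
  note [measurable] = error_cdf_borel[OF f]
  define r where "r x = error_cdf f ((t - \<mu> x) / \<sigma> x)" for x
  have r[measurable]: "r \<in> borel_measurable borel" unfolding r_def[abs_def] by measurable
  have r01: "0 \<le> r x" "r x \<le> 1" for x unfolding r_def using error_cdf_nonneg[OF f] error_cdf_le_1[OF f] by auto
  have Wm[measurable]: "indicator {z :: (real ^ 'd) \<times> real. snd z \<le> t} \<in> borel_measurable borel"
    by measurable
  have "bounded_regression (observation_law f \<mu> \<sigma> h) (indicator {z. snd z \<le> t}) r"
  proof
    show "sets (observation_law f \<mu> \<sigma> h) = sets borel" by simp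
    show "indicator {z :: (real ^ 'd) \<times> real. snd z \<le> t} \<in> borel_measurable borel" by (rule Wm)
    show "0 \<le> (indicator {z. snd z \<le> t} z :: real)" "(indicator {z. snd z \<le> t} z :: real) \<le> 1"
      for z :: "(real ^ 'd) \<times> real" by (auto split: split_indicator)
    show "r \<in> borel_measurable borel" by (rule r)
    show "0 \<le> r x" "r x \<le> 1" for x by (rule r01)+
    fix g :: "real ^ 'd \<Rightarrow> real"
    assume g[measurable]: "g \<in> borel_measurable borel" and g1: "\<And>x. \<bar>g x\<bar> \<le> 1"
    let ?u = "\<lambda>z. g (fst z) * (indicator {z. snd z \<le> t} z - r (fst z))"
    have um: "?u \<in> borel_measurable borel" by measurable
    have ub: "\<bar>?u z\<bar> \<le> 1" for z
    proof -
      have "\<bar>(indicator {z. snd z \<le> t} z :: real) - r (fst z)\<bar> \<le> 1"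
        using r01[of "fst z"] by (auto split: split_indicator)
      then have "\<bar>g (fst z)\<bar> * \<bar>(indicator {z. snd z \<le> t} z :: real) - r (fst z)\<bar> \<le> 1 * 1"
        using g1 by (intro mult_mono) auto
      then show ?thesis by (simp add: abs_mult)
    qed
    have "(\<integral>z. ?u z \<partial>observation_law f \<mu> \<sigma> h)
      = (\<integral>x. (\<integral>e. ?u (x, \<mu> x + \<sigma> x * e) \<partial>lborel_density f) \<partial>lborel_density h)"
      using ub by (intro integral_observation_law(1)[OF f h \<mu> \<sigma> um, of "-1" 1]) (auto simp: abs_le_iff minus_le_iff)
    also have "\<dots> = (\<integral>x. 0 \<partial>lborel_density h)"
    proof (rule Bochner_Integration.integral_cong[OF refl])
      fix x
      have eq: "?u (x, \<mu> x + \<sigma> x * e) = g x * (indicator {..(t - \<mu> x) / \<sigma> x} e - r x)" for e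
        using \<sigma>_pos[of x] by (auto simp: field_simps split: split_indicator)
      have "(\<integral>e. g x * (indicator {..(t - \<mu> x) / \<sigma> x} e - r x) \<partial>lborel_density f)
         = g x * (F.prob {..(t - \<mu> x) / \<sigma> x} - r x)"
      proof -
        have "integrable (lborel_density f) (indicator {..(t - \<mu> x) / \<sigma> x} :: real \<Rightarrow> real)"
          by (intro integrable_real_indicator) (auto simp: F.emeasure_eq_measure)
        then show ?thesis using F.prob_space by (simp add: Bochner_Integration.integral_diff)
      qed
      also have "\<dots> = 0" by (simp add: r_def error_cdf_def)
      finally show "(\<integral>e. ?u (x, \<mu> x + \<sigma> x * e) \<partial>lborel_density f) = 0" unfolding eq .
    qed
    finally show "(\<integral>z. ?u z \<partial>observation_law f \<mu> \<sigma> h) = 0" by simp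
  qed
  then show ?thesis by (simp add: r_def[abs_def])
qed

text \<open>Identifies the loss weighted by \<open>h\<close> with an expectation over a new
  observation, the form in which \<open>aggregate_risk\<close> is stated.\<close>

lemma nn_integral_covariate:
  fixes g :: "real ^ 'd::finite \<Rightarrow> real"
  assumes f: "regular_error f" and h: "h \<in> covariate_densities C"
    and \<mu>[measurable]: "\<mu> \<in> borel_measurable borel" and \<sigma>[measurable]: "\<sigma> \<in> borel_measurable borel"
    and g[measurable]: "g \<in> borel_measurable borel" and g0: "\<And>x. 0 \<le> g x" and gK: "\<And>x. g x \<le> K"
  shows "(\<integral>\<^sup>+x. ennreal (g x * h x) \<partial>lborel) = ennreal (\<integral>z. g (fst z) \<partial>observation_law f \<mu> \<sigma> h)"
proof -
  interpret H: prob_space "lborel_density h" using h by (rule prob_space_covariate_density)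
  interpret F: prob_space "lborel_density f" using f by (rule prob_space_regular_error)
  have h'[measurable]: "h \<in> borel_measurable borel" using h by (simp add: covariate_densities_def)
  have "(\<integral>z. g (fst z) \<partial>observation_law f \<mu> \<sigma> h) = (\<integral>x. g x \<partial>lborel_density h)"
    using integral_observation_law(1)[OF f h \<mu> \<sigma>, of "\<lambda>z. g (fst z)" 0 K] g0 gK F.prob_space by simp
  also have "ennreal \<dots> = (\<integral>\<^sup>+x. ennreal (g x) \<partial>lborel_density h)"
    using g0 gK H.integral_between[of g 0 K] by (intro nn_integral_eq_integral[symmetric]) auto
  also have "\<dots> = (\<integral>\<^sup>+x. ennreal (g x * h x) \<partial>lborel)"
    using g0 by (simp add: nn_integral_density ennreal_mult' mult.commute)
  finally show ?thesis by simp
qed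

text \<open>The thresholds \<open>0\<close> and \<open>1\<close> determine the location \<open>m\<close> and the inverse scale \<open>t\<close>:
  \<open>a\<^sub>0 = - m t\<close> and \<open>a\<^sub>1 - a\<^sub>0 = t\<close>.\<close>

lemma location_from_thresholds:
  fixes m t \<kappa> A a0 a1 b0 b1 :: real
  assumes \<kappa>: "0 < \<kappa>" "\<kappa> \<le> t" and a0: "a0 = - m * t" and a1: "a1 = (1 - m) * t" and A: "\<bar>a0\<bar> \<le> A"
  shows "\<bar>m - (- b0 / max (b1 - b0) \<kappa>)\<bar> \<le> (1 / \<kappa> + A / \<kappa>\<^sup>2) * (\<bar>b0 - a0\<bar> + \<bar>b1 - a1\<bar>)"
proof -
  define T where "T = max (b1 - b0) \<kappa>"
  have T: "\<kappa> \<le> T" "0 < T" "0 < t" using \<kappa> by (auto simp: T_def)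
  have t: "t = a1 - a0" by (simp add: a0 a1 algebra_simps)
  have Tt: "\<bar>T - t\<bar> \<le> \<bar>b0 - a0\<bar> + \<bar>b1 - a1\<bar>"
    using \<kappa>(2) unfolding T_def t by linarith
  have "m - (- b0 / T) = (b0 - a0) / T + a0 * (t - T) / (t * T)"
    using T by (simp add: a0 field_simps)
  then have "\<bar>m - (- b0 / T)\<bar> \<le> \<bar>(b0 - a0) / T\<bar> + \<bar>a0 * (t - T) / (t * T)\<bar>"
    by (metis abs_triangle_ineq)
  also have "\<bar>(b0 - a0) / T\<bar> = \<bar>b0 - a0\<bar> / T" using T by (simp add: abs_divide)
  also have "\<bar>a0 * (t - T) / (t * T)\<bar> = \<bar>a0\<bar> * \<bar>T - t\<bar> / (t * T)"
    using T by (simp add: abs_divide abs_mult abs_minus_commute)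
  also have "\<bar>b0 - a0\<bar> / T \<le> (\<bar>b0 - a0\<bar> + \<bar>b1 - a1\<bar>) / \<kappa>"
    using T \<kappa> by (intro frac_le) auto
  also have "\<bar>a0\<bar> * \<bar>T - t\<bar> / (t * T) \<le> A * (\<bar>b0 - a0\<bar> + \<bar>b1 - a1\<bar>) / (\<kappa> * \<kappa>)"
    using T \<kappa> A Tt by (intro frac_le mult_mono) auto
  finally show ?thesis by (simp add: T_def power2_eq_square distrib_right distrib_left add_divide_distrib)
qed

lemma abs_exp_diff_le:
  fixes u v :: real
  assumes "exp u \<le> T" "exp v \<le> T"
  shows "\<bar>exp u - exp v\<bar> \<le> T * \<bar>u - v\<bar>"
proof -
  have *: "exp u - exp v \<le> T * (u - v)" if "exp u \<le> T" "v \<le> u" for u v :: real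
  proof -
    have "1 - exp (v - u) \<le> u - v" using exp_ge_add_one_self[of "v - u"] by linarith
    then have "exp u * (1 - exp (v - u)) \<le> exp u * (u - v)" by (intro mult_left_mono) auto
    also have "\<dots> \<le> T * (u - v)" using that by (intro mult_right_mono) auto
    finally show ?thesis by (simp add: right_diff_distrib exp_add[symmetric])
  qed
  show ?thesis
  proof (cases "v \<le> u")
    case True then show ?thesis using *[of u v] assms by simp
  next
    case False then show ?thesis using *[of v u] assms by (simp add: abs_minus_commute[of "exp u"])
  qed
qed

lemma minimax_upper_bound:
  fixes B :: "nat \<Rightarrow> real"
  assumes f: "regular_error f" and \<gamma>: "0 < \<gamma>" "\<gamma> \<le> 1" and L: "L > 0" and B0: "B 0 > 0"
    and C: "C > 1" and C': "C' > 0" and \<alpha>: "\<alpha> = real s + \<gamma>"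
  shows "\<exists>K>0. \<forall>n\<ge>1. minimax_risk n f (multi_index_class p s \<gamma> L B :: (real ^ 'd::finite \<Rightarrow> real) set)
       (scale_functions C') (covariate_densities C) \<le> ennreal (K * real n powr (- (2 * \<alpha> / (2 * \<alpha> + 1))))"
proof -
  let ?D = "real CARD('d)" and ?Q = "multi_index_class p s \<gamma> L B :: (real ^ 'd \<Rightarrow> real) set"
  have D: "1 \<le> ?D" by (simp add: Suc_leI)
  have \<alpha>0: "0 < \<alpha>" using \<alpha> \<gamma> by simp
  \<comment> \<open>\<open>\<kappa>\<close> and \<open>T\<close> bound the inverse scale on the cube
    from below and above, and \<open>A\<close> then bounds all arguments of the distribution
    function for thresholds in \<open>[0, 1]\<close>.\<close>
  define T where "T = exp (?D * C')"
  define \<kappa> where "\<kappa> = exp (- (?D * C'))"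
  have T: "1 \<le> T" using C' by (simp add: T_def)
  have \<kappa>: "0 < \<kappa>" by (simp add: \<kappa>_def)
  define b where "b = real p * B 0"
  have b: "0 \<le> b" using B0 by (simp add: b_def)
  define A where "A = (1 + b) * T"
  have A: "0 < A" unfolding A_def using b T by (intro mult_pos_pos) auto
  obtain K1 where K1: "0 < K1" and approx_\<mu>: "\<And>\<delta>. 0 < \<delta> \<Longrightarrow> \<delta> \<le> 1 \<Longrightarrow>
    \<exists>M. uniform_net ?Q M b (K1 * \<delta> powr \<alpha>) \<and> real (card M) \<le> exp (K1 / \<delta>)"
    unfolding b_def
    using multi_index_approximation[where 'd = 'd and p = p and B = B, OF \<gamma> less_imp_le[OF L] \<alpha>] by blast
  define Cs where "Cs = {c :: real ^ 'd. \<forall>i. \<bar>c $ i\<bar> \<le> C'}"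
  have Cs: "\<bar>c $ i\<bar> \<le> C'" if "c \<in> Cs" for c i using that by (simp add: Cs_def)
  obtain K2 where K2: "0 \<le> K2" and net_c: "\<And>\<delta>. 0 < \<delta> \<Longrightarrow> \<delta> \<le> 1 \<Longrightarrow>
     has_net Cs (\<lambda>c c'. \<forall>i. \<bar>c $ i - c' $ i\<bar> \<le> \<delta> powr \<alpha> / ?D) (exp (K2 / \<delta>))"
    using box_net[where G = Cs and C = C' and a = \<alpha> and D = ?D, OF Cs] D \<alpha>0 C' by auto
  have Cs_T: "\<kappa> \<le> exp (- (c \<bullet> x))" "exp (- (c \<bullet> x)) \<le> T" if "c \<in> Cs" "x \<in> cbox 0 1" for c x
    using abs_inner_cube_le[of c C' x] Cs[OF that(1)] that(2) by (auto simp: \<kappa>_def T_def abs_le_iff)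
  obtain q Mx where q: "0 < q" and Mx: "0 \<le> Mx"
    and lower: "\<And>a b. a \<in> {-A..A} \<Longrightarrow> b \<in> {-A..A} \<Longrightarrow> q * \<bar>a - b\<bar> \<le> \<bar>error_cdf f a - error_cdf f b\<bar>"
    and upper: "\<And>a b. a \<in> {-A..A} \<Longrightarrow> b \<in> {-A..A} \<Longrightarrow> \<bar>error_cdf f a - error_cdf f b\<bar> \<le> Mx * \<bar>a - b\<bar>"
    using error_cdf_bi_Lipschitz[OF f A] by blast
  obtain G where G[measurable]: "G \<in> borel_measurable borel"
    and G_inv: "\<And>u a. a \<in> {-A..A} \<Longrightarrow> \<bar>G u - a\<bar> \<le> \<bar>u - error_cdf f a\<bar> / q"
    using Lipschitz_left_inverse[OF A q error_cdf_mono[OF f] lower upper] by blast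
  \<comment> \<open>The uniform error of the best candidate per
    \<open>\<delta> powr \<alpha>\<close>: \<open>Mx\<close> is the Lipschitz constant of the
    distribution function, \<open>T * K1\<close> stems from the location and
    \<open>T * (1 + b)\<close> from the scale.\<close>
  define E where "E = Mx * (T * (K1 + 1 + b))"
  have E: "0 \<le> E" unfolding E_def using Mx T K1 b by (intro mult_nonneg_nonneg) auto
  \<comment> \<open>Lipschitz constant of the recovery of \<open>\<mu> x\<close> from the two
    probabilities: \<open>1 / q\<close> for inverting the distribution function, the rest from
    \<open>location_from_thresholds\<close>.\<close>
  define H where "H = (1 / \<kappa> + A / \<kappa>\<^sup>2) / q"
  \<comment> \<open>Each of the two thresholds contributes \<open>2 * (K1 + K2) + E\<^sup>2\<close>;
    the added 1 ensures positivity.\<close>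
  define K where "K = 2 * H\<^sup>2 * (2 * (2 * (K1 + K2) + E\<^sup>2)) + 1"
  have K: "0 < K"
    unfolding K_def using K1 K2 by (intro add_nonneg_pos mult_nonneg_nonneg) auto
  have main: "minimax_risk n f ?Q (scale_functions C') (covariate_densities C)
      \<le> ennreal (K * real n powr (- (2 * \<alpha> / (2 * \<alpha> + 1))))" if n: "n \<ge> 1" for n
  proof -
    define \<rho> where "\<rho> = real n powr (- (2 * \<alpha> / (2 * \<alpha> + 1)))"
    \<comment> \<open>The balance point: by \<open>\<delta>\<alpha>\<close> and
      \<open>n\<delta>\<close> the squared mesh and the entropy over \<open>n\<close> both equal
      \<open>\<rho>\<close> up to constants.\<close>
    define \<delta> where "\<delta> = real n powr (- (1 / (2 * \<alpha> + 1)))"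
    have \<delta>: "0 < \<delta>" "\<delta> \<le> 1"
      using n \<alpha>0 powr_mono[of "- (1 / (2 * \<alpha> + 1))" 0 "real n"] by (auto simp: \<delta>_def)
    have \<delta>\<alpha>: "(\<delta> powr \<alpha>)\<^sup>2 = \<rho>"
      using n by (simp add: \<delta>_def \<rho>_def powr_powr powr_power)
    have n\<delta>: "1 / (\<delta> * real n) = \<rho>"
    proof -
      have "\<delta> * real n = real n powr (- (1 / (2 * \<alpha> + 1)) + 1)" using n powr_add[of "real n" "- (1 / (2 * \<alpha> + 1))" 1] by (simp add: \<delta>_def)
      also have "- (1 / (2 * \<alpha> + 1)) + 1 = 2 * \<alpha> / (2 * \<alpha> + 1)" using \<alpha>0 by (simp add: field_simps)
      finally show ?thesis by (simp add: \<rho>_def powr_minus divide_inverse)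
    qed
    obtain M where M_uniform: "uniform_net ?Q M b (K1 * \<delta> powr \<alpha>)" and card_M: "real (card M) \<le> exp (K1 / \<delta>)"
      using approx_\<mu>[OF \<delta>] by blast
    have M: "finite M" "\<And>m. m \<in> M \<Longrightarrow> continuous_on UNIV m" "\<And>m x. m \<in> M \<Longrightarrow> \<bar>m x\<bar> \<le> b"
      using M_uniform unfolding uniform_net_def by simp_all
    have M_net: "\<exists>m\<in>M. \<forall>x\<in>cbox 0 1. \<bar>\<mu> x - m x\<bar> \<le> K1 * \<delta> powr \<alpha>" if "\<mu> \<in> ?Q" for \<mu>
      using M_uniform that unfolding uniform_net_def by simp
    obtain N where N: "N \<subseteq> Cs" "finite N" "real (card N) \<le> exp (K2 / \<delta>)"
      and N_net: "\<And>c. c \<in> Cs \<Longrightarrow> \<exists>c'\<in>N. \<forall>i. \<bar>c $ i - c' $ i\<bar> \<le> \<delta> powr \<alpha> / ?D"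
      using net_c[OF \<delta>] unfolding has_net_def by blast
    define J where "J = M \<times> N"
    have J: "finite J" using M N by (simp add: J_def)
    define r where "r t mc x = error_cdf f ((t - fst mc x) * exp (- (snd mc \<bullet> x)))"
      for t :: real and mc :: "(real ^ 'd \<Rightarrow> real) \<times> (real ^ 'd)" and x
    have r_meas: "r t mc \<in> borel_measurable borel" if "mc \<in> J" for t mc
    proof -
      have "continuous_on UNIV (\<lambda>x. (t - fst mc x) * exp (- (snd mc \<bullet> x)))"
        using that M(2)[of "fst mc"] by (intro continuous_intros) (auto simp: J_def)
      then show ?thesis unfolding r_def[abs_def]
        by (intro measurable_compose[OF borel_measurable_continuous_onI error_cdf_borel[OF f]])
    qed
    have r_bounds: "0 \<le> r t mc x \<and> r t mc x \<le> 1" for t mc x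
      unfolding r_def using error_cdf_nonneg[OF f] error_cdf_le_1[OF f] by auto
    define W where "W t = (indicator {z. snd z \<le> t} :: (real ^ 'd) \<times> real \<Rightarrow> real)" for t
    define ag where "ag t z x = aggregate (W t) J (r t) n z x" for t z x
    \<comment> \<open>The true inverse scale is at least \<open>\<kappa>\<close>, so truncating the
      estimated one there cannot increase its error and keeps the denominator away from 0.\<close>
    define est where "est z x = - G (ag 0 z x) / max (G (ag 1 z x) - G (ag 0 z x)) \<kappa>" for z x
    have sup_le: "risk n f est \<mu> \<sigma> h \<le> ennreal (K * \<rho>)"
      and est_in: "est \<in> estimators n"
      if \<mu>: "\<mu> \<in> ?Q" and \<sigma>: "\<sigma> \<in> scale_functions C'" and h: "h \<in> covariate_densities C" for \<mu> \<sigma> h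
    proof -
      obtain c where c: "c \<in> Cs" and \<sigma>_eq: "\<sigma> = (\<lambda>x. exp (c \<bullet> x))"
        using \<sigma> by (auto simp: scale_functions_def Cs_def inner_vec_def)
      have \<mu>m[measurable]: "\<mu> \<in> borel_measurable borel"
        using multi_index_class_continuous[OF \<mu> \<gamma>(1)] by (rule borel_measurable_continuous_onI)
      have \<sigma>m[measurable]: "\<sigma> \<in> borel_measurable borel"
        unfolding \<sigma>_eq by (intro borel_measurable_continuous_onI continuous_intros)
      have \<sigma>_pos: "0 < \<sigma> x" for x by (simp add: \<sigma>_eq)
      have \<mu>b: "\<bar>\<mu> x\<bar> \<le> b" for x unfolding b_def by (rule multi_index_class_bounded[OF \<mu>])
      define P where "P = observation_law f \<mu> \<sigma> h"
      define r0 where "r0 t x = error_cdf f ((t - \<mu> x) / \<sigma> x)" for t x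
      have reg: "bounded_regression P (W t) (r0 t)" for t
        unfolding P_def W_def r0_def[abs_def] by (rule bounded_regression_observation_law[OF f h \<mu>m \<sigma>m \<sigma>_pos])
      let ?Pn = "PiM {..<n} (\<lambda>_. P)"
      have prob_P: "prob_space P" using reg[of 0] by (simp add: bounded_regression_def)
      obtain m where m: "m \<in> M" "\<And>x. x \<in> cbox 0 1 \<Longrightarrow> \<bar>\<mu> x - m x\<bar> \<le> K1 * \<delta> powr \<alpha>"
        using M_net[OF \<mu>] by blast
      obtain c' where c': "c' \<in> N" "\<And>i. \<bar>c $ i - c' $ i\<bar> \<le> \<delta> powr \<alpha> / ?D"
        using N_net[OF c] by blast
      have c'Cs: "c' \<in> Cs" using c' N by auto
      have j: "(m, c') \<in> J" using m c' by (simp add: J_def)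
      have J_ne: "J \<noteq> {}" using j by auto
      have arg: "(t - y) * w \<in> {-A..A}" if "0 \<le> t" "t \<le> 1" "\<bar>y\<bar> \<le> b" "0 \<le> w" "w \<le> T" for t y w
      proof -
        have "\<bar>(t - y) * w\<bar> \<le> (1 + b) * T" unfolding abs_mult using that by (intro mult_mono) auto
        then show ?thesis by (auto simp: A_def abs_le_iff)
      qed
      have approx: "\<bar>r t (m, c') x - r0 t x\<bar> \<le> E * \<delta> powr \<alpha>"
        if t: "0 \<le> t" "t \<le> 1" and x: "x \<in> cbox 0 1" for t x
      proof -
        let ?w = "exp (- (c \<bullet> x))" and ?w' = "exp (- (c' \<bullet> x))"
        have eq: "(t - \<mu> x) / \<sigma> x = (t - \<mu> x) * ?w" by (simp add: \<sigma>_eq exp_minus divide_inverse)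
        have "\<bar>(- (c' \<bullet> x)) - (- (c \<bullet> x))\<bar> = \<bar>(c - c') \<bullet> x\<bar>" by (simp add: inner_diff_left)
        also have "\<dots> \<le> ?D * (\<delta> powr \<alpha> / ?D)" using c'(2) x by (intro abs_inner_cube_le) auto
        finally have "\<bar>(- (c' \<bullet> x)) - (- (c \<bullet> x))\<bar> \<le> \<delta> powr \<alpha>" by simp
        then have "T * \<bar>(- (c' \<bullet> x)) - (- (c \<bullet> x))\<bar> \<le> T * \<delta> powr \<alpha>" using T by (intro mult_left_mono) auto
        then have w: "\<bar>?w' - ?w\<bar> \<le> T * \<delta> powr \<alpha>"
          using abs_exp_diff_le[OF Cs_T(2)[OF c'Cs x] Cs_T(2)[OF c x]] by linarith
        have "(t - m x) * ?w' - (t - \<mu> x) * ?w = (\<mu> x - m x) * ?w' + (t - \<mu> x) * (?w' - ?w)"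
          by (simp add: algebra_simps)
        then have "\<bar>(t - m x) * ?w' - (t - \<mu> x) * ?w\<bar> \<le> \<bar>(\<mu> x - m x) * ?w'\<bar> + \<bar>(t - \<mu> x) * (?w' - ?w)\<bar>"
          by (simp only: abs_triangle_ineq)
        also have "\<dots> \<le> (K1 * \<delta> powr \<alpha>) * T + (1 + b) * (T * \<delta> powr \<alpha>)"
          unfolding abs_mult
        proof (intro add_mono mult_mono)
          show "\<bar>\<mu> x - m x\<bar> \<le> K1 * \<delta> powr \<alpha>" by (rule m(2)[OF x])
          show "\<bar>?w'\<bar> \<le> T" using Cs_T(2)[OF c'Cs x] by simp
          show "\<bar>t - \<mu> x\<bar> \<le> 1 + b" using t \<mu>b[of x] by linarith
          show "\<bar>?w' - ?w\<bar> \<le> T * \<delta> powr \<alpha>" by (rule w)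
        qed (use K1 b in auto)
        also have "\<dots> = T * (K1 + 1 + b) * \<delta> powr \<alpha>" by (simp add: algebra_simps)
        finally have d: "\<bar>(t - m x) * ?w' - (t - \<mu> x) * ?w\<bar> \<le> T * (K1 + 1 + b) * \<delta> powr \<alpha>" .
        have "\<bar>r t (m, c') x - r0 t x\<bar> \<le> Mx * \<bar>(t - m x) * ?w' - (t - \<mu> x) * ?w\<bar>"
          unfolding r_def r0_def eq fst_conv snd_conv
          using t M(3)[OF m(1)] \<mu>b Cs_T(2)[OF c'Cs x] Cs_T(2)[OF c x] by (intro upper arg) auto
        also have "\<dots> \<le> Mx * (T * (K1 + 1 + b) * \<delta> powr \<alpha>)" using d Mx by (intro mult_left_mono) auto
        finally show ?thesis by (simp add: E_def mult.assoc)
      qed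
      have r0m[measurable]: "r0 t \<in> borel_measurable borel" for t
        using reg[of t] by (simp add: bounded_regression_def bounded_regression_axioms_def)
      have r0_bounds: "0 \<le> r0 t x" "r0 t x \<le> 1" for t x
        unfolding r0_def using error_cdf_nonneg[OF f] error_cdf_le_1[OF f] by auto
      \<comment> \<open>The bound \<open>approx\<close> holds on the cube only; the expectation is
        therefore rewritten as an integral against \<open>h\<close>, which vanishes
        elsewhere.\<close>
      have int_approx: "(\<integral>y. (r t (m, c') (fst y) - r0 t (fst y))\<^sup>2 \<partial>P) \<le> E\<^sup>2 * \<rho>" if t: "0 \<le> t" "t \<le> 1" for t
      proof -
        note [measurable] = r_meas[OF j, of t]
        have "\<bar>r t (m, c') x - r0 t x\<bar> \<le> 1" for x
          using r_bounds[of t "(m, c')" x] r0_bounds[of t x] by linarith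
        then have sq1: "(r t (m, c') x - r0 t x)\<^sup>2 \<le> 1" for x by (simp add: abs_square_le_1)
        have h0: "h x = 0" if "x \<notin> cbox 0 1" for x using h that by (auto simp: covariate_densities_def)
        have hnn: "0 \<le> h x" for x
        proof (cases "x \<in> cbox 0 1")
          case True
          then have "1 / C \<le> h x" using h by (auto simp: covariate_densities_def)
          moreover have "0 \<le> 1 / C" using C by simp
          ultimately show ?thesis by linarith
        next
          case False then show ?thesis using h0 by simp
        qed
        have "ennreal (\<integral>y. (r t (m, c') (fst y) - r0 t (fst y))\<^sup>2 \<partial>P)
            = (\<integral>\<^sup>+x. ennreal ((r t (m, c') x - r0 t x)\<^sup>2 * h x) \<partial>lborel)"
          unfolding P_def using sq1 by (intro nn_integral_covariate[OF f h \<mu>m \<sigma>m, symmetric]) auto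
        also have "\<dots> \<le> (\<integral>\<^sup>+x. ennreal (E\<^sup>2 * \<rho> * h x) \<partial>lborel)"
        proof (intro nn_integral_mono ennreal_leI)
          fix x :: "real ^ 'd"
          show "(r t (m, c') x - r0 t x)\<^sup>2 * h x \<le> E\<^sup>2 * \<rho> * h x"
          proof (cases "x \<in> cbox 0 1")
            case True
            have "\<bar>r t (m, c') x - r0 t x\<bar>\<^sup>2 \<le> (E * \<delta> powr \<alpha>)\<^sup>2"
              using approx[OF t True] by (intro power_mono) auto
            then have "(r t (m, c') x - r0 t x)\<^sup>2 \<le> E\<^sup>2 * \<rho>" by (simp add: power_mult_distrib \<delta>\<alpha>)
            then show ?thesis using hnn by (intro mult_right_mono) auto
          next
            case False then show ?thesis using h0 by simp
          qed
        qed
        also have "\<dots> = ennreal (E\<^sup>2 * \<rho>)"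
        proof -
          have hm: "h \<in> borel_measurable borel" and h1: "(\<integral>\<^sup>+x. ennreal (h x) \<partial>lborel) = 1"
            using h by (auto simp: covariate_densities_def)
          have "(\<integral>\<^sup>+x. ennreal (E\<^sup>2 * \<rho> * h x) \<partial>lborel) = (\<integral>\<^sup>+x. ennreal (E\<^sup>2 * \<rho>) * ennreal (h x) \<partial>lborel)"
            by (intro nn_integral_cong ennreal_mult') (simp add: \<rho>_def)
          also have "\<dots> = ennreal (E\<^sup>2 * \<rho>) * 1" using hm h1 by (subst nn_integral_cmult) auto
          finally show ?thesis by simp
        qed
        finally show ?thesis by (subst (asm) ennreal_le_iff) (auto simp: \<rho>_def)
      qed
      have ag_meas: "(\<lambda>(z, x). ag t z x) \<in> borel_measurable (PiM {..<n} (\<lambda>_. borel) \<Otimes>\<^sub>M borel)" for t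
        unfolding ag_def by (rule bounded_regression.aggregate_measurable[where r = "r t", OF reg[of t] J r_meas])
      show "est \<in> estimators n"
      proof -
        note [measurable] = ag_meas[of 0] ag_meas[of 1]
        have [measurable]: "(\<lambda>p. ag t (fst p) (snd p)) \<in> borel_measurable (PiM {..<n} (\<lambda>_. borel) \<Otimes>\<^sub>M borel)" for t
          using ag_meas[of t] by (simp add: split_beta')
        show ?thesis unfolding estimators_def est_def split_beta' by simp
      qed
      have card_J: "ln (real (card J)) \<le> (K1 + K2) / \<delta>"
      proof -
        have "real (card J) \<le> exp (K1 / \<delta>) * exp (K2 / \<delta>)"
          using card_M N(3) by (simp add: J_def card_cartesian_product mult_mono)
        also have "\<dots> = exp ((K1 + K2) / \<delta>)" by (simp add: exp_add[symmetric] add_divide_distrib)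
        finally have "ln (real (card J)) \<le> ln (exp ((K1 + K2) / \<delta>))"
          using J J_ne by (subst ln_le_cancel_iff) (auto simp: card_gt_0_iff)
        then show ?thesis by simp
      qed
      define R where "R t z = (\<integral>y. (ag t z (fst y) - r0 t (fst y))\<^sup>2 \<partial>P)" for t z
      have R_le: "(\<integral>z. R t z \<partial>?Pn) \<le> (2 * (K1 + K2) + E\<^sup>2) * \<rho>" if t: "0 \<le> t" "t \<le> 1" for t
      proof -
        have "(\<integral>z. R t z \<partial>?Pn) \<le> 2 * ln (real (card J)) / real n + E\<^sup>2 * \<rho>"
          unfolding R_def ag_def
          using bounded_regression.aggregate_risk[where r = "r t", OF reg[of t] J j r_meas r_bounds n int_approx[OF t]] .
        also have "2 * ln (real (card J)) / real n \<le> 2 * ((K1 + K2) / \<delta>) / real n"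
          using card_J by (intro divide_right_mono mult_left_mono) auto
        also have "2 * ((K1 + K2) / \<delta>) / real n = 2 * (K1 + K2) * (1 / (\<delta> * real n))" by simp
        finally show ?thesis unfolding n\<delta> by (simp add: algebra_simps)
      qed
      have R_int: "integrable ?Pn (R t)" for t
        unfolding R_def[abs_def] ag_def
        by (rule bounded_regression.aggregate_risk_integrable[where r = "r t", OF reg[of t] J J_ne r_meas r_bounds n])
      have R_nn: "0 \<le> R t z" for t z unfolding R_def by (intro Bochner_Integration.integral_nonneg) auto
      have loss: "sq_loss h \<mu> (est z) \<le> ennreal (2 * H\<^sup>2 * (R 0 z + R 1 z))"
        if z: "z \<in> space ?Pn" for z
      proof -
        have z': "z \<in> space (PiM {..<n} (\<lambda>_. borel))" using z by (auto simp: space_PiM P_def)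
        have agz[measurable]: "ag t z \<in> borel_measurable borel" for t
          using measurable_Pair2[OF ag_meas z', of t] by simp
        have ag1: "0 \<le> ag t z x" "ag t z x \<le> 1" for t x
          unfolding ag_def by (rule bounded_regression.aggregate_bounds[where r = "r t", OF reg[of t] J J_ne r_bounds n])+
        have sqb: "(ag t z x - r0 t x)\<^sup>2 \<le> 1" for t x
        proof -
          have "\<bar>ag t z x - r0 t x\<bar> \<le> 1" using ag1[of t x] r0_bounds[of t x] by linarith
          then show ?thesis by (simp add: abs_square_le_1)
        qed
        have fstP: "fst \<in> measurable P borel"
          using borel_measurable_fst_snd(1) unfolding P_def by (subst measurable_cong_sets[OF sets_observation_law refl])
        interpret P: prob_space P by (rule prob_P)
        have iR: "integrable P (\<lambda>y. (ag t z (fst y) - r0 t (fst y))\<^sup>2)" for t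
        proof (rule P.integral_between(1)[where lo = 0 and hi = 1])
          show "(\<lambda>y. (ag t z (fst y) - r0 t (fst y))\<^sup>2) \<in> borel_measurable P"
            by (rule measurable_compose[OF fstP]) measurable
        qed (use sqb in auto)
        have pw: "(\<mu> x - est z x)\<^sup>2 \<le> 2 * H\<^sup>2 * ((ag 0 z x - r0 0 x)\<^sup>2 + (ag 1 z x - r0 1 x)\<^sup>2)"
          if x: "x \<in> cbox 0 1" for x
        proof -
          let ?w = "exp (- (c \<bullet> x))"
          have w: "\<kappa> \<le> ?w" "?w \<le> T" using Cs_T[OF c x] by auto
          have eq: "r0 t x = error_cdf f ((t - \<mu> x) * ?w)" for t
            by (simp add: r0_def \<sigma>_eq exp_minus divide_inverse)
          have in_A: "(t - \<mu> x) * ?w \<in> {-A..A}" if "0 \<le> t" "t \<le> 1" for t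
            using that \<mu>b w by (intro arg) auto
          have inv: "\<bar>G (ag t z x) - (t - \<mu> x) * ?w\<bar> \<le> \<bar>ag t z x - r0 t x\<bar> / q" if "0 \<le> t" "t \<le> 1" for t
            unfolding eq by (rule G_inv[OF in_A[OF that]])
          have "\<bar>\<mu> x - est z x\<bar> \<le> (1 / \<kappa> + A / \<kappa>\<^sup>2)
             * (\<bar>G (ag 0 z x) - (0 - \<mu> x) * ?w\<bar> + \<bar>G (ag 1 z x) - (1 - \<mu> x) * ?w\<bar>)"
            unfolding est_def
            by (rule location_from_thresholds[OF \<kappa> w(1)]) (use in_A[of 0] in auto)
          also have "\<dots> \<le> (1 / \<kappa> + A / \<kappa>\<^sup>2) * (\<bar>ag 0 z x - r0 0 x\<bar> / q + \<bar>ag 1 z x - r0 1 x\<bar> / q)"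
            using \<kappa> A by (intro mult_left_mono add_mono inv) auto
          also have "\<dots> = H * (\<bar>ag 0 z x - r0 0 x\<bar> + \<bar>ag 1 z x - r0 1 x\<bar>)"
            by (simp add: H_def add_divide_distrib[symmetric])
          finally have "\<bar>\<mu> x - est z x\<bar>\<^sup>2 \<le> (H * (\<bar>ag 0 z x - r0 0 x\<bar> + \<bar>ag 1 z x - r0 1 x\<bar>))\<^sup>2"
            by (intro power_mono) auto
          also have "\<dots> = H\<^sup>2 * (\<bar>ag 0 z x - r0 0 x\<bar> + \<bar>ag 1 z x - r0 1 x\<bar>)\<^sup>2" by (rule power_mult_distrib)
          also have "\<dots> \<le> H\<^sup>2 * (2 * ((ag 0 z x - r0 0 x)\<^sup>2 + (ag 1 z x - r0 1 x)\<^sup>2))"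
          proof (intro mult_left_mono)
            have "(u + v)\<^sup>2 \<le> 2 * (u\<^sup>2 + v\<^sup>2)" for u v :: real
              using zero_le_power2[of "u - v"] by (simp add: power2_eq_square algebra_simps)
            from this[of "\<bar>ag 0 z x - r0 0 x\<bar>" "\<bar>ag 1 z x - r0 1 x\<bar>"]
            show "(\<bar>ag 0 z x - r0 0 x\<bar> + \<bar>ag 1 z x - r0 1 x\<bar>)\<^sup>2 \<le> 2 * ((ag 0 z x - r0 0 x)\<^sup>2 + (ag 1 z x - r0 1 x)\<^sup>2)"
              by simp
          qed simp
          finally have le: "(\<mu> x - est z x)\<^sup>2 \<le> H\<^sup>2 * (2 * ((ag 0 z x - r0 0 x)\<^sup>2 + (ag 1 z x - r0 1 x)\<^sup>2))"
            by (simp only: power2_abs)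
          have "H\<^sup>2 * (2 * y) = 2 * H\<^sup>2 * y" for y by simp
          with le show ?thesis by (simp only:)
        qed
        let ?g = "\<lambda>x. 2 * H\<^sup>2 * ((ag 0 z x - r0 0 x)\<^sup>2 + (ag 1 z x - r0 1 x)\<^sup>2)"
        have h0: "h x = 0" if "x \<notin> cbox 0 1" for x using h that by (auto simp: covariate_densities_def)
        have "sq_loss h \<mu> (est z) \<le> (\<integral>\<^sup>+x. ennreal (?g x * h x) \<partial>lborel)"
          unfolding sq_loss_def
        proof (intro nn_integral_mono)
          fix x :: "real ^ 'd"
          show "ennreal ((\<mu> x - est z x)\<^sup>2 * h x) \<le> ennreal (?g x * h x)"
          proof (cases "x \<in> cbox 0 1 \<and> 0 \<le> h x")
            case True
            then show ?thesis using pw[of x] by (intro ennreal_leI mult_right_mono) auto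
          next
            case False
            then have "h x \<le> 0" using h0[of x] by auto
            then show ?thesis by (simp add: ennreal_neg mult_nonneg_nonpos)
          qed
        qed
        also have "\<dots> = ennreal (\<integral>y. ?g (fst y) \<partial>P)"
          unfolding P_def
        proof (rule nn_integral_covariate[OF f h \<mu>m \<sigma>m, where K = "2 * H\<^sup>2 * 2"])
          show "?g \<in> borel_measurable borel" by measurable
          show "0 \<le> ?g x" for x by simp
          show "?g x \<le> 2 * H\<^sup>2 * 2" for x
            using sqb[of 0 x] sqb[of 1 x] by (intro mult_left_mono) auto
        qed
        also have "(\<integral>y. ?g (fst y) \<partial>P) = 2 * H\<^sup>2 * (R 0 z + R 1 z)"
          using iR by (simp add: R_def)
        finally show ?thesis .
      qed
      have "risk n f est \<mu> \<sigma> h = (\<integral>\<^sup>+z. sq_loss h \<mu> (est z) \<partial>?Pn)"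
        by (simp add: risk_def sample_law_def P_def)
      also have "\<dots> \<le> (\<integral>\<^sup>+z. ennreal (2 * H\<^sup>2 * (R 0 z + R 1 z)) \<partial>?Pn)"
        by (intro nn_integral_mono loss)
      also have "\<dots> = ennreal (\<integral>z. 2 * H\<^sup>2 * (R 0 z + R 1 z) \<partial>?Pn)"
        using R_int R_nn by (intro nn_integral_eq_integral) auto
      also have "\<dots> \<le> ennreal (K * \<rho>)"
      proof (rule ennreal_leI)
        have "(\<integral>z. 2 * H\<^sup>2 * (R 0 z + R 1 z) \<partial>?Pn)
          = 2 * H\<^sup>2 * ((\<integral>z. R 0 z \<partial>?Pn) + (\<integral>z. R 1 z \<partial>?Pn))"
          using R_int by simp
        also have "\<dots> \<le> 2 * H\<^sup>2 * ((2 * (K1 + K2) + E\<^sup>2) * \<rho> + (2 * (K1 + K2) + E\<^sup>2) * \<rho>)"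
          by (intro mult_left_mono add_mono R_le) auto
        also have "\<dots> = (K - 1) * \<rho>" by (simp add: K_def algebra_simps)
        also have "\<dots> \<le> K * \<rho>" by (intro mult_right_mono) (auto simp: \<rho>_def)
        finally show "(\<integral>z. 2 * H\<^sup>2 * (R 0 z + R 1 z) \<partial>?Pn) \<le> K * \<rho>" .
      qed
      finally show "risk n f est \<mu> \<sigma> h \<le> ennreal (K * \<rho>)" .
    qed
    show ?thesis
    proof (cases "?Q \<noteq> {} \<and> (scale_functions C' :: (real ^ 'd \<Rightarrow> real) set) \<noteq> {} \<and> (covariate_densities C :: (real ^ 'd \<Rightarrow> real) set) \<noteq> {}")
      case True
      then obtain \<mu> \<sigma> h where "\<mu> \<in> ?Q" "\<sigma> \<in> (scale_functions C' :: (real ^ 'd \<Rightarrow> real) set)"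
        "h \<in> (covariate_densities C :: (real ^ 'd \<Rightarrow> real) set)" by blast
      then have "est \<in> estimators n" by (rule est_in)
      then have "minimax_risk n f ?Q (scale_functions C') (covariate_densities C)
        \<le> (SUP \<mu>\<in>?Q. SUP \<sigma>\<in>scale_functions C'. SUP h\<in>covariate_densities C. risk n f est \<mu> \<sigma> h)"
        unfolding minimax_risk_def by (rule INF_lower)
      also have "\<dots> \<le> ennreal (K * \<rho>)" by (intro SUP_least sup_le)
      finally show ?thesis by (simp add: \<rho>_def)
    next
      \<comment> \<open>Measurability of \<open>est\<close> was obtained for a given choice of
        parameters. If a class is empty, the zero estimator is used instead, the supremum being
        0.\<close>
      case False
      have "(\<lambda>_ _. 0) \<in> (estimators n :: ((nat \<Rightarrow> (real ^ 'd) \<times> real) \<Rightarrow> real ^ 'd \<Rightarrow> real) set)"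
        by (simp add: estimators_def)
      then have "minimax_risk n f ?Q (scale_functions C') (covariate_densities C)
        \<le> (SUP \<mu>\<in>?Q. SUP \<sigma>\<in>scale_functions C'. SUP h\<in>covariate_densities C. risk n f (\<lambda>_ _. 0) \<mu> \<sigma> h)"
        unfolding minimax_risk_def by (rule INF_lower)
      also have "\<dots> \<le> 0" using False by (intro SUP_least) auto
      finally show ?thesis by simp
    qed
  qed
  show ?thesis using K main by blast
qed

section \<open>The minimax rate\<close>

text \<open>Finiteness is part of the claim because \<open>enn2real\<close> maps infinity to 0, so
  the order of the real-valued risk alone would not express the upper bound.\<close>

theorem corollary4:
  fixes p s :: nat
    and \<gamma> \<alpha> L Cbar C' :: real
    and B :: "nat \<Rightarrow> real"
    and f :: "real \<Rightarrow> real"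
    and Q S H :: "(real ^ 'd::finite \<Rightarrow> real) set"
  assumes "p \<ge> 1"
    and "CARD('d) \<ge> 2 \<or> p \<le> 2"
    and "0 < \<gamma>" and "\<gamma> \<le> 1"
    and "\<alpha> = real s + \<gamma>"
    and "L > 0" and "\<And>k. k \<le> s \<Longrightarrow> B k > 0"
    and "Cbar > 1" and "C' > 0"
    and "f \<in> error_densities"
    and "Q = multi_index_class p s \<gamma> L B"
    and "S = scale_functions C'"
    and "H = covariate_densities Cbar"
  shows "(\<forall>\<^sub>F n in sequentially. minimax_risk n f Q S H < \<infinity>)
    \<and> (\<lambda>n. enn2real (minimax_risk n f Q S H))
        \<in> \<Theta>(\<lambda>n. real n powr (- (2 * \<alpha> / (2 * \<alpha> + 1))))"
proof -
  define \<rho> where "\<rho> n = real n powr (- (2 * \<alpha> / (2 * \<alpha> + 1)))" for n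
  have f: "regular_error f" using assms by (intro regular_error_if_error_density) simp
  have "\<exists>c>0. \<forall>n\<ge>1. ennreal (c * \<rho> n) \<le> minimax_risk n f Q S H"
    unfolding assms(11-13) \<rho>_def using assms by (intro minimax_lower_bound f) auto
  then obtain c where c: "c > 0" "\<And>n. n \<ge> 1 \<Longrightarrow> ennreal (c * \<rho> n) \<le> minimax_risk n f Q S H" by blast
  have "\<exists>K>0. \<forall>n\<ge>1. minimax_risk n f Q S H \<le> ennreal (K * \<rho> n)"
    unfolding assms(11-13) \<rho>_def using assms by (intro minimax_upper_bound f) auto
  then obtain K where K: "K > 0" "\<And>n. n \<ge> 1 \<Longrightarrow> minimax_risk n f Q S H \<le> ennreal (K * \<rho> n)" by blast
  have \<rho>: "0 \<le> \<rho> n" for n by (simp add: \<rho>_def)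
  have fin: "minimax_risk n f Q S H < \<infinity>" if "n \<ge> 1" for n
    using le_less_trans[OF K(2)[OF that]] by simp
  have "(\<lambda>n. enn2real (minimax_risk n f Q S H)) \<in> \<Theta>(\<rho>)"
  proof (rule bigthetaI'[OF c(1) K(1)])
    show "\<forall>\<^sub>F n in sequentially. c * norm (\<rho> n) \<le> norm (enn2real (minimax_risk n f Q S H))
        \<and> norm (enn2real (minimax_risk n f Q S H)) \<le> K * norm (\<rho> n)"
      using eventually_ge_at_top[of 1]
    proof eventually_elim
      fix n :: nat assume n: "n \<ge> 1"
      obtain R where R: "minimax_risk n f Q S H = ennreal R" "0 \<le> R"
        using fin[OF n] by (cases "minimax_risk n f Q S H") auto
      have "c * \<rho> n \<le> R" using c(2)[OF n] R by (simp add: ennreal_le_iff)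
      moreover have "R \<le> K * \<rho> n" using K(2)[OF n] R K(1) \<rho>[of n] by (simp add: ennreal_le_iff)
      ultimately show "c * norm (\<rho> n) \<le> norm (enn2real (minimax_risk n f Q S H))
        \<and> norm (enn2real (minimax_risk n f Q S H)) \<le> K * norm (\<rho> n)"
        using R \<rho>[of n] by simp
    qed
  qed
  moreover have "\<forall>\<^sub>F n in sequentially. minimax_risk n f Q S H < \<infinity>"
    using eventually_ge_at_top[of 1] by eventually_elim (rule fin)
  ultimately show ?thesis by (simp add: \<rho>_def[abs_def])
qed

end
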